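(* Let $S_1,\dots,S_m$ be contracting similitudes of $\mathbb{R}^2$ satisfying the Open Set Condition, and let $\Lambda\subset\mathbb{R}^2$ be the associated self-similar set, i.e. the nonempty compact set with $\Lambda=\bigcup_{i=1}^m S_i(\Lambda)$. Assume that $0<\mathcal{H}^1(\Lambda)<\infty$ and that $\Lambda$ is not contained in a line. Then $\Lambda$ is invisible from every $a\in\mathbb{R}^2$, that is, for every $a\in\mathbb{R}^2$, $$\mathcal{H}^1\bigl(P_a(\Lambda\setminus\{a\})\bigr)=0 .$$
   Context: $\mathcal{H}^1$ denotes one-dimensional Hausdorff measure. For $a\in\mathbb{R}^2$, $P_a$ is the radial projection from $a$: $P_a:\mathbb{R}^2\setminus\{a\}\to S^1$, $P_a(x)=\frac{x-a}{|x-a|}$, where $S^1$ is the unit circle in $\mathbb{R}^2$. A contracting similitude of $\mathbb{R}^2$ is a map $S_i(x)=\lambda_i\mathcal{O}_i x+b_i$ with $0<\lambda_i<1$, $\mathcal{O}_i$ an orthogonal transformation of the plane, and $b_i\in\mathbb{R}^2$. The Open Set Condition for $S_1,\dots,S_m$ holds if there exists a nonempty open set $V\subset\mathbb{R}^2$ such that $S_i(V)\subset V$ for all $i$ and $S_i(V)\cap S_j(V)=\emptyset$ for all $i\neq j$. *)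

theory Defs
  imports "HOL-Analysis.Analysis"
begin

text \<open>
  One-dimensional Hausdorff measure, as an outer measure on all subsets. The covering sets are
  arbitrary; finite covers are included because the empty set has diameter 0. Boundedness has to be
  required explicitly because \<^const>\<open>diameter\<close> is real-valued and carries no information about
  unbounded sets. If no admissible cover exists, the infimum is infinite.
\<close>

definition hausdorff1_delta :: "real \<Rightarrow> 'a::metric_space set \<Rightarrow> ennreal" where
  "hausdorff1_delta \<delta> A =
     (INF U \<in> {U :: nat \<Rightarrow> 'a set. A \<subseteq> (\<Union>i. U i) \<and> (\<forall>i. bounded (U i) \<and> diameter (U i) \<le> \<delta>)}.
        (\<Sum>i. ennreal (diameter (U i))))"

definition hausdorff1 :: "'a::metric_space set \<Rightarrow> ennreal" where
  "hausdorff1 A = (SUP \<delta> \<in> {0<..}. hausdorff1_delta \<delta> A)"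

text \<open>Only used away from the centre \<open>a\<close>.\<close>

definition radial_projection :: "real^2 \<Rightarrow> real^2 \<Rightarrow> real^2" where
  "radial_projection a x = (x - a) /\<^sub>R norm (x - a)"

definition invisible_from :: "(real^2) set \<Rightarrow> real^2 \<Rightarrow> bool" where
  "invisible_from A a \<longleftrightarrow> hausdorff1 (radial_projection a ` (A - {a})) = 0"

definition contracting_similitude :: "(real^2 \<Rightarrow> real^2) \<Rightarrow> bool" where
  "contracting_similitude S \<longleftrightarrow>
     (\<exists>r T b. 0 < r \<and> r < 1 \<and> orthogonal_transformation T \<and> (\<forall>x. S x = r *\<^sub>R T x + b))"

definition open_set_condition :: "nat \<Rightarrow> (nat \<Rightarrow> real^2 \<Rightarrow> real^2) \<Rightarrow> bool" where
  "open_set_condition m S \<longleftrightarrow>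
     (\<exists>V. V \<noteq> {} \<and> open V \<and> (\<forall>i\<in>{1..m}. S i ` V \<subseteq> V) \<and>
          (\<forall>i\<in>{1..m}. \<forall>j\<in>{1..m}. i \<noteq> j \<longrightarrow> S i ` V \<inter> S j ` V = {}))"

definition is_self_similar_set :: "nat \<Rightarrow> (nat \<Rightarrow> real^2 \<Rightarrow> real^2) \<Rightarrow> (real^2) set \<Rightarrow> bool" where
  "is_self_similar_set m S \<Lambda> \<longleftrightarrow>
     compact \<Lambda> \<and> \<Lambda> \<noteq> {} \<and> \<Lambda> = (\<Union>i\<in>{1..m}. S i ` \<Lambda>)"

end

theory Submission
  imports Defs
begin

text \<open>
  Write \<open>F e\<close> for the length of the projection \<open>{x \<bullet> e | x \<in> \<Lambda>}\<close>. The open set condition and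
  \<open>0 < H\<^sup>1(\<Lambda>) < \<infinity>\<close> force the contraction ratios to sum to at most 1. As \<open>F\<close> is upper semicontinuous
  and \<open>F e \<le> \<Sum>\<^sub>i r\<^sub>i F (T\<^sub>i\<^sup>* e)\<close>, a maximum principle makes \<open>F\<close> constant on orbit closures of the
  rotation parts, and the projections of distinct cylinders of the same generation overlap in null sets.

  Then \<open>F e = 0\<close> for almost every direction. Suppose \<open>e\<close> is a density point of \<open>{F \<ge> F e - \<epsilon>}\<close> with
  \<open>F e > 0\<close>. If \<open>\<Lambda>\<close> contains pairs of points almost orthogonal to \<open>e\<close>, take small cylinders around such
  a pair: turning \<open>e\<close> slightly slides one projection across the other, and by Fubini they overlap
  substantially on the way, which is impossible. Otherwise the projection is bi-Lipschitz on \<open>\<Lambda>\<close>, and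
  comparing two nearby projections at a Lebesgue density point shows that \<open>\<Lambda>\<close> is contained in a line.

  Finally, at a small scale the radial projection in a direction of view with \<open>F = 0\<close> is close to the
  orthogonal one, so its image there has length at most \<open>\<epsilon>\<close> times the natural mass of the cylinders
  that are seen. The Vitali covering theorem sums this up.
\<close>

section \<open>Vitali coverings and density points\<close>

text \<open>The projection length is only upper semicontinuous in the direction: near a given
  direction it may drop. Two devices answer this. Bounds are proved for open neighbourhoods of
  projections, so that one bound serves all nearby directions; and directions are studied at density
  points of the level sets, on which the drop is at most \<epsilon>. The rotation parts may generate
  a finite or an infinite group; one compactness argument on orbit closures covers both, with
  recurrence of isometries supplying the inverses that words do not give.

  No self-similar measure is built. Its role is taken by sums of the ratios of words of one length:
  the total is at most 1, and the part belonging to a family of cylinders is, up to the factor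
  \<open>F e\<close>, the length of their joint projection.

  Directions are vectors \<open>(1, \<beta>)\<close> and not unit vectors. Displacements between
  projected points are then affine in \<beta>, which turns an average over directions into an
  average over translations, and the same \<beta> indexes the lines of sight orthogonal to these
  vectors.\<close>

text \<open>Vitali's theorem covers \<open>S\<close> by countably many disjoint balls up to a null
  set, and a bound on finite subfamilies passes to the countable union. \<open>P\<close> is left
  free: it is sparseness of a set in one use and a bound by masses of cylinders in the other.
  \<open>S\<close> need not be measurable, hence the cover \<open>W\<close>.\<close>

lemma vitali_outer_measure_le:
  fixes S E :: "'a::euclidean_space set"
  assumes SE: "S \<subseteq> E" and E: "E \<in> sets lebesgue"
    and fine: "\<And>x d. x \<in> S \<Longrightarrow> 0 < d \<Longrightarrow> \<exists>r. 0 < r \<and> r < d \<and> P x r"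
    and bound: "\<And>C. finite C \<Longrightarrow>
        pairwise (\<lambda>i j. disjnt (cball (fst i) (snd i)) (cball (fst j) (snd j))) C \<Longrightarrow>
        (\<And>x r. (x, r) \<in> C \<Longrightarrow> x \<in> S \<and> 0 < r \<and> P x r) \<Longrightarrow>
        (\<Sum>(x, r)\<in>C. measure lebesgue (E \<inter> cball x r)) \<le> b"
  shows "\<exists>W. S \<subseteq> W \<and> W \<in> lmeasurable \<and> measure lebesgue W \<le> b"
proof -
  let ?K = "{(x, r). x \<in> S \<and> 0 < r \<and> P x r}"
  have cov: "\<exists>i. i \<in> ?K \<and> x \<in> cball (fst i) (snd i) \<and> snd i < d" if "x \<in> S" "0 < d" for x and d :: real
  proof -
    obtain r where "0 < r" "r < d" "P x r"
      using fine[OF \<open>x \<in> S\<close> \<open>0 < d\<close>] by blast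
    then show ?thesis
      using \<open>x \<in> S\<close> by (intro exI[of _ "(x, r)"]) auto
  qed
  have pos: "0 < snd i" if "i \<in> ?K" for i
    using that by auto
  obtain C where C: "countable C" "C \<subseteq> ?K"
    "pairwise (\<lambda>i j. disjnt (cball (fst i) (snd i)) (cball (fst j) (snd j))) C"
    "negligible (S - (\<Union>i\<in>C. cball (fst i) (snd i)))"
    by (rule Vitali_covering_theorem_cballs[OF pos cov])
  let ?A = "\<lambda>i. E \<inter> cball (fst i) (snd i)"
  have A: "?A i \<in> lmeasurable" for i
    using fmeasurable_Int_fmeasurable[OF lmeasurable_cball E] by (simp add: Int_commute)
  have fin: "measure lebesgue (\<Union>i\<in>C'. ?A i) \<le> b" if "C' \<subseteq> C" "finite C'" for C'
  proof -
    have "measure lebesgue (\<Union>i\<in>C'. ?A i) \<le> (\<Sum>i\<in>C'. measure lebesgue (?A i))"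
      using \<open>finite C'\<close> A by (intro measure_UNION_le) (auto simp: fmeasurableD)
    also have "\<dots> \<le> b"
      using bound[of C'] that C(2,3) pairwise_subset[OF C(3) \<open>C' \<subseteq> C\<close>]
      by (force simp: case_prod_unfold)
    finally show ?thesis .
  qed
  let ?V = "\<Union>i\<in>C. ?A i" and ?N = "S - (\<Union>i\<in>C. cball (fst i) (snd i))"
  have V: "?V \<in> lmeasurable" "measure lebesgue ?V \<le> b"
    using fmeasurable_UN_bound[OF C(1) A fin] measure_UN_bound[OF C(1) A fin] by blast+
  show ?thesis
  proof (intro exI conjI)
    show "S \<subseteq> ?V \<union> ?N"
      using SE by auto
    show "?V \<union> ?N \<in> lmeasurable"
      using V(1) C(4) by (simp add: fmeasurable.Un negligible_imp_measurable)
    show "measure lebesgue (?V \<union> ?N) \<le> b"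
      using V C(4) by (simp add: measure_Un_null_set negligible_iff_null_sets fmeasurableD)
  qed
qed

text \<open>\<open>a\<close> is the outer measure of \<open>S\<close>, finite because
  \<open>S\<close> is bounded. Inside an open superset of measure close to \<open>a\<close>, the
  sparse balls give \<open>a \<le> k * a\<close> up to an arbitrarily small error, so
  \<open>a = 0\<close>.\<close>

lemma negligible_non_density_points_bounded:
  fixes S B :: "'a::euclidean_space set"
  assumes SB: "S \<subseteq> B" and B: "B \<in> sets lebesgue" and \<kappa>: "\<kappa> < 1" and "bounded S"
    and sparse: "\<And>x d. x \<in> S \<Longrightarrow> 0 < d \<Longrightarrow>
      \<exists>r. 0 < r \<and> r < d \<and> measure lebesgue (B \<inter> cball x r) \<le> \<kappa> * measure lebesgue (cball x r)"
  shows "negligible S"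
proof -
  define X where "X = {measure lebesgue U |U. S \<subseteq> U \<and> U \<in> lmeasurable}"
  define a where "a = Inf X"
  \<comment> \<open>\<kappa> may be negative, since the later use with \<open>1 - \<epsilon>\<close>
    puts no upper bound on \<epsilon>; the estimates below need a nonnegative factor.\<close>
  define k where "k = max 0 \<kappa>"
  have k: "0 \<le> k" "k < 1" "\<kappa> \<le> k" using \<kappa> by (auto simp: k_def)
  obtain R where "S \<subseteq> ball 0 R" using \<open>bounded S\<close> bounded_subset_ballD by blast
  then have "X \<noteq> {}" by (auto simp: X_def)
  have bdd: "bdd_below X" unfolding X_def by (rule bdd_belowI[of _ 0]) auto
  have "0 \<le> a" unfolding a_def by (rule cInf_greatest[OF \<open>X \<noteq> {}\<close>]) (auto simp: X_def)
  \<comment> \<open>The selected balls lie in an almost optimal open set \<open>U\<close> and cover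
    almost all of \<open>S\<close>. As \<open>S\<close> is part of \<open>B\<close>, it occupies at
    most the fraction \<open>k\<close> of them.\<close>
  have step: "a \<le> k * (a + 2 * \<delta>)" if "\<delta> > 0" for \<delta>
  proof -
    have "\<exists>x\<in>X. x < a + \<delta>"
      using \<open>X \<noteq> {}\<close> bdd \<open>\<delta> > 0\<close> unfolding a_def by (meson cInf_lessD less_add_same_cancel1)
    then obtain U0 where U0: "S \<subseteq> U0" "U0 \<in> lmeasurable" "measure lebesgue U0 < a + \<delta>"
      by (auto simp: X_def)
    obtain U where U: "open U" "U0 \<subseteq> U" "U - U0 \<in> lmeasurable" "emeasure lebesgue (U - U0) < ennreal \<delta>"
      using sets_lebesgue_outer_open[OF fmeasurableD[OF U0(2)] \<open>\<delta> > 0\<close>] by blast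
    have UU: "U = U0 \<union> (U - U0)" using U(2) by blast
    have "U \<in> lmeasurable" using U0(2) U(3) by (subst UU) (rule fmeasurable.Un)
    have "measure lebesgue (U - U0) < \<delta>"
      using U(3,4) \<open>\<delta> > 0\<close> by (simp add: emeasure_eq_measure2 ennreal_less_iff)
    moreover have "measure lebesgue U \<le> measure lebesgue U0 + measure lebesgue (U - U0)"
      using U0(2) U(3) by (subst UU) (rule measure_Un_le, auto simp: fmeasurableD)
    ultimately have U: "open U" "U0 \<subseteq> U" "U \<in> lmeasurable" "measure lebesgue U < measure lebesgue U0 + \<delta>"
      using U \<open>U \<in> lmeasurable\<close> by auto
    have "0 \<le> measure lebesgue U" by simp
    have "\<exists>W. S \<subseteq> W \<and> W \<in> lmeasurable \<and> measure lebesgue W \<le> k * measure lebesgue U"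
    proof (rule vitali_outer_measure_le[OF SB B, where b = "k * measure lebesgue U" and P = "\<lambda>x r. cball x r \<subseteq> U \<and>
        measure lebesgue (B \<inter> cball x r) \<le> \<kappa> * measure lebesgue (cball x r)"])
      fix x and d :: real
      assume "x \<in> S" "0 < d"
      then obtain e where e: "e > 0" "cball x e \<subseteq> U"
        using U U0 open_contains_cball by (metis subsetD)
      obtain r where r: "0 < r" "r < min d e" "measure lebesgue (B \<inter> cball x r) \<le> \<kappa> * measure lebesgue (cball x r)"
        using sparse[OF \<open>x \<in> S\<close>, of "min d e"] \<open>0 < d\<close> \<open>e > 0\<close> by auto
      have "cball x r \<subseteq> cball x e" using r by auto
      then show "\<exists>r. 0 < r \<and> r < d \<and> cball x r \<subseteq> U \<and>
        measure lebesgue (B \<inter> cball x r) \<le> \<kappa> * measure lebesgue (cball x r)"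
        using r e by (intro exI[of _ r]) auto
    next
      fix C :: "('a \<times> real) set"
      assume C: "finite C"
        "pairwise (\<lambda>i j. disjnt (cball (fst i) (snd i)) (cball (fst j) (snd j))) C"
        "\<And>x r. (x, r) \<in> C \<Longrightarrow> x \<in> S \<and> 0 < r \<and> cball x r \<subseteq> U \<and>
          measure lebesgue (B \<inter> cball x r) \<le> \<kappa> * measure lebesgue (cball x r)"
      have "(\<Sum>(x, r)\<in>C. measure lebesgue (B \<inter> cball x r)) \<le> (\<Sum>(x, r)\<in>C. k * measure lebesgue (cball x r))"
      proof (rule sum_mono, clarify)
        fix x r assume "(x, r) \<in> C"
        have "measure lebesgue (B \<inter> cball x r) \<le> \<kappa> * measure lebesgue (cball x r)"
          using C(3) \<open>(x, r) \<in> C\<close> by blast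
        also have "\<dots> \<le> k * measure lebesgue (cball x r)"
          using k by (intro mult_right_mono) auto
        finally show "measure lebesgue (B \<inter> cball x r) \<le> k * measure lebesgue (cball x r)" .
      qed
      also have "\<dots> = k * (\<Sum>i\<in>C. measure lebesgue (cball (fst i) (snd i)))"
        by (simp add: sum_distrib_left case_prod_unfold)
      also have "(\<Sum>i\<in>C. measure lebesgue (cball (fst i) (snd i))) = measure lebesgue (\<Union>i\<in>C. cball (fst i) (snd i))"
        using C(1,2) by (subst measure_UNION') (auto simp: case_prod_unfold)
      also have "\<dots> \<le> measure lebesgue U"
        using C(1,3) U(3) by (intro measure_mono_fmeasurable) fastforce+
      finally show "(\<Sum>(x, r)\<in>C. measure lebesgue (B \<inter> cball x r)) \<le> k * measure lebesgue U"
        using k by (simp add: mult_left_mono)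
    qed
    then obtain W where W: "S \<subseteq> W" "W \<in> lmeasurable" "measure lebesgue W \<le> k * measure lebesgue U"
      by blast
    then have "a \<le> measure lebesgue W"
      using bdd unfolding a_def by (intro cInf_lower) (auto simp: X_def)
    with W(3) have "a \<le> k * measure lebesgue U"
      by linarith
    also have "\<dots> \<le> k * (a + 2 * \<delta>)"
      using k U U0 by (intro mult_left_mono) auto
    finally show ?thesis .
  qed
  have "a \<le> 0"
  proof (rule ccontr)
    assume "\<not> a \<le> 0"
    then have "0 < a" by simp
    define \<delta> where "\<delta> = (1 - k) * a / 4"
    have "\<delta> > 0" using \<open>0 < a\<close> k by (simp add: \<delta>_def)
    have "a \<le> k * a + 2 * k * \<delta>" using step[OF \<open>\<delta> > 0\<close>] by (simp add: algebra_simps)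
    also have "\<dots> \<le> k * a + 2 * 1 * \<delta>" using k \<open>\<delta> > 0\<close> by (intro add_left_mono mult_right_mono mult_left_mono) auto
    also have "\<dots> < k * a + (1 - k) * a" using \<open>0 < a\<close> k by (simp add: \<delta>_def)
    finally show False by (simp add: algebra_simps)
  qed
  with \<open>0 \<le> a\<close> have "a = 0" by simp
  show ?thesis
    unfolding negligible_outer
  proof (intro allI impI)
    fix e :: real assume "e > 0"
    then have "\<exists>x\<in>X. x < e"
      using \<open>X \<noteq> {}\<close> bdd \<open>a = 0\<close> unfolding a_def by (metis cInf_lessD)
    then show "\<exists>T. S \<subseteq> T \<and> T \<in> lmeasurable \<and> measure lebesgue T < e"
      by (auto simp: X_def)
  qed
qed

lemma negligible_non_density_points:
  fixes S B :: "'a::euclidean_space set"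
  assumes SB: "S \<subseteq> B" and B: "B \<in> sets lebesgue" and \<kappa>: "\<kappa> < 1"
    and sparse: "\<And>x d. x \<in> S \<Longrightarrow> 0 < d \<Longrightarrow>
      \<exists>r. 0 < r \<and> r < d \<and> measure lebesgue (B \<inter> cball x r) \<le> \<kappa> * measure lebesgue (cball x r)"
  shows "negligible S"
proof -
  have "negligible (S \<inter> ball 0 (real n))" for n
    using SB B \<kappa> sparse by (intro negligible_non_density_points_bounded[of _ B \<kappa>]) auto
  then have "negligible (\<Union>n. S \<inter> ball 0 (real n))"
    by (intro negligible_Union_nat)
  also have "(\<Union>n. S \<inter> ball 0 (real n)) = S"
    using reals_Archimedean2 by fastforce
  finally show ?thesis .
qed

section \<open>Similitude systems and their cylinders\<close>

definition proj :: "'a::real_inner \<Rightarrow> 'a set \<Rightarrow> real set" where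
  "proj e X = (\<lambda>x. x \<bullet> e) ` X"

text \<open>A neighbourhood absorbs both a small change of direction and the distortion of a
  cylinder under radial projection, so the measure bounds are stated for it.\<close>

definition thicken :: "real \<Rightarrow> real set \<Rightarrow> real set" where
  "thicken \<delta> X = (\<Union>x\<in>X. ball x \<delta>)"

lemma compact_proj: "compact X \<Longrightarrow> compact (proj e X)"
  unfolding proj_def by (intro compact_continuous_image continuous_intros)

lemma lmeasurable_proj: "compact X \<Longrightarrow> proj e X \<in> lmeasurable"
  by (simp add: compact_proj lmeasurable_compact)

lemma open_thicken: "open (thicken \<delta> X)"
  by (auto simp: thicken_def)

lemma bounded_thicken: "bounded X \<Longrightarrow> bounded (thicken \<delta> X)"
proof -
  assume "bounded X"
  then obtain B where "\<And>x. x \<in> X \<Longrightarrow> norm x \<le> B" by (auto simp: bounded_iff)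
  then have "norm x \<le> B + \<delta>" if "x \<in> thicken \<delta> X" for x
    using that by (force simp: thicken_def dist_real_def)
  then show ?thesis by (auto simp: bounded_iff)
qed

lemma lmeasurable_thicken: "bounded X \<Longrightarrow> thicken \<delta> X \<in> lmeasurable"
  by (simp add: bounded_thicken open_thicken lmeasurable_open)

lemma thicken_memI: "x \<in> X \<Longrightarrow> \<bar>t - x\<bar> < \<delta> \<Longrightarrow> t \<in> thicken \<delta> X"
  by (force simp: thicken_def dist_real_def)

lemma thicken_mono: "\<delta> \<le> \<delta>' \<Longrightarrow> thicken \<delta> X \<subseteq> thicken \<delta>' X"
  by (auto simp: thicken_def)

lemma sets_thicken: "thicken \<delta> X \<in> sets lebesgue"
  using borel_open[OF open_thicken] by simp

lemma measure_affine_real: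
  "measure lebesgue ((\<lambda>t. m * t + c) ` S) = \<bar>m\<bar> * measure lebesgue (S :: real set)"
  using measure_lebesgue_affine[of m c S] by simp

lemma lmeasurable_affine_real:
  fixes S :: "real set"
  assumes "S \<in> lmeasurable"
  shows "(\<lambda>t. m * t + c) ` S \<in> lmeasurable"
proof (cases "m = 0")
  case True
  then show ?thesis
    by (intro lmeasurable_compact finite_imp_compact) (auto intro: finite_subset[of _ "{c}"])
next
  case False
  have scale: "(*) m ` S \<in> sets lebesgue"
  proof -
    have "(*\<^sub>R) (1 / m) -` S \<inter> space lebesgue \<in> sets lebesgue"
      using assms by (intro measurable_sets[OF lebesgue_measurable_scaling]) (auto simp: fmeasurableD)
    moreover have "(*) m ` S = (*\<^sub>R) (1 / m) -` S"
      using False by (force simp: image_iff)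
    ultimately show ?thesis by simp
  qed
  have "emeasure lebesgue ((*) m ` S) = ennreal \<bar>m\<bar> * ennreal (measure lebesgue S)"
    using emeasure_lebesgue_affine[of m 0 S] emeasure_eq_measure2[OF assms] by simp
  then have "emeasure lebesgue ((*) m ` S) < \<infinity>"
    by (simp add: ennreal_mult_less_top)
  then have "(*) m ` S \<in> lmeasurable" using scale by (simp add: fmeasurable_def)
  then have "(+) c ` (*) m ` S \<in> lmeasurable" by (rule measurable_translation)
  then show ?thesis by (simp add: image_image add.commute)
qed

text \<open>The dimension is arbitrary; the plane is needed only when directions are parametrised.
  The open set condition will enter through one consequence, the bound 1 on the sum of the
  ratios.\<close>

locale similitude_system =
  fixes I :: "'i set" and r :: "'i \<Rightarrow> real" and T :: "'i \<Rightarrow> 'a::euclidean_space \<Rightarrow> 'a"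
    and b :: "'i \<Rightarrow> 'a" and \<Lambda> :: "'a set"
  assumes finite_I: "finite I"
    and ratio: "i \<in> I \<Longrightarrow> 0 < r i" "i \<in> I \<Longrightarrow> r i < 1"
    and orth: "i \<in> I \<Longrightarrow> orthogonal_transformation (T i)"
    and compact: "compact \<Lambda>"
    and nonempty: "\<Lambda> \<noteq> {}"
    and self_similar: "\<Lambda> = (\<Union>i\<in>I. (\<lambda>x. r i *\<^sub>R T i x + b i) ` \<Lambda>)"
begin

primrec Sw :: "'i list \<Rightarrow> 'a \<Rightarrow> 'a" where
  "Sw [] x = x"
| "Sw (i # w) x = r i *\<^sub>R T i (Sw w x) + b i"

primrec rw :: "'i list \<Rightarrow> real" where
  "rw [] = 1"
| "rw (i # w) = r i * rw w"

text \<open>The linear part of \<^term>\<open>Sw w\<close> acts on covectors by its adjoint; see \<open>inner_Sw\<close>.\<close>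

primrec Aw :: "'i list \<Rightarrow> 'a \<Rightarrow> 'a" where
  "Aw [] e = e"
| "Aw (i # w) e = Aw w (adjoint (T i) e)"

definition words :: "nat \<Rightarrow> 'i list set" where
  "words n = {w \<in> lists I. length w = n}"

definition cyl :: "'i list \<Rightarrow> 'a set" where
  "cyl w = Sw w ` \<Lambda>"

text \<open>The function \<open>F\<close> of the overview, taken on all vectors and not only on unit
  vectors.\<close>

definition shadow :: "'a \<Rightarrow> real" where
  "shadow e = measure lebesgue (proj e \<Lambda>)"

lemma Sw_append: "Sw (u @ v) x = Sw u (Sw v x)"
  by (induction u) auto

lemma rw_append: "rw (u @ v) = rw u * rw v"
  by (induction u) auto

lemma Aw_append: "Aw (u @ v) e = Aw v (Aw u e)"
  by (induction u arbitrary: e) auto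

lemma rw_pos: "w \<in> lists I \<Longrightarrow> 0 < rw w"
  by (induction w) (auto simp: ratio)

lemma linear_T: "i \<in> I \<Longrightarrow> linear (T i)"
  using orth orthogonal_transformation_linear by blast

text \<open>An orthogonal map is onto and preserves inner products, so its adjoint is its
  inverse.\<close>

lemma orth_adjoint:
  assumes "i \<in> I"
  shows "norm (adjoint (T i) e) = norm e" "linear (adjoint (T i))" "T i x \<bullet> e = x \<bullet> adjoint (T i) e"
proof -
  show 1: "T i x \<bullet> e = x \<bullet> adjoint (T i) e" for x e
    by (simp add: adjoint_works linear_T assms)
  show "linear (adjoint (T i))"
    by (simp add: adjoint_linear linear_T assms)
  obtain y where y: "T i y = e"
    using orth[OF assms] orthogonal_transformation_surj by (metis surjD)
  have "x \<bullet> adjoint (T i) e = x \<bullet> y" for x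
    using 1[of x e] orth[OF assms] y by (metis orthogonal_transformation_def)
  then have "adjoint (T i) e = y"
    using vector_eq_ldot by blast
  then show "norm (adjoint (T i) e) = norm e"
    using y orth[OF assms] orthogonal_transformation_norm by metis
qed

lemma inner_Sw: "w \<in> lists I \<Longrightarrow> (Sw w x - Sw w y) \<bullet> e = rw w * ((x - y) \<bullet> Aw w e)"
proof (induction w arbitrary: e)
  case (Cons i w)
  then have "i \<in> I" by simp
  have "(Sw (i # w) x - Sw (i # w) y) \<bullet> e = r i * (T i (Sw w x - Sw w y) \<bullet> e)"
    using linear_T[OF \<open>i \<in> I\<close>] by (simp add: linear_diff algebra_simps inner_diff_left)
  also have "T i (Sw w x - Sw w y) \<bullet> e = (Sw w x - Sw w y) \<bullet> adjoint (T i) e"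
    using orth_adjoint(3)[OF \<open>i \<in> I\<close>] .
  finally show ?case using Cons by simp
qed simp

lemma norm_Aw: "w \<in> lists I \<Longrightarrow> norm (Aw w e) = norm e"
  by (induction w arbitrary: e) (auto simp: orth_adjoint)

lemma linear_Aw: "w \<in> lists I \<Longrightarrow> linear (Aw w)"
proof (induction w)
  case Nil then show ?case by (simp add: linear_iff)
next
  case (Cons i w)
  then have "linear (Aw w \<circ> adjoint (T i))"
    by (intro linear_compose) (auto simp: orth_adjoint)
  then show ?case by (simp add: o_def linear_iff)
qed

lemma Aw_diff: "w \<in> lists I \<Longrightarrow> Aw w (x - y) = Aw w x - Aw w y"
  by (simp add: linear_Aw linear_diff)

lemma dist_Sw: "w \<in> lists I \<Longrightarrow> dist (Sw w x) (Sw w y) = rw w * dist x y"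
proof (induction w)
  case (Cons i w)
  then have i: "i \<in> I" by simp
  have "Sw (i # w) x - Sw (i # w) y = r i *\<^sub>R T i (Sw w x - Sw w y)"
    using linear_T[OF i] by (simp add: linear_diff scaleR_diff_right)
  then show ?case
    using Cons orthogonal_transformation_norm[OF orth[OF i]] ratio[OF i]
    by (simp add: dist_norm)
qed simp

lemma Sw_mem: "w \<in> lists I \<Longrightarrow> x \<in> \<Lambda> \<Longrightarrow> Sw w x \<in> \<Lambda>"
proof (induction w)
  case (Cons i w)
  then have "Sw (i # w) x \<in> (\<Union>i\<in>I. (\<lambda>x. r i *\<^sub>R T i x + b i) ` \<Lambda>)" by auto
  then show ?case using self_similar by auto
qed simp

lemma cyl_subset: "w \<in> lists I \<Longrightarrow> cyl w \<subseteq> \<Lambda>"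
  using Sw_mem by (auto simp: cyl_def)

lemma cyl_append_subset: "v \<in> lists I \<Longrightarrow> cyl (u @ v) \<subseteq> cyl u"
  using Sw_mem by (auto simp: cyl_def Sw_append)

lemma finite_words: "finite (words n)"
  using finite_lists_length_eq[OF finite_I, of n] by (simp add: words_def lists_eq_set)

lemma words_lists: "w \<in> words n \<Longrightarrow> w \<in> lists I"
  by (simp add: words_def)

lemma words_0: "words 0 = {[]}"
  by (auto simp: words_def)

lemma words_Suc: "words (Suc n) = (\<lambda>(i, w). i # w) ` (I \<times> words n)"
  by (force simp: words_def length_Suc_conv)

lemma sum_words_Suc: "(\<Sum>w\<in>words (Suc n). f w) = (\<Sum>i\<in>I. \<Sum>w\<in>words n. f (i # w))"
  unfolding words_Suc
  by (subst sum.reindex) (auto simp: inj_on_def sum.cartesian_product case_prod_unfold)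

lemma sum_rw: "(\<Sum>w\<in>words n. rw w) = (\<Sum>i\<in>I. r i) ^ n"
proof (induction n)
  case (Suc n)
  then show ?case
    by (simp add: sum_words_Suc sum_distrib_left[symmetric] sum_distrib_right)
qed (simp add: words_0)

lemma Un_cyl: "(\<Union>w\<in>words n. cyl w) = \<Lambda>"
proof (induction n)
  case 0 then show ?case by (simp add: words_0 cyl_def)
next
  case (Suc n)
  have eq: "cyl (i # w) = (\<lambda>x. r i *\<^sub>R T i x + b i) ` cyl w" for i w
    by (simp add: cyl_def image_image)
  have "(\<Union>w\<in>words (Suc n). cyl w) = (\<Union>i\<in>I. \<Union>w\<in>words n. cyl (i # w))"
    unfolding words_Suc by auto
  also have "\<dots> = (\<Union>i\<in>I. (\<lambda>x. r i *\<^sub>R T i x + b i) ` (\<Union>w\<in>words n. cyl w))"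
    by (simp only: eq image_UN)
  finally have "(\<Union>w\<in>words (Suc n). cyl w) = \<dots>" .
  then show ?case using Suc self_similar by simp
qed

lemma I_nonempty: "I \<noteq> {}"
  using nonempty self_similar by auto

definition rmin :: real where "rmin = Min (r ` I)"

lemma rmin: "0 < rmin" "i \<in> I \<Longrightarrow> rmin \<le> r i" "rmin < 1"
proof -
  show "0 < rmin" "i \<in> I \<Longrightarrow> rmin \<le> r i" for i
    using finite_I I_nonempty ratio by (auto simp: rmin_def)
  then show "rmin < 1" using I_nonempty ratio by (meson ex_in_conv le_less_trans)
qed

lemma ratio_bound: obtains \<rho> where "0 < \<rho>" "\<rho> < 1" "\<And>n w. w \<in> words n \<Longrightarrow> rw w \<le> \<rho> ^ n"
proof
  let ?\<rho> = "Max (r ` I)"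
  have le: "r i \<le> ?\<rho>" if "i \<in> I" for i
    using finite_I that by auto
  show "?\<rho> < 1" using finite_I I_nonempty ratio by auto
  show pos: "0 < ?\<rho>" using finite_I I_nonempty ratio by (auto simp: Max_gr_iff)
  show "rw w \<le> ?\<rho> ^ n" if "w \<in> words n" for n w
    using that
  proof (induction n arbitrary: w)
    case (Suc n)
    then show ?case
      using le ratio rw_pos[OF words_lists] pos by (auto simp: words_Suc less_imp_le intro!: mult_mono)
  qed (simp add: words_0)
qed

lemma eventually_rw_less:
  assumes "0 < \<delta>"
  shows "\<forall>\<^sub>F n in sequentially. \<forall>w\<in>words n. rw w < \<delta>"
proof -
  obtain \<rho> where \<rho>: "0 < \<rho>" "\<rho> < 1" "\<And>n w. w \<in> words n \<Longrightarrow> rw w \<le> \<rho> ^ n"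
    by (rule ratio_bound) blast
  have "(\<lambda>n. \<rho> ^ n) \<longlonglongrightarrow> 0" using \<rho> by (intro LIMSEQ_power_zero) auto
  then have "\<forall>\<^sub>F n in sequentially. \<rho> ^ n < \<delta>"
    using \<open>0 < \<delta>\<close> by (rule order_tendstoD)
  then show ?thesis
    by eventually_elim (use \<rho>(3) in fastforce)
qed

text \<open>Prolong an address of \<open>x\<close> until the size falls to \<open>s\<close> or
  below; the last letter costs at most the factor \<open>rmin\<close>. The induction is on a number
  \<open>n\<close> of letters that is certain to suffice.\<close>

lemma ex_cyl_size:
  assumes "x \<in> \<Lambda>" "0 < s" "s \<le> 1"
  shows "\<exists>w \<in> lists I. x \<in> cyl w \<and> rw w \<le> s \<and> rmin * s \<le> rw w"
proof -
  obtain \<rho> where \<rho>: "0 < \<rho>" "\<rho> < 1" "\<And>n w. w \<in> words n \<Longrightarrow> rw w \<le> \<rho> ^ n"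
    by (rule ratio_bound) blast
  obtain n where "\<rho> ^ n < s" using real_arch_pow_inv[OF \<open>0 < s\<close> \<rho>(2)] by blast
  then have "\<rho> ^ n \<le> s" by simp
  then show ?thesis
    using assms
  proof (induction n arbitrary: x s)
    case 0
    then have "s = 1" by simp
    then show ?case using 0 rmin by (intro bexI[of _ "[]"]) (auto simp: cyl_def)
  next
    case (Suc n)
    obtain i y where i: "i \<in> I" "y \<in> \<Lambda>" "x = r i *\<^sub>R T i y + b i"
      using Suc.prems(2) self_similar by blast
    have ri: "0 < r i" "rmin \<le> r i" "r i < 1" using i ratio rmin by auto
    show ?case
    proof (cases "s \<le> r i")
      case True
      have "[i] \<in> words 1" using i by (simp add: words_def)
      then have "r i \<le> \<rho>" using \<rho>(3)[of "[i]" 1] by simp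
      then have "r i * \<rho> ^ n \<le> \<rho> * \<rho> ^ n" using \<rho> by (intro mult_right_mono) auto
      then have "\<rho> ^ n \<le> s / r i" using ri Suc.prems(1) by (simp add: field_simps)
      moreover have "0 < s / r i" "s / r i \<le> 1" using True ri Suc.prems by auto
      ultimately obtain w where w: "w \<in> lists I" "y \<in> cyl w" "rw w \<le> s / r i" "rmin * (s / r i) \<le> rw w"
        using Suc.IH[of "s / r i" y] i by blast
      then show ?thesis
      proof (intro bexI[of _ "i # w"] conjI)
        show "x \<in> cyl (i # w)" using w(2) i(3) by (auto simp: cyl_def)
        show "rw (i # w) \<le> s" "rmin * s \<le> rw (i # w)"
          using w(3,4) ri by (simp_all add: field_simps)
      qed (use \<open>i \<in> I\<close> w(1) in simp)
    next
      case False
      have "rmin * s \<le> rmin * 1" using Suc.prems rmin by (intro mult_left_mono) auto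
      then show ?thesis
      proof (intro bexI[of _ "[i]"] conjI)
        show "x \<in> cyl [i]" using i unfolding cyl_def by auto
        show "rmin * s \<le> rw [i]" using \<open>rmin * s \<le> rmin * 1\<close> ri by simp
      qed (use \<open>i \<in> I\<close> False in simp_all)
    qed
  qed
qed

lemma inner_Sw_0: "w \<in> lists I \<Longrightarrow> Sw w x \<bullet> e = rw w * (x \<bullet> Aw w e) + Sw w 0 \<bullet> e"
  using inner_Sw[of w x 0 e] by (simp add: inner_diff_left)

lemma proj_cyl:
  "w \<in> lists I \<Longrightarrow> proj e (cyl w) = (\<lambda>t. rw w * t + Sw w 0 \<bullet> e) ` proj (Aw w e) \<Lambda>"
  unfolding proj_def cyl_def image_image by (rule image_cong[OF refl], rule inner_Sw_0)

lemma measure_proj_cyl: "w \<in> lists I \<Longrightarrow> measure lebesgue (proj e (cyl w)) = rw w * shadow (Aw w e)"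
  using rw_pos[of w] by (simp add: proj_cyl measure_affine_real shadow_def)

lemma continuous_Sw: "w \<in> lists I \<Longrightarrow> continuous_on X (Sw w)"
proof (induction w)
  case (Cons i w)
  then have "linear (T i)" "continuous_on X (Sw w)" using linear_T by auto
  then have "continuous_on X (\<lambda>x. T i (Sw w x))" by (metis linear_continuous_on_compose)
  then show ?case by (auto intro!: continuous_intros)
qed simp

lemma compact_cyl: "w \<in> lists I \<Longrightarrow> compact (cyl w)"
  unfolding cyl_def by (intro compact_continuous_image continuous_Sw compact)

lemma lmeasurable_proj_cyl: "w \<in> lists I \<Longrightarrow> proj e (cyl w) \<in> lmeasurable"
  by (simp add: lmeasurable_proj compact_cyl)

lemma shadow_nonneg: "0 \<le> shadow e"
  by (simp add: shadow_def)

lemma proj_Un_cyl: "proj e \<Lambda> = (\<Union>w\<in>words n. proj e (cyl w))"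
  by (subst Un_cyl[of n, symmetric]) (auto simp: proj_def)

lemma shadow_le: "shadow e \<le> (\<Sum>w\<in>words n. rw w * shadow (Aw w e))"
proof -
  have "shadow e = measure lebesgue (\<Union>w\<in>words n. proj e (cyl w))"
    unfolding shadow_def by (subst proj_Un_cyl[of _ n]) simp
  also have "\<dots> \<le> (\<Sum>w\<in>words n. measure lebesgue (proj e (cyl w)))"
    using finite_words lmeasurable_proj_cyl words_lists
    by (intro measure_UNION_le) (auto simp: fmeasurableD)
  also have "\<dots> = (\<Sum>w\<in>words n. rw w * shadow (Aw w e))"
    by (intro sum.cong) (auto simp: measure_proj_cyl words_lists)
  finally show ?thesis .
qed

lemma norm_bound: obtains B where "0 < B" "\<And>x. x \<in> \<Lambda> \<Longrightarrow> norm x \<le> B"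
  by (meson bounded_pos compact compact_imp_bounded)

text \<open>A compact projection leaves a margin \<open>d\<close> inside an open superset of almost
  the same measure, and a small change of direction moves it little because \<Lambda> is bounded.
  The neighbourhood makes this stronger than upper semicontinuity of \<open>shadow\<close>.\<close>

lemma shadow_usc:
  assumes "0 < \<epsilon>"
  shows "\<exists>\<delta>>0. \<forall>e'. norm (e' - e) < \<delta> \<longrightarrow> measure lebesgue (thicken \<delta> (proj e' \<Lambda>)) < shadow e + \<epsilon>"
proof -
  obtain B where B: "0 < B" "\<And>x. x \<in> \<Lambda> \<Longrightarrow> norm x \<le> B"
    by (rule norm_bound) blast
  let ?K = "proj e \<Lambda>"
  have K: "?K \<in> lmeasurable" using compact by (rule lmeasurable_proj)
  obtain U where U: "open U" "?K \<subseteq> U" "U - ?K \<in> lmeasurable" "emeasure lebesgue (U - ?K) < ennreal \<epsilon>"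
    using sets_lebesgue_outer_open[OF fmeasurableD[OF K] \<open>0 < \<epsilon>\<close>] by blast
  have UU: "U = ?K \<union> (U - ?K)" using U(2) by blast
  have Um: "U \<in> lmeasurable" using K U(3) by (subst UU) (rule fmeasurable.Un)
  have "measure lebesgue (U - ?K) < \<epsilon>"
    using U(3,4) \<open>0 < \<epsilon>\<close> by (simp add: emeasure_eq_measure2 ennreal_less_iff)
  moreover have "measure lebesgue U \<le> measure lebesgue ?K + measure lebesgue (U - ?K)"
    using K U(3) by (subst UU) (rule measure_Un_le, auto simp: fmeasurableD)
  ultimately have mU: "measure lebesgue U < shadow e + \<epsilon>"
    by (simp add: shadow_def)
  obtain d where d: "d > 0" "(\<Union>x\<in>?K. ball x d) \<subseteq> U"
    using compact_subset_open_imp_ball_epsilon_subset[OF compact_proj[OF compact] U(1,2)] by blast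
  \<comment> \<open>Half of the margin pays for the change of direction, where points have norm at
    most \<open>B\<close>, and half for the thickening.\<close>
  define \<delta> where "\<delta> = min (d / 2) (d / (2 * B))"
  have "\<delta> > 0" using d B by (simp add: \<delta>_def)
  have "thicken \<delta> (proj e' \<Lambda>) \<subseteq> U" if e': "norm (e' - e) < \<delta>" for e'
  proof
    fix t assume "t \<in> thicken \<delta> (proj e' \<Lambda>)"
    then obtain x where x: "x \<in> \<Lambda>" "\<bar>x \<bullet> e' - t\<bar> < \<delta>"
      by (auto simp: thicken_def proj_def dist_real_def)
    have "\<bar>x \<bullet> (e' - e)\<bar> \<le> norm x * norm (e' - e)" by (rule Cauchy_Schwarz_ineq2)
    also have "\<dots> \<le> B * \<delta>" using B x e' by (intro mult_mono) auto
    also have "\<dots> \<le> d / 2" using B by (simp add: \<delta>_def min_def field_simps)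
    finally have "\<bar>x \<bullet> e' - x \<bullet> e\<bar> \<le> d / 2" by (simp add: inner_diff_right)
    moreover have "\<delta> \<le> d / 2" by (simp add: \<delta>_def)
    ultimately have "\<bar>x \<bullet> e - t\<bar> < d" using x by linarith
    then have "t \<in> (\<Union>x\<in>?K. ball x d)" using x by (auto simp: proj_def dist_real_def)
    then show "t \<in> U" using d by blast
  qed
  then have "measure lebesgue (thicken \<delta> (proj e' \<Lambda>)) < shadow e + \<epsilon>" if "norm (e' - e) < \<delta>" for e'
    using that Um mU measure_mono_fmeasurable[of "thicken \<delta> (proj e' \<Lambda>)" U lebesgue]
    by (simp add: open_thicken)
  then show ?thesis using \<open>\<delta> > 0\<close> by blast
qed

end

section \<open>The open set condition\<close>

lemma hausdorff1_delta_antimono: "\<delta> \<le> \<delta>' \<Longrightarrow> hausdorff1_delta \<delta>' A \<le> hausdorff1_delta \<delta> A"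
  unfolding hausdorff1_delta_def by (intro INF_superset_mono) (auto intro: order_trans)

lemma hausdorff1_delta_le: "0 < \<delta> \<Longrightarrow> hausdorff1_delta \<delta> A \<le> hausdorff1 A"
  unfolding hausdorff1_def by (intro SUP_upper) auto

context similitude_system
begin

lemma surj_Sw: "w \<in> lists I \<Longrightarrow> surj (Sw w)"
proof (induction w)
  case (Cons i w)
  then have i: "i \<in> I" and "surj (Sw w)" by auto
  have "\<exists>x. p = Sw (i # w) x" for p
  proof -
    obtain q where q: "T i q = (1 / r i) *\<^sub>R (p - b i)"
      using orthogonal_transformation_surj[OF orth[OF i]] by (metis surjD)
    obtain x where "Sw w x = q" using \<open>surj (Sw w)\<close> by (metis surjD)
    then have "Sw (i # w) x = p" using q ratio[OF i] by simp
    then show ?thesis by blast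
  qed
  then show ?case by (auto simp: surj_def)
qed (simp add: surj_def)

lemma inj_Sw: "w \<in> lists I \<Longrightarrow> inj (Sw w)"
proof (rule injI)
  fix x y assume w: "w \<in> lists I" and "Sw w x = Sw w y"
  then have "rw w * dist x y = 0" using dist_Sw[OF w, of x y] by simp
  then show "x = y" using rw_pos[OF w] by simp
qed

lemma Sw_open_set:
  assumes V: "\<And>i. i \<in> I \<Longrightarrow> (\<lambda>x. r i *\<^sub>R T i x + b i) ` V \<subseteq> V" and "w \<in> lists I"
  shows "Sw w ` V \<subseteq> V"
  using \<open>w \<in> lists I\<close>
proof (induction w)
  case (Cons i w)
  then have "Sw (i # w) ` V \<subseteq> (\<lambda>x. r i *\<^sub>R T i x + b i) ` V" by auto
  then show ?case using V[of i] Cons by auto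
qed auto

lemma Sw_open_set_disjoint:
  assumes V: "\<And>i. i \<in> I \<Longrightarrow> (\<lambda>x. r i *\<^sub>R T i x + b i) ` V \<subseteq> V"
    and disj: "\<And>i j. i \<in> I \<Longrightarrow> j \<in> I \<Longrightarrow> i \<noteq> j \<Longrightarrow>
      (\<lambda>x. r i *\<^sub>R T i x + b i) ` V \<inter> (\<lambda>x. r j *\<^sub>R T j x + b j) ` V = {}"
  shows "u \<in> words n \<Longrightarrow> v \<in> words n \<Longrightarrow> u \<noteq> v \<Longrightarrow> Sw u ` V \<inter> Sw v ` V = {}"
proof (induction n arbitrary: u v)
  case 0 then show ?case by (simp add: words_0)
next
  case (Suc n)
  let ?f = "\<lambda>i x. r i *\<^sub>R T i x + b i"
  obtain i u' where u: "u = i # u'" "i \<in> I" "u' \<in> words n" using Suc.prems(1) by (auto simp: words_Suc)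
  obtain j v' where v: "v = j # v'" "j \<in> I" "v' \<in> words n" using Suc.prems(2) by (auto simp: words_Suc)
  have eq: "Sw (k # w) ` V = ?f k ` Sw w ` V" for k w by (simp add: image_image)
  show ?case
  proof (cases "i = j")
    case True
    then have "Sw u' ` V \<inter> Sw v' ` V = {}" using Suc u v by auto
    moreover have "Sw [i] = ?f i" by (rule ext) simp
    then have "inj (?f i)" using inj_Sw[of "[i]"] u(2) by simp
    ultimately have "?f i ` Sw u' ` V \<inter> ?f i ` Sw v' ` V = {}"
      by (simp flip: image_Int)
    then show ?thesis unfolding u(1) v(1) eq using True by simp
  next
    case False
    have "?f i ` Sw u' ` V \<subseteq> ?f i ` V" "?f j ` Sw v' ` V \<subseteq> ?f j ` V"
      using Sw_open_set[OF V words_lists[OF u(3)]] Sw_open_set[OF V words_lists[OF v(3)]] by (auto intro!: image_mono)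
    then show ?thesis unfolding u(1) v(1) eq using disj[OF u(2) v(2) False] by blast
  qed
qed

lemma rw_ge_rmin_power: "w \<in> words n \<Longrightarrow> rmin ^ n \<le> rw w"
proof (induction n arbitrary: w)
  case (Suc n)
  then obtain i u where u: "w = i # u" "i \<in> I" "u \<in> words n" by (auto simp: words_Suc)
  have "rmin * rmin ^ n \<le> r i * rw u"
    using Suc.IH[OF u(3)] rmin u(2) ratio[OF u(2)] by (intro mult_mono) auto
  then show ?case by (simp add: u)
qed (simp add: words_0)

text \<open>The sets \<open>S\<^sub>w(V)\<close> need not meet the cylinders, but they contain disjoint balls of comparable size at
  comparable distance, so volume bounds the number of cylinders near a point.\<close>

lemma bounded_overlap:
  assumes V: "\<And>i. i \<in> I \<Longrightarrow> (\<lambda>x. r i *\<^sub>R T i x + b i) ` V \<subseteq> V" "open V" "V \<noteq> {}"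
    and disj: "\<And>i j. i \<in> I \<Longrightarrow> j \<in> I \<Longrightarrow> i \<noteq> j \<Longrightarrow>
      (\<lambda>x. r i *\<^sub>R T i x + b i) ` V \<inter> (\<lambda>x. r j *\<^sub>R T j x + b j) ` V = {}"
  shows "\<exists>C::real. \<forall>n U. bounded U \<longrightarrow> diameter U \<le> rmin ^ n \<longrightarrow> real (card {w \<in> words n. cyl w \<inter> U \<noteq> {}}) \<le> C"
proof -
  obtain z \<rho> where z: "0 < \<rho>" "ball z \<rho> \<subseteq> V" using V(2,3) open_contains_ball by (metis all_not_in_conv)
  obtain B where B: "0 < B" "\<And>x. x \<in> \<Lambda> \<Longrightarrow> norm x \<le> B" by (rule norm_bound) blast
  define D where "D = B + norm z"
  have D: "0 < D" "dist y z \<le> D" if "y \<in> \<Lambda>" for y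
    using B(1) B(2)[OF that] norm_triangle_ineq4[of y z] by (auto simp: D_def dist_norm add_pos_nonneg)
  \<comment> \<open>The path from a point of \<open>U\<close> to the far side of a chosen ball has
    three parts, at most \<open>d\<close>, \<open>d * D\<close> and
    \<open>d * \<rho>\<close>.\<close>
  define K where "K = 1 + D + \<rho>"
  let ?N = "DIM('a)"
  have "real (card {w \<in> words n. cyl w \<inter> U \<noteq> {}}) \<le> (K / (rmin * \<rho>)) ^ ?N"
    if U: "bounded U" "diameter U \<le> rmin ^ n" for n U
  proof (cases "{w \<in> words n. cyl w \<inter> U \<noteq> {}} = {}")
    case True
    have "0 < D" using D(1) nonempty by blast
    then have "0 \<le> (K / (rmin * \<rho>)) ^ ?N" using rmin(1) z(1) by (simp add: K_def)
    then show ?thesis unfolding True by simp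
  next
    case False
    let ?W = "{w \<in> words n. cyl w \<inter> U \<noteq> {}}"
    define d where "d = rmin ^ n"
    have d: "0 < d" "d \<le> 1" using rmin by (auto simp: d_def power_le_one)
    obtain x0 where x0: "x0 \<in> U" using False by blast
    have "\<exists>c. ball c (rmin * d * \<rho>) \<subseteq> Sw w ` V \<and> ball c (rmin * d * \<rho>) \<subseteq> ball x0 (d * K)" if w: "w \<in> ?W" for w
    proof -
      obtain x where x: "x \<in> \<Lambda>" "Sw w x \<in> U" using w by (auto simp: cyl_def)
      have wI: "w \<in> lists I" using w words_lists by auto
      have rwp: "0 < rw w" using rw_pos[OF wI] .
      have dr: "0 < d / rw w" "d / rw w \<le> 1" using rw_ge_rmin_power[of w n] w d rwp by (auto simp: d_def)
      \<comment> \<open>A word of length \<open>n\<close> may be much larger than \<open>d\<close>.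
        A longer word through the same point has size comparable to \<open>d\<close>, and its ball
        still lies in the image of \<open>V\<close> under \<open>Sw w\<close>.\<close>
      obtain v where v: "v \<in> lists I" "x \<in> cyl v" "rw v \<le> d / rw w" "rmin * (d / rw w) \<le> rw v"
        using ex_cyl_size[OF x(1) dr] by blast
      obtain y where y: "y \<in> \<Lambda>" "x = Sw v y" using v(2) by (auto simp: cyl_def)
      let ?u = "w @ v"
      have uI: "?u \<in> lists I" using wI v by auto
      have ru: "rw ?u \<le> d" "rmin * d \<le> rw ?u" using v(3,4) rwp by (auto simp: rw_append field_simps)
      have xu: "Sw w x = Sw ?u y" by (simp add: y Sw_append)
      have "ball (Sw ?u z) (rmin * d * \<rho>) \<subseteq> Sw w ` V"
      proof
        fix p assume p: "p \<in> ball (Sw ?u z) (rmin * d * \<rho>)"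
        obtain q where q: "p = Sw ?u q" using surj_Sw[OF uI] by (metis surjD)
        have "rw ?u * dist z q < rmin * d * \<rho>" using p dist_Sw[OF uI, of z q] by (simp add: q)
        also have "\<dots> \<le> rw ?u * \<rho>" using ru z by (intro mult_right_mono) auto
        finally have "dist z q < \<rho>" using rw_pos[OF uI] by simp
        then have "q \<in> V" using z by auto
        then have "Sw v q \<in> V" using Sw_open_set[OF V(1) v(1)] by blast
        then show "p \<in> Sw w ` V" by (simp add: q Sw_append)
      qed
      moreover have "ball (Sw ?u z) (rmin * d * \<rho>) \<subseteq> ball x0 (d * K)"
      proof
        fix p assume p: "p \<in> ball (Sw ?u z) (rmin * d * \<rho>)"
        have "dist x0 (Sw w x) \<le> d" using diameter_bounded_bound[OF U(1) x0 x(2)] U(2) by (simp add: d_def)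
        moreover have "dist (Sw w x) (Sw ?u z) \<le> d * D"
          unfolding xu dist_Sw[OF uI] using ru D(2)[OF y(1)] d rw_pos[OF uI] by (intro mult_mono) auto
        moreover have "dist (Sw ?u z) p < rmin * d * \<rho>" using p by simp
        moreover have "rmin * d * \<rho> \<le> 1 * d * \<rho>" using rmin d z by (intro mult_right_mono) auto
        moreover have "dist x0 p \<le> dist x0 (Sw w x) + dist (Sw w x) (Sw ?u z) + dist (Sw ?u z) p"
          by (meson dist_triangle order_trans add_right_mono)
        ultimately show "p \<in> ball x0 (d * K)" by (simp add: K_def algebra_simps)
      qed
      ultimately show ?thesis by blast
    qed
    then have "\<forall>w\<in>?W. \<exists>c. ball c (rmin * d * \<rho>) \<subseteq> Sw w ` V \<and> ball c (rmin * d * \<rho>) \<subseteq> ball x0 (d * K)" ..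
    from bchoice[OF this] obtain c where
      c: "\<And>w. w \<in> ?W \<Longrightarrow> ball (c w) (rmin * d * \<rho>) \<subseteq> Sw w ` V"
         "\<And>w. w \<in> ?W \<Longrightarrow> ball (c w) (rmin * d * \<rho>) \<subseteq> ball x0 (d * K)" by blast
    let ?v = "unit_ball_vol (real ?N)"
    have pos: "0 < rmin * d * \<rho>" "0 < d * K" "0 < K"
    proof -
      have "0 < D" using D(1) nonempty by blast
      then show "0 < K" using z by (simp add: K_def)
      then show "0 < d * K" "0 < rmin * d * \<rho>" using d rmin z by simp_all
    qed
    have fin: "finite ?W" using finite_words[of n] by simp
    have "pairwise (\<lambda>u v. disjnt (ball (c u) (rmin * d * \<rho>)) (ball (c v) (rmin * d * \<rho>))) ?W"
    proof (rule pairwiseI)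
      fix u v assume uv: "u \<in> ?W" "v \<in> ?W" "u \<noteq> v"
      then have "Sw u ` V \<inter> Sw v ` V = {}" using Sw_open_set_disjoint[OF V(1) disj, of u n v] by blast
      then show "disjnt (ball (c u) (rmin * d * \<rho>)) (ball (c v) (rmin * d * \<rho>))"
        using c(1)[OF uv(1)] c(1)[OF uv(2)] unfolding disjnt_def by blast
    qed
    then have "(\<Sum>w\<in>?W. measure lebesgue (ball (c w) (rmin * d * \<rho>))) = measure lebesgue (\<Union>w\<in>?W. ball (c w) (rmin * d * \<rho>))"
      using fin by (intro measure_UNION'[symmetric]) auto
    also have "\<dots> \<le> measure lebesgue (ball x0 (d * K))"
      using c(2) fin by (intro measure_mono_fmeasurable) (auto intro!: sets.finite_UN)
    finally have "real (card ?W) * (?v * (rmin * d * \<rho>) ^ ?N) \<le> ?v * (d * K) ^ ?N"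
      using pos by (simp add: content_ball)
    also have "d * K = (rmin * d * \<rho>) * (K / (rmin * \<rho>))"
      using rmin(1) z(1) by simp
    also have "\<dots> ^ ?N = (rmin * d * \<rho>) ^ ?N * (K / (rmin * \<rho>)) ^ ?N"
      by (rule power_mult_distrib)
    finally have "(?v * (rmin * d * \<rho>) ^ ?N) * real (card ?W) \<le> (?v * (rmin * d * \<rho>) ^ ?N) * (K / (rmin * \<rho>)) ^ ?N"
      by (simp add: mult_ac)
    moreover have "0 < ?v * (rmin * d * \<rho>) ^ ?N" using pos by simp
    ultimately show ?thesis by (simp only: mult_le_cancel_left_pos)
  qed
  then show ?thesis by blast
qed

text \<open>Pulling a cover of the cylinder back by \<open>Sw w\<close> divides all diameters by
  \<open>rw w\<close>.\<close>

lemma hausdorff1_delta_cyl: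
  assumes "w \<in> lists I"
  shows "ennreal (rw w) * hausdorff1_delta (\<delta> / rw w) \<Lambda> \<le> hausdorff1_delta \<delta> (cyl w)"
  unfolding hausdorff1_delta_def[of \<delta>]
proof (rule INF_greatest, clarify)
  fix U :: "nat \<Rightarrow> 'a set"
  assume U: "cyl w \<subseteq> (\<Union>i. U i)" "\<forall>i. bounded (U i) \<and> diameter (U i) \<le> \<delta>"
  have rwp: "0 < rw w" using rw_pos[OF assms] .
  define W where "W i = Sw w -` U i" for i
  have W: "bounded (W i)" "diameter (W i) \<le> diameter (U i) / rw w" for i
  proof -
    have le: "dist x y \<le> diameter (U i) / rw w" if "x \<in> W i" "y \<in> W i" for x y
      using diameter_bounded_bound[of "U i" "Sw w x" "Sw w y"] U(2) that rwp
      by (simp add: W_def dist_Sw[OF assms] field_simps)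
    then show "bounded (W i)" unfolding bounded_two_points by blast
    have "0 \<le> diameter (U i) / rw w" using U(2) rwp by (simp add: diameter_ge_0)
    then show "diameter (W i) \<le> diameter (U i) / rw w"
      using le by (intro diameter_le) (auto simp: dist_norm)
  qed
  have "hausdorff1_delta (\<delta> / rw w) \<Lambda> \<le> (\<Sum>i. ennreal (diameter (W i)))"
    unfolding hausdorff1_delta_def
  proof (rule INF_lower, clarify, intro conjI allI)
    show "\<Lambda> \<subseteq> (\<Union>i. W i)" using U(1) by (force simp: W_def cyl_def)
    show "bounded (W i)" for i by (rule W)
    have "diameter (U i) / rw w \<le> \<delta> / rw w" for i using U(2) rwp by (intro divide_right_mono) auto
    then show "diameter (W i) \<le> \<delta> / rw w" for i using W(2) order_trans by blast
  qed
  also have "\<dots> \<le> (\<Sum>i. ennreal (1 / rw w) * ennreal (diameter (U i)))"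
  proof (rule suminf_le)
    show "ennreal (diameter (W i)) \<le> ennreal (1 / rw w) * ennreal (diameter (U i))" for i
      using W(2)[of i] U(2) rwp by (simp add: ennreal_mult[symmetric] diameter_ge_0 ennreal_leI)
  qed auto
  also have "\<dots> = ennreal (1 / rw w) * (\<Sum>i. ennreal (diameter (U i)))" by simp
  finally have "ennreal (rw w) * hausdorff1_delta (\<delta> / rw w) \<Lambda>
      \<le> ennreal (rw w) * (ennreal (1 / rw w) * (\<Sum>i. ennreal (diameter (U i))))"
    by (intro mult_left_mono) auto
  also have "\<dots> = (\<Sum>i. ennreal (diameter (U i)))"
    using rwp by (simp add: mult.assoc[symmetric] ennreal_mult[symmetric])
  finally show "ennreal (rw w) * hausdorff1_delta (\<delta> / rw w) \<Lambda> \<le> (\<Sum>i. ennreal (diameter (U i)))" .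
qed

text \<open>One cover of \<Lambda> serves all cylinders: each of its sets is charged only to the
  cylinders that it meets, at most \<open>C\<close> of them. This gives additivity up to a constant
  directly from covers.\<close>

lemma sum_hausdorff1_delta_cyl_le:
  assumes C: "\<And>U. bounded U \<Longrightarrow> diameter U \<le> rmin ^ n \<Longrightarrow> real (card {w \<in> words n. cyl w \<inter> U \<noteq> {}}) \<le> C"
    and "\<delta> \<le> rmin ^ n" "0 < \<delta>"
  shows "(\<Sum>w\<in>words n. hausdorff1_delta \<delta> (cyl w)) \<le> ennreal C * hausdorff1_delta \<delta> \<Lambda>"
proof -
  have "(\<Sum>w\<in>words n. hausdorff1_delta \<delta> (cyl w)) \<le> ennreal C * (\<Sum>i. ennreal (diameter (U i)))"
    if U: "\<Lambda> \<subseteq> (\<Union>i. U i)" "\<forall>i. bounded (U i) \<and> diameter (U i) \<le> \<delta>" for U :: "nat \<Rightarrow> 'a set"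
  proof -
    define u where "u w i = (if cyl w \<inter> U i \<noteq> {} then ennreal (diameter (U i)) else 0)" for w i
    have "hausdorff1_delta \<delta> (cyl w) \<le> (\<Sum>i. u w i)" if "w \<in> words n" for w
    proof -
      define U' where "U' i = (if cyl w \<inter> U i \<noteq> {} then U i else {})" for i
      have "hausdorff1_delta \<delta> (cyl w) \<le> (\<Sum>i. ennreal (diameter (U' i)))"
        unfolding hausdorff1_delta_def
      proof (rule INF_lower, clarify, intro conjI allI)
        show "cyl w \<subseteq> (\<Union>i. U' i)"
          using U(1) cyl_subset[OF words_lists[OF that]] by (fastforce simp: U'_def)
        show "bounded (U' i)" "diameter (U' i) \<le> \<delta>" for i
          using U(2) \<open>0 < \<delta>\<close> by (auto simp: U'_def)
      qed
      also have "(\<lambda>i. ennreal (diameter (U' i))) = u w" by (auto simp: U'_def u_def)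
      finally show ?thesis .
    qed
    then have "(\<Sum>w\<in>words n. hausdorff1_delta \<delta> (cyl w)) \<le> (\<Sum>w\<in>words n. \<Sum>i. u w i)" by (rule sum_mono)
    also have "\<dots> = (\<Sum>i. \<Sum>w\<in>words n. u w i)" by (rule suminf_sum[symmetric]) auto
    also have "\<dots> \<le> (\<Sum>i. ennreal C * ennreal (diameter (U i)))"
    proof (rule suminf_le)
      fix i
      let ?W = "{w \<in> words n. cyl w \<inter> U i \<noteq> {}}"
      have "(\<Sum>w\<in>words n. u w i) = (\<Sum>w\<in>?W. ennreal (diameter (U i)))"
        unfolding u_def using finite_words[of n] by (simp add: sum.If_cases Int_def)
      also have "\<dots> = ennreal (real (card ?W)) * ennreal (diameter (U i))"
        by (simp add: ennreal_of_nat_eq_real_of_nat)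
      also have "\<dots> \<le> ennreal C * ennreal (diameter (U i))"
        using C[of "U i"] U(2) assms(2) by (intro mult_right_mono ennreal_leI) (auto intro: order_trans)
      finally show "(\<Sum>w\<in>words n. u w i) \<le> ennreal C * ennreal (diameter (U i))" .
    qed auto
    also have "\<dots> = ennreal C * (\<Sum>i. ennreal (diameter (U i)))" by simp
    finally show ?thesis .
  qed
  note cover = this
  \<comment> \<open>\<open>C\<close> is positive because a single point already meets a cylinder;
    the division by \<open>C\<close> below relies on it.\<close>
  obtain x where "x \<in> \<Lambda>" using nonempty by blast
  then obtain w where "w \<in> words n" "x \<in> cyl w" using Un_cyl[of n] by blast
  then have "{w \<in> words n. cyl w \<inter> {x} \<noteq> {}} \<noteq> {}" by auto
  then have "0 < card {w \<in> words n. cyl w \<inter> {x} \<noteq> {}}" using finite_words[of n] by (simp add: card_gt_0_iff)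
  moreover have "real (card {w \<in> words n. cyl w \<inter> {x} \<noteq> {}}) \<le> C" using rmin by (intro C) auto
  ultimately have "0 < C" by linarith
  let ?s = "\<Sum>w\<in>words n. hausdorff1_delta \<delta> (cyl w)"
  have "?s / ennreal C \<le> hausdorff1_delta \<delta> \<Lambda>"
    unfolding hausdorff1_delta_def[of \<delta> \<Lambda>]
  proof (rule INF_greatest, clarify)
    fix U :: "nat \<Rightarrow> 'a set"
    assume "\<Lambda> \<subseteq> (\<Union>i. U i)" "\<forall>i. bounded (U i) \<and> diameter (U i) \<le> \<delta>"
    from cover[OF this] show "?s / ennreal C \<le> (\<Sum>i. ennreal (diameter (U i)))"
      using \<open>0 < C\<close> by (intro divide_le_posI_ennreal) auto
  qed
  then have "?s / ennreal C * ennreal C \<le> hausdorff1_delta \<delta> \<Lambda> * ennreal C"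
    by (intro mult_right_mono) auto
  moreover have "?s / ennreal C * ennreal C = ?s"
    unfolding ennreal_divide_times using \<open>0 < C\<close> by (simp add: ennreal_divide_self)
  ultimately show ?thesis by (simp add: mult.commute)
qed

text \<open>The overlap constant \<open>C\<close> does not depend on \<open>n\<close>. Were the sum
  of the ratios above 1, its \<open>n\<close>-th power, the total ratio of the words of length
  \<open>n\<close>, would exceed \<open>C\<close>; but scaling gives
  \<open>?q ^ n * H \<le> C * H\<close> for the measure \<open>H\<close> of \<Lambda>, and
  \<open>H\<close> is positive and finite.\<close>

theorem sum_ratio_le_1_if_open_set_condition:
  assumes V: "\<And>i. i \<in> I \<Longrightarrow> (\<lambda>x. r i *\<^sub>R T i x + b i) ` V \<subseteq> V" "open V" "V \<noteq> {}"
    and disj: "\<And>i j. i \<in> I \<Longrightarrow> j \<in> I \<Longrightarrow> i \<noteq> j \<Longrightarrow>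
      (\<lambda>x. r i *\<^sub>R T i x + b i) ` V \<inter> (\<lambda>x. r j *\<^sub>R T j x + b j) ` V = {}"
    and H: "0 < hausdorff1 \<Lambda>" "hausdorff1 \<Lambda> < \<infinity>"
  shows "(\<Sum>i\<in>I. r i) \<le> 1"
proof (rule ccontr)
  let ?q = "\<Sum>i\<in>I. r i"
  assume "\<not> ?q \<le> 1"
  then have "1 < ?q" by simp
  obtain C where C: "\<And>n U. bounded U \<Longrightarrow> diameter U \<le> rmin ^ n \<Longrightarrow> real (card {w \<in> words n. cyl w \<inter> U \<noteq> {}}) \<le> C"
    using bounded_overlap[OF V disj] by blast
  obtain n where n: "max C 0 < ?q ^ n" using real_arch_pow[OF \<open>1 < ?q\<close>] by blast
  have le: "ennreal (?q ^ n) * hausdorff1_delta \<delta> \<Lambda> \<le> ennreal C * hausdorff1 \<Lambda>" if "0 < \<delta>" for \<delta>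
  proof -
    \<comment> \<open>Small enough for the overlap bound at level \<open>n\<close>, and small enough
      that \<open>\<gamma> / rw w \<le> \<delta>\<close> for every word of length
      \<open>n\<close>.\<close>
    define \<gamma> where "\<gamma> = min 1 \<delta> * rmin ^ n"
    have \<gamma>: "0 < \<gamma>" "\<gamma> \<le> rmin ^ n" using that rmin by (auto simp: \<gamma>_def mult_le_cancel_right1)
    have "ennreal (?q ^ n) * hausdorff1_delta \<delta> \<Lambda> = (\<Sum>w\<in>words n. ennreal (rw w)) * hausdorff1_delta \<delta> \<Lambda>"
      using rw_pos words_lists by (simp add: sum_rw[symmetric] less_imp_le)
    also have "\<dots> = (\<Sum>w\<in>words n. ennreal (rw w) * hausdorff1_delta \<delta> \<Lambda>)" by (rule sum_distrib_right)
    also have "\<dots> \<le> (\<Sum>w\<in>words n. hausdorff1_delta \<gamma> (cyl w))"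
    proof (rule sum_mono)
      fix w assume w: "w \<in> words n"
      have rwp: "0 < rw w" using rw_pos words_lists[OF w] by blast
      have "\<gamma> \<le> \<delta> * rw w" unfolding \<gamma>_def
        using rw_ge_rmin_power[OF w] rmin that by (intro mult_mono) auto
      then have "\<gamma> / rw w \<le> \<delta>" using rwp by (simp add: pos_divide_le_eq)
      then have "ennreal (rw w) * hausdorff1_delta \<delta> \<Lambda> \<le> ennreal (rw w) * hausdorff1_delta (\<gamma> / rw w) \<Lambda>"
        by (intro mult_left_mono hausdorff1_delta_antimono) auto
      also have "\<dots> \<le> hausdorff1_delta \<gamma> (cyl w)" by (rule hausdorff1_delta_cyl[OF words_lists[OF w]])
      finally show "ennreal (rw w) * hausdorff1_delta \<delta> \<Lambda> \<le> hausdorff1_delta \<gamma> (cyl w)" .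
    qed
    also have "\<dots> \<le> ennreal C * hausdorff1_delta \<gamma> \<Lambda>" by (rule sum_hausdorff1_delta_cyl_le[OF C \<gamma>(2,1)])
    also have "\<dots> \<le> ennreal C * hausdorff1 \<Lambda>" using \<gamma> by (intro mult_left_mono hausdorff1_delta_le) auto
    finally show ?thesis .
  qed
  have "ennreal (?q ^ n) * hausdorff1 \<Lambda> = (SUP \<delta>\<in>{0<..}. ennreal (?q ^ n) * hausdorff1_delta \<delta> \<Lambda>)"
    unfolding hausdorff1_def by (rule SUP_mult_left_ennreal)
  also have "\<dots> \<le> ennreal C * hausdorff1 \<Lambda>" using le by (intro SUP_least) auto
  finally have *: "ennreal (?q ^ n) * hausdorff1 \<Lambda> \<le> ennreal C * hausdorff1 \<Lambda>" .
  obtain h where h: "hausdorff1 \<Lambda> = ennreal h" "0 < h"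
    using H by (cases "hausdorff1 \<Lambda>") auto
  have "ennreal C * ennreal h \<le> ennreal (max C 0) * ennreal h" by (intro mult_right_mono ennreal_leI) auto
  then have "ennreal (?q ^ n * h) \<le> ennreal (max C 0 * h)"
    using * h n by (auto simp: ennreal_mult)
  then have "?q ^ n * h \<le> max C 0 * h" using h(2) by (subst (asm) ennreal_le_iff) auto
  then show False using n h(2) by simp
qed

end

section \<open>The maximum principle for projections\<close>

text \<open>Subadditivity holds over \<open>K\<close> and over \<open>J - K\<close>; equality for
  the whole family leaves no slack in either.\<close>

lemma measure_UN_eq_sum_subfamily:
  assumes "finite J" and A: "\<And>j. j \<in> J \<Longrightarrow> A j \<in> fmeasurable M"
    and eq: "measure M (\<Union>j\<in>J. A j) = (\<Sum>j\<in>J. measure M (A j))" and "K \<subseteq> J"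
  shows "measure M (\<Union>j\<in>K. A j) = (\<Sum>j\<in>K. measure M (A j))"
proof -
  have fin: "finite K" "finite (J - K)"
    using \<open>finite J\<close> \<open>K \<subseteq> J\<close> finite_subset by auto
  have le: "measure M (\<Union>j\<in>L. A j) \<le> (\<Sum>j\<in>L. measure M (A j))" if "L \<subseteq> J" for L
    using that A \<open>finite J\<close> by (intro measure_UNION_le) (auto intro: finite_subset dest: fmeasurableD)
  have "(\<Sum>j\<in>K. measure M (A j)) + (\<Sum>j\<in>J - K. measure M (A j)) = measure M (\<Union>j\<in>J. A j)"
    using sum.subset_diff[OF \<open>K \<subseteq> J\<close> \<open>finite J\<close>, of "\<lambda>j. measure M (A j)"] eq by simp
  also have "(\<Union>j\<in>J. A j) = (\<Union>j\<in>K. A j) \<union> (\<Union>j\<in>J - K. A j)"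
    using \<open>K \<subseteq> J\<close> by auto
  also have "measure M \<dots> \<le> measure M (\<Union>j\<in>K. A j) + measure M (\<Union>j\<in>J - K. A j)"
  proof (rule measure_Un_le)
    show "(\<Union>j\<in>K. A j) \<in> sets M" "(\<Union>j\<in>J - K. A j) \<in> sets M"
      using fin A \<open>K \<subseteq> J\<close> by (auto intro!: sets.finite_UN dest: fmeasurableD)
  qed
  also have "measure M (\<Union>j\<in>J - K. A j) \<le> (\<Sum>j\<in>J - K. measure M (A j))"
    by (rule le) auto
  finally show ?thesis using le[OF \<open>K \<subseteq> J\<close>] by simp
qed

text \<open>Powers applied to \<open>e\<close> stay in a compact ball, so two of them come close;
  the common power cancels because the map preserves distances. This yields approximate inverses
  among powers.\<close>

lemma linear_isometry_recurrent:
  fixes A :: "'a::euclidean_space \<Rightarrow> 'a"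
  assumes lin: "linear A" and iso: "\<And>x. norm (A x) = norm x" and "0 < \<delta>"
  shows "\<exists>k\<ge>1. norm ((A ^^ k) e - e) < \<delta>"
proof -
  have diff: "(A ^^ n) x - (A ^^ n) y = (A ^^ n) (x - y)" for n x y
    by (induction n) (auto simp: linear_diff[OF lin, symmetric])
  have nrm: "norm ((A ^^ n) x) = norm x" for n x
    by (induction n) (auto simp: iso)
  have "compact (cball (0::'a) (norm e))" by simp
  moreover have "\<forall>n. (A ^^ n) e \<in> cball 0 (norm e)" by (simp add: nrm)
  ultimately obtain l f where f: "strict_mono f" "((\<lambda>n. (A ^^ n) e) \<circ> f) \<longlonglongrightarrow> l"
    by (meson seq_compactE compact_imp_seq_compact)
  then have "Cauchy ((\<lambda>n. (A ^^ n) e) \<circ> f)" using LIMSEQ_imp_Cauchy by blast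
  then obtain N where N: "\<forall>m\<ge>N. \<forall>n\<ge>N. norm ((A ^^ f m) e - (A ^^ f n) e) < \<delta>"
    using \<open>0 < \<delta>\<close> unfolding Cauchy_iff by auto
  define k where "k = f (Suc N) - f N"
  have "f N < f (Suc N)" using f by (simp add: strict_mono_def)
  then have k: "1 \<le> k" "f (Suc N) = f N + k" by (auto simp: k_def)
  have "norm ((A ^^ f N) ((A ^^ k) e) - (A ^^ f N) e) < \<delta>"
    using N[rule_format, of "Suc N" N] k by (simp add: funpow_add)
  then have "norm ((A ^^ k) e - e) < \<delta>" by (simp add: diff nrm)
  then show ?thesis using k by blast
qed

locale subunit_similitude_system = similitude_system I r T b \<Lambda>
  for I :: "'i set" and r and T :: "'i \<Rightarrow> 'a::euclidean_space \<Rightarrow> 'a" and b and \<Lambda> +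
  assumes sum_ratio_le_1: "(\<Sum>i\<in>I. r i) \<le> 1"
begin

lemma sum_rw_le_1: "(\<Sum>w\<in>words n. rw w) \<le> 1"
  using ratio sum_ratio_le_1 by (simp add: sum_rw power_le_one sum_nonneg less_imp_le)

section \<open>Orbit closures of a direction and constancy of the projection length\<close>

definition orbit :: "'a \<Rightarrow> 'a set" where
  "orbit e = (\<lambda>w. Aw w e) ` lists I"

lemma shadow_near:
  assumes "0 < \<epsilon>"
  shows "\<exists>\<delta>>0. \<forall>e'. norm (e' - e) < \<delta> \<longrightarrow> shadow e' < shadow e + \<epsilon>"
proof -
  obtain \<delta> where \<delta>: "\<delta> > 0" and
    thick: "\<And>e'. norm (e' - e) < \<delta> \<Longrightarrow> measure lebesgue (thicken \<delta> (proj e' \<Lambda>)) < shadow e + \<epsilon>"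
    using shadow_usc[OF assms] by blast
  have "shadow e' \<le> measure lebesgue (thicken \<delta> (proj e' \<Lambda>))" for e'
    unfolding shadow_def
    using \<delta> compact_proj[OF compact] lmeasurable_proj[OF compact]
    by (intro measure_mono_fmeasurable lmeasurable_thicken compact_imp_bounded)
       (auto simp: fmeasurableD intro: thicken_memI)
  then show ?thesis using \<delta> thick by (meson le_less_trans)
qed

lemma funpow_Aw: "w \<in> lists I \<Longrightarrow> \<exists>v\<in>lists I. \<forall>x. (Aw w ^^ k) x = Aw v x"
proof (induction k)
  case 0 then show ?case by (intro bexI[of _ "[]"]) auto
next
  case (Suc k)
  then obtain v where "v \<in> lists I" "\<And>x. (Aw w ^^ k) x = Aw v x" by blast
  then show ?case using Suc.prems by (intro bexI[of _ "v @ w"]) (auto simp: Aw_append)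
qed

lemma Aw_in_orbit_closure: "w \<in> lists I \<Longrightarrow> Aw w e \<in> closure (orbit e)"
  by (intro closure_subset[THEN subsetD]) (simp add: orbit_def)

lemma orbit_closure_mono:
  assumes "p \<in> closure (orbit e)"
  shows "closure (orbit p) \<subseteq> closure (orbit e)"
proof (rule closure_minimal)
  show "orbit p \<subseteq> closure (orbit e)"
  proof
    fix x assume "x \<in> orbit p"
    then obtain w where "w \<in> lists I" and x: "x = Aw w p" unfolding orbit_def by blast
    have "Aw w ` closure (orbit e) \<subseteq> closure (Aw w ` orbit e)"
      using linear_Aw[OF \<open>w \<in> lists I\<close>]
      by (intro image_closure_subset) (auto intro: linear_continuous_on linear_conv_bounded_linear[THEN iffD1] closure_subset[THEN subsetD])
    also have "\<dots> \<subseteq> closure (orbit e)"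
    proof (rule closure_mono, rule image_subsetI)
      fix q assume "q \<in> orbit e"
      then obtain v where "v \<in> lists I" "q = Aw v e" unfolding orbit_def by blast
      then show "Aw w q \<in> orbit e"
        using \<open>w \<in> lists I\<close> unfolding orbit_def by (intro image_eqI[of _ _ "v @ w"]) (auto simp: Aw_append)
    qed
    finally show "x \<in> closure (orbit e)" using assms x by blast
  qed
qed simp

lemma self_in_orbit: "e \<in> orbit e"
  unfolding orbit_def by (rule image_eqI[of _ _ "[]"]) auto

text \<open>If \<open>Aw w e\<close> is close to \<open>p\<close> and the \<open>k\<close>-th power
  of \<open>Aw w\<close> brings \<open>e\<close> back close to itself, then the remaining
  \<open>k - 1\<close> applications carry \<open>p\<close> close to \<open>e\<close>. Words form
  only a semigroup, so this symmetry is not automatic.\<close>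

lemma orbit_closure_sym:
  assumes "p \<in> closure (orbit e)"
  shows "e \<in> closure (orbit p)"
  unfolding closure_approachable
proof (intro allI impI)
  fix \<epsilon> :: real assume "0 < \<epsilon>"
  then have "0 < \<epsilon> / 2" by simp
  then obtain w where w: "w \<in> lists I" "norm (Aw w e - p) < \<epsilon> / 2"
    using assms unfolding closure_approachable orbit_def dist_norm by blast
  obtain k where k: "1 \<le> k" "norm ((Aw w ^^ k) e - e) < \<epsilon> / 2"
    using linear_isometry_recurrent[OF linear_Aw[OF w(1)] norm_Aw[OF w(1)] \<open>0 < \<epsilon> / 2\<close>] by blast
  obtain j where j: "k = Suc j" using k(1) by (cases k) auto
  obtain v where v: "v \<in> lists I" "\<And>x. (Aw w ^^ j) x = Aw v x" using funpow_Aw[OF w(1)] by blast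
  have "norm (Aw v p - Aw v (Aw w e)) = norm (p - Aw w e)"
    using v(1) by (simp add: Aw_diff[symmetric] norm_Aw)
  then have "norm (Aw v p - Aw v (Aw w e)) < \<epsilon> / 2" using w(2) by (simp add: norm_minus_commute)
  moreover have "norm (Aw v (Aw w e) - e) < \<epsilon> / 2"
    using k(2) by (simp only: j funpow_Suc_right o_apply v)
  ultimately have "norm (Aw v p - e) < \<epsilon>"
    using norm_triangle_sub[of "Aw v p - e" "Aw v (Aw w e) - e"] by (auto simp: norm_minus_commute)
  then show "\<exists>y\<in>orbit p. dist y e < \<epsilon>"
    using v(1) by (auto simp: orbit_def dist_norm)
qed

lemma orbit_bounded: "orbit e \<subseteq> cball 0 (norm e)"
  unfolding orbit_def by (rule image_subsetI) (simp add: norm_Aw del: in_lists_conv_set)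

lemma compact_orbit_closure: "compact (closure (orbit e))"
  using bounded_subset[OF bounded_cball orbit_bounded] by (simp add: compact_closure)

lemma shadow_bound: obtains B where "\<And>e. shadow e \<le> B * norm e"
proof -
  obtain B where B: "0 < B" "\<And>x. x \<in> \<Lambda> \<Longrightarrow> norm x \<le> B"
    by (rule norm_bound) blast
  have "shadow e \<le> (2 * B) * norm e" for e
  proof -
    have "proj e \<Lambda> \<subseteq> {- (B * norm e)..B * norm e}"
    proof (clarsimp simp: proj_def)
      fix x assume "x \<in> \<Lambda>"
      have "\<bar>x \<bullet> e\<bar> \<le> norm x * norm e" by (rule Cauchy_Schwarz_ineq2)
      also have "\<dots> \<le> B * norm e" using B \<open>x \<in> \<Lambda>\<close> by (intro mult_right_mono) auto
      finally show "- (B * norm e) \<le> x \<bullet> e \<and> x \<bullet> e \<le> B * norm e" by auto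
    qed
    then have "shadow e \<le> measure lebesgue {- (B * norm e)..B * norm e}"
      unfolding shadow_def using lmeasurable_proj[OF compact]
      by (intro measure_mono_fmeasurable) (auto simp: fmeasurableD)
    then show ?thesis using B by simp
  qed
  then show thesis using that by blast
qed

text \<open>The shadow attains its maximum over the orbit closure; by \<open>shadow_le\<close> it is
  constant on the orbit of a maximum point, and orbit closures of isometries are minimal.\<close>

lemma shadow_orbit_closure:
  assumes p: "p \<in> closure (orbit e)"
  shows "shadow p = shadow e"
proof -
  let ?C = "closure (orbit e)"
  obtain B where B: "\<And>e. shadow e \<le> B * norm e" by (rule shadow_bound) blast
  have nrm: "norm q \<le> norm e" if "q \<in> ?C" for q
  proof -
    have "?C \<subseteq> cball 0 (norm e)" by (intro closure_minimal orbit_bounded) simp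
    then show ?thesis using that by auto
  qed
  have B0: "shadow q \<le> \<bar>B\<bar> * norm e" if "q \<in> ?C" for q
  proof -
    have "shadow q \<le> B * norm q" by (rule B)
    also have "\<dots> \<le> \<bar>B\<bar> * norm q" by (intro mult_right_mono) auto
    also have "\<dots> \<le> \<bar>B\<bar> * norm e" using nrm[OF that] by (intro mult_left_mono) auto
    finally show ?thesis .
  qed
  define c where "c = Sup (shadow ` ?C)"
  have ne: "shadow ` ?C \<noteq> {}" using p by auto
  have bdd: "bdd_above (shadow ` ?C)" using B0 by (intro bdd_aboveI) auto
  have le_c: "shadow q \<le> c" if "q \<in> ?C" for q
    unfolding c_def using that bdd by (intro cSup_upper) auto
  \<comment> \<open>This is upper semicontinuity: values close to \<open>c\<close> arbitrarily near
    \<open>q\<close> force the value at \<open>q\<close> up to \<open>c\<close>.\<close>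
  have ge_c: "c \<le> shadow q" if near: "\<And>\<delta> \<epsilon>. 0 < \<delta> \<Longrightarrow> 0 < \<epsilon> \<Longrightarrow> \<exists>x. norm (x - q) < \<delta> \<and> c - \<epsilon> < shadow x" for q
  proof (rule field_le_epsilon)
    fix \<epsilon> :: real assume "0 < \<epsilon>"
    then have "0 < \<epsilon> / 2" by simp
    obtain \<delta> where \<delta>: "0 < \<delta>" "\<And>x. norm (x - q) < \<delta> \<Longrightarrow> shadow x < shadow q + \<epsilon> / 2"
      using shadow_near[OF \<open>0 < \<epsilon> / 2\<close>] by blast
    obtain x where "norm (x - q) < \<delta>" "c - \<epsilon> / 2 < shadow x"
      using near[OF \<delta>(1) \<open>0 < \<epsilon> / 2\<close>] by blast
    with \<delta>(2)[of x] show "c \<le> shadow q + \<epsilon>" by simp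
  qed
  have "\<exists>x\<in>?C. c - inverse (Suc n) < shadow x" for n
    using less_cSupE[OF _ ne, of "c - inverse (Suc n)"] unfolding c_def[symmetric] by auto
  then obtain X where X: "\<And>n. X n \<in> ?C" "\<And>n. c - inverse (Suc n) < shadow (X n)" by metis
  obtain \<psi> f where f: "\<psi> \<in> ?C" "strict_mono f" "(X \<circ> f) \<longlonglongrightarrow> \<psi>"
    using compact_orbit_closure[of e] X(1) by (meson seq_compactE compact_imp_seq_compact)
  have "c \<le> shadow \<psi>"
  proof (rule ge_c)
    fix \<delta> \<epsilon> :: real assume "0 < \<delta>" "0 < \<epsilon>"
    have "\<forall>\<^sub>F n in sequentially. norm (X (f n) - \<psi>) < \<delta>"
      using tendstoD[OF f(3) \<open>0 < \<delta>\<close>] by (simp add: dist_norm o_def)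
    moreover have "\<forall>\<^sub>F n in sequentially. inverse (real (Suc (f n))) < \<epsilon>"
      using filterlim_compose[OF LIMSEQ_inverse_real_of_nat filterlim_subseq[OF f(2)]] \<open>0 < \<epsilon>\<close>
      by (auto dest: order_tendstoD)
    ultimately have "\<forall>\<^sub>F n in sequentially. norm (X (f n) - \<psi>) < \<delta> \<and> c - \<epsilon> < shadow (X (f n))"
      by eventually_elim (use X(2) in \<open>smt (verit)\<close>)
    then show "\<exists>x. norm (x - \<psi>) < \<delta> \<and> c - \<epsilon> < shadow x"
      by (auto simp: eventually_sequentially)
  qed
  then have c: "shadow \<psi> = c" using le_c[OF f(1)] by simp
  have const: "shadow (Aw w \<psi>) = c" if w: "w \<in> lists I" for w
  proof (rule ccontr)
    let ?n = "length w"
    have in_C: "Aw v \<psi> \<in> ?C" if "v \<in> lists I" for v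
      using orbit_closure_mono[OF f(1)] Aw_in_orbit_closure[OF that] by blast
    assume "shadow (Aw w \<psi>) \<noteq> c"
    then have lt: "shadow (Aw w \<psi>) < c" using le_c[OF in_C[OF w]] by simp
    have "w \<in> words ?n" using w by (simp add: words_def)
    \<comment> \<open>A maximum cannot be at most an average of values not above it, with weights of
      sum at most 1, if one value is strictly smaller.\<close>
    have "c \<le> (\<Sum>v\<in>words ?n. rw v * shadow (Aw v \<psi>))"
      using shadow_le[of \<psi> ?n] c by simp
    also have "\<dots> < (\<Sum>v\<in>words ?n. rw v * c)"
    proof (rule sum_strict_mono_ex1[OF finite_words])
      show "\<forall>v\<in>words ?n. rw v * shadow (Aw v \<psi>) \<le> rw v * c"
        using le_c[OF in_C] rw_pos words_lists by (auto intro!: mult_left_mono simp: less_imp_le)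
      show "\<exists>v\<in>words ?n. rw v * shadow (Aw v \<psi>) < rw v * c"
        using lt rw_pos[OF w] \<open>w \<in> words ?n\<close> by (intro bexI[of _ w]) auto
    qed
    also have "\<dots> = (\<Sum>v\<in>words ?n. rw v) * c" by (simp add: sum_distrib_right)
    also have "\<dots> \<le> 1 * c"
      using sum_rw_le_1 shadow_nonneg[of \<psi>] c by (intro mult_right_mono) auto
    finally show False by simp
  qed
  have eq: "shadow q = c" if q: "q \<in> ?C" "q \<in> closure (orbit \<psi>)" for q
  proof (rule antisym[OF le_c[OF q(1)] ge_c])
    fix \<delta> \<epsilon> :: real assume "0 < \<delta>" "0 < \<epsilon>"
    then obtain w where "w \<in> lists I" "norm (Aw w \<psi> - q) < \<delta>"
      using q(2) unfolding closure_approachable orbit_def dist_norm by blast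
    then show "\<exists>x. norm (x - q) < \<delta> \<and> c - \<epsilon> < shadow x"
      using const \<open>0 < \<epsilon>\<close> by (intro exI[of _ "Aw w \<psi>"]) auto
  qed
  \<comment> \<open>Constancy is known along the orbit of the maximum point; by symmetry its closure
    is all of \<open>?C\<close>.\<close>
  have "e \<in> closure (orbit \<psi>)" using orbit_closure_sym[OF f(1)] .
  then have "?C \<subseteq> closure (orbit \<psi>)" by (rule orbit_closure_mono)
  then show ?thesis
    using eq[OF p] eq[of e] self_in_orbit[of e] closure_subset p by (metis subsetD)
qed

lemma shadow_Aw: "w \<in> lists I \<Longrightarrow> shadow (Aw w e) = shadow e"
  by (intro shadow_orbit_closure Aw_in_orbit_closure)

text \<open>What matters is one \<delta> for all words. Otherwise counterexamples accumulate at a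
  point of the compact orbit closure, where the shadow has the same value and the local bound
  applies.\<close>

lemma shadow_usc_orbit:
  assumes "0 < \<epsilon>"
  shows "\<exists>\<delta>>0. \<forall>w\<in>lists I. \<forall>e'. norm (e' - Aw w e) < \<delta> \<longrightarrow>
    measure lebesgue (thicken \<delta> (proj e' \<Lambda>)) < shadow e + \<epsilon>"
proof (rule ccontr)
  assume neg: "\<not> ?thesis"
  have "\<exists>w\<in>lists I. \<exists>e'. norm (e' - Aw w e) < inverse (Suc n) \<and>
    \<not> measure lebesgue (thicken (inverse (Suc n)) (proj e' \<Lambda>)) < shadow e + \<epsilon>" for n :: nat
    using neg by (metis inverse_positive_iff_positive of_nat_0_less_iff zero_less_Suc)
  then obtain w E where w: "\<And>n. w n \<in> lists I"
    and E: "\<And>n. norm (E n - Aw (w n) e) < inverse (Suc n)"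
      "\<And>n. \<not> measure lebesgue (thicken (inverse (Suc n)) (proj (E n) \<Lambda>)) < shadow e + \<epsilon>"
    by metis
  have "\<forall>n. Aw (w n) e \<in> closure (orbit e)"
    using Aw_in_orbit_closure w by blast
  then obtain p f where f: "p \<in> closure (orbit e)" "strict_mono f" "((\<lambda>n. Aw (w n) e) \<circ> f) \<longlonglongrightarrow> p"
    using compact_orbit_closure[of e] by (meson seq_compactE compact_imp_seq_compact)
  obtain \<delta> where \<delta>: "0 < \<delta>" "\<And>e'. norm (e' - p) < \<delta> \<Longrightarrow> measure lebesgue (thicken \<delta> (proj e' \<Lambda>)) < shadow p + \<epsilon>"
    using shadow_usc[OF assms] by blast
  have "\<forall>\<^sub>F n in sequentially. norm (Aw (w (f n)) e - p) < \<delta> / 2"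
    using tendstoD[OF f(3), of "\<delta> / 2"] \<delta>(1) by (simp add: dist_norm o_def)
  moreover have "\<forall>\<^sub>F n in sequentially. inverse (real (Suc (f n))) < \<delta> / 2"
    using order_tendstoD(2)[OF filterlim_compose[OF LIMSEQ_inverse_real_of_nat filterlim_subseq[OF f(2)]], of "\<delta> / 2"] \<delta>(1)
    by simp
  ultimately have "\<forall>\<^sub>F n in sequentially. norm (Aw (w (f n)) e - p) < \<delta> / 2 \<and> inverse (real (Suc (f n))) < \<delta> / 2"
    by (rule eventually_conj)
  then obtain n where n: "norm (Aw (w (f n)) e - p) < \<delta> / 2" "inverse (real (Suc (f n))) < \<delta> / 2"
    by (auto simp: eventually_sequentially)
  have "norm (E (f n) - p) < \<delta>"
    using E(1)[of "f n"] n norm_triangle_ineq[of "E (f n) - Aw (w (f n)) e" "Aw (w (f n)) e - p"] by auto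
  then have "measure lebesgue (thicken \<delta> (proj (E (f n)) \<Lambda>)) < shadow e + \<epsilon>"
    using \<delta>(2) shadow_orbit_closure[OF f(1)] by simp
  moreover have "measure lebesgue (thicken (inverse (Suc (f n))) (proj (E (f n)) \<Lambda>))
      \<le> measure lebesgue (thicken \<delta> (proj (E (f n)) \<Lambda>))"
    using n(2) \<delta>(1) compact_proj[OF compact]
    by (intro measure_mono_fmeasurable lmeasurable_thicken compact_imp_bounded thicken_mono sets_thicken) auto
  ultimately show False using E(2)[of "f n"] by simp
qed

section \<open>Null overlaps of projected cylinders\<close>

text \<open>With all shadows along the orbit equal, \<open>shadow_le\<close> and the bound 1 on the
  weights squeeze from both sides. Subadditivity over the cylinders is thus an equality, which makes
  their projections almost disjoint.\<close>

lemma shadow_eq_sum: "shadow e = (\<Sum>w\<in>words n. rw w * shadow e)"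
proof (rule antisym)
  have "shadow e \<le> (\<Sum>w\<in>words n. rw w * shadow (Aw w e))" by (rule shadow_le)
  also have "\<dots> = (\<Sum>w\<in>words n. rw w * shadow e)"
    by (intro sum.cong) (auto simp: shadow_Aw words_lists)
  finally show "shadow e \<le> (\<Sum>w\<in>words n. rw w * shadow e)" .
  have "(\<Sum>w\<in>words n. rw w) * shadow e \<le> 1 * shadow e"
    using sum_rw_le_1 shadow_nonneg by (intro mult_right_mono) auto
  then show "(\<Sum>w\<in>words n. rw w * shadow e) \<le> shadow e"
    by (simp add: sum_distrib_right)
qed

lemma measure_proj_UN_cyl:
  assumes "W \<subseteq> words n"
  shows "measure lebesgue (\<Union>w\<in>W. proj e (cyl w)) = (\<Sum>w\<in>W. rw w) * shadow e"
proof -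
  have m: "measure lebesgue (proj e (cyl w)) = rw w * shadow e" if "w \<in> words n" for w
    using that by (simp add: measure_proj_cyl words_lists shadow_Aw)
  have "measure lebesgue (\<Union>w\<in>W. proj e (cyl w)) = (\<Sum>w\<in>W. measure lebesgue (proj e (cyl w)))"
  proof (rule measure_UN_eq_sum_subfamily[OF finite_words[of n] _ _ assms])
    show "proj e (cyl w) \<in> lmeasurable" if "w \<in> words n" for w
      using that by (simp add: lmeasurable_proj_cyl words_lists)
    show "measure lebesgue (\<Union>w\<in>words n. proj e (cyl w)) = (\<Sum>w\<in>words n. measure lebesgue (proj e (cyl w)))"
      using shadow_eq_sum[of e n] m by (simp add: proj_Un_cyl[symmetric] shadow_def[symmetric])
  qed
  also have "\<dots> = (\<Sum>w\<in>W. rw w * shadow e)"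
    using m assms by (intro sum.cong) auto
  finally show ?thesis by (simp add: sum_distrib_right)
qed

lemma null_overlap_same_length:
  assumes "u \<in> words n" "v \<in> words n" "u \<noteq> v"
  shows "measure lebesgue (proj e (cyl u) \<inter> proj e (cyl v)) = 0"
proof -
  have "measure lebesgue (proj e (cyl u) \<union> proj e (cyl v)) = (rw u + rw v) * shadow e"
    using measure_proj_UN_cyl[of "{u, v}" n e] assms by simp
  moreover have "measure lebesgue (proj e (cyl w)) = rw w * shadow e" if "w \<in> words n" for w
    using measure_proj_UN_cyl[of "{w}" n e] that by simp
  ultimately show ?thesis
    using measure_Un3[of "proj e (cyl u)" lebesgue "proj e (cyl v)"] assms
    by (simp add: lmeasurable_proj_cyl words_lists algebra_simps)
qed

text \<open>Cutting \<open>v\<close> to the length of \<open>u\<close> only enlarges its cylinder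
  and reduces the claim to words of equal length.\<close>

lemma null_overlap:
  assumes "u \<in> lists I" "v \<in> lists I" "length u \<le> length v" "take (length u) v \<noteq> u"
  shows "measure lebesgue (proj e (cyl u) \<inter> proj e (cyl v)) = 0"
proof -
  let ?v = "take (length u) v"
  have "?v \<in> lists I" "drop (length u) v \<in> lists I" using assms(2) by (auto simp: in_lists_conv_set dest: in_set_takeD in_set_dropD)
  have sub: "cyl v \<subseteq> cyl ?v"
    using cyl_append_subset[OF \<open>drop (length u) v \<in> lists I\<close>, of ?v] by simp
  have "measure lebesgue (proj e (cyl u) \<inter> proj e (cyl v)) \<le> measure lebesgue (proj e (cyl u) \<inter> proj e (cyl ?v))"
  proof (rule measure_mono_fmeasurable)
    show "proj e (cyl u) \<inter> proj e (cyl v) \<subseteq> proj e (cyl u) \<inter> proj e (cyl ?v)"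
      using sub by (auto simp: proj_def)
    show "proj e (cyl u) \<inter> proj e (cyl v) \<in> sets lebesgue"
      using assms(1,2) by (intro sets.Int fmeasurableD lmeasurable_proj_cyl)
    show "proj e (cyl u) \<inter> proj e (cyl ?v) \<in> lmeasurable"
      using assms(1) \<open>?v \<in> lists I\<close> by (intro fmeasurable.Int lmeasurable_proj_cyl)
  qed
  also have "\<dots> = 0"
    using assms \<open>?v \<in> lists I\<close> by (intro null_overlap_same_length[of _ "length u"]) (auto simp: words_def)
  finally show ?thesis by (simp add: measure_le_0_iff)
qed

end

section \<open>Projections with far apart fibres\<close>

text \<open>Fubini for the set of pairs with \<open>x\<close> in \<open>P\<close> and
  \<open>x - \<tau>\<close> in \<open>Q\<close>.\<close>

lemma nn_integral_measure_Int_translate: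
  fixes P Q :: "real set"
  assumes [measurable]: "P \<in> sets borel" "Q \<in> sets borel"
  shows "(\<integral>\<^sup>+\<tau>. emeasure lborel (P \<inter> (+) \<tau> ` Q) \<partial>lborel) = emeasure lborel P * emeasure lborel Q"
proof -
  have eq: "(+) \<tau> ` Q = {x. x - \<tau> \<in> Q}" for \<tau>
    by (force simp: image_iff)
  have "(\<integral>\<^sup>+\<tau>. emeasure lborel (P \<inter> (+) \<tau> ` Q) \<partial>lborel) =
      (\<integral>\<^sup>+\<tau>. (\<integral>\<^sup>+x. indicator P x * indicator Q (x - \<tau>) \<partial>lborel) \<partial>lborel)"
  proof (rule nn_integral_cong)
    fix \<tau> :: real
    have "(\<integral>\<^sup>+x. indicator P x * indicator Q (x - \<tau>) \<partial>lborel) =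
        (\<integral>\<^sup>+x. indicator (P \<inter> {x. x - \<tau> \<in> Q}) x \<partial>lborel)"
      by (intro nn_integral_cong) (auto simp: indicator_def)
    also have "\<dots> = emeasure lborel (P \<inter> {x. x - \<tau> \<in> Q})"
      by (intro nn_integral_indicator) measurable
    finally show "emeasure lborel (P \<inter> (+) \<tau> ` Q) = (\<integral>\<^sup>+x. indicator P x * indicator Q (x - \<tau>) \<partial>lborel)"
      by (simp add: eq)
  qed
  also have "\<dots> = (\<integral>\<^sup>+x. (\<integral>\<^sup>+\<tau>. indicator P x * indicator Q (x - \<tau>) \<partial>lborel) \<partial>lborel)"
    by (rule lborel_pair.Fubini') measurable
  also have "\<dots> = (\<integral>\<^sup>+x. indicator P x * emeasure lborel Q \<partial>lborel)"
  proof (rule nn_integral_cong)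
    fix x :: real
    have "emeasure lborel Q = (\<integral>\<^sup>+\<tau>. indicator Q \<tau> \<partial>lborel)" by simp
    also have "\<dots> = (\<integral>\<^sup>+\<tau>. indicator Q (x - \<tau>) \<partial>lborel)"
      by (subst nn_integral_real_affine[where c = "-1" and t = x]) auto
    finally show "(\<integral>\<^sup>+\<tau>. indicator P x * indicator Q (x - \<tau>) \<partial>lborel) = indicator P x * emeasure lborel Q"
      by (simp add: nn_integral_cmult)
  qed
  also have "\<dots> = emeasure lborel P * emeasure lborel Q"
    by (simp add: nn_integral_multc)
  finally show ?thesis .
qed

text \<open>Translations beyond \<open>2 * \<rho>\<close> separate \<open>P\<close> from
  \<open>Q\<close>, those in \<open>Z\<close> cost at most the length of \<open>P\<close> each, and
  the others at most \<open>k\<close>. Hence two sets of substantial length cannot have small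
  overlap for nearly all relevant translations.\<close>

lemma measure_times_le_translate_overlap:
  fixes P Q Z :: "real set"
  assumes P: "open P" "P \<subseteq> {-\<rho>..\<rho>}" and Q: "open Q" "Q \<subseteq> {-\<rho>..\<rho>}" and Z: "Z \<in> lmeasurable"
    and k: "0 \<le> k" "\<And>\<tau>. \<bar>\<tau>\<bar> \<le> 2 * \<rho> \<Longrightarrow> \<tau> \<notin> Z \<Longrightarrow> measure lebesgue (P \<inter> (+) \<tau> ` Q) \<le> k"
    and "0 \<le> \<rho>"
  shows "measure lebesgue P * measure lebesgue Q \<le> 4 * \<rho> * k + measure lebesgue P * measure lebesgue Z"
proof -
  let ?m = "measure lebesgue"
  have bP: "bounded P" and bQ: "bounded Q" using P Q by (meson bounded_closed_interval bounded_subset)+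
  have tQ: "open ((+) \<tau> ` Q)" for \<tau> using Q open_translation by blast
  have lm: "P \<in> lmeasurable" "Q \<in> lmeasurable" "P \<inter> (+) \<tau> ` Q \<in> lmeasurable" for \<tau>
    using P Q bP bQ tQ[of \<tau>] by (auto intro!: lmeasurable_open bounded_Int)
  have em: "emeasure lborel S = ennreal (?m S)" if "open S" "S \<in> lmeasurable" for S :: "real set"
  proof -
    have "emeasure lborel S = emeasure lebesgue S" using that(1) by simp
    also have "\<dots> = ennreal (?m S)" using that(2) by (simp add: emeasure_eq_measure2)
    finally show ?thesis .
  qed
  have emI: "emeasure lborel (P \<inter> (+) \<tau> ` Q) = ennreal (?m (P \<inter> (+) \<tau> ` Q))" for \<tau>
    using P tQ lm by (intro em) auto
  have "ennreal (?m P * ?m Q) = emeasure lborel P * emeasure lborel Q"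
    using P Q lm by (simp add: em ennreal_mult)
  also have "\<dots> = (\<integral>\<^sup>+\<tau>. emeasure lborel (P \<inter> (+) \<tau> ` Q) \<partial>lborel)"
    using P Q by (intro nn_integral_measure_Int_translate[symmetric]) auto
  \<comment> \<open>\<open>Z\<close> is only Lebesgue measurable, so the integral moves to the
    completed measure.\<close>
  also have "\<dots> = (\<integral>\<^sup>+\<tau>. ennreal (?m (P \<inter> (+) \<tau> ` Q)) \<partial>lebesgue)"
    by (subst nn_integral_completion) (simp add: emI)
  also have "\<dots> \<le> (\<integral>\<^sup>+\<tau>. ennreal k * indicator {-(2 * \<rho>)..2 * \<rho>} \<tau> + ennreal (?m P) * indicator Z \<tau> \<partial>lebesgue)"
  proof (rule nn_integral_mono)
    fix \<tau> :: real
    consider "2 * \<rho> < \<bar>\<tau>\<bar>" | "\<bar>\<tau>\<bar> \<le> 2 * \<rho>" "\<tau> \<notin> Z" | "\<tau> \<in> Z" by linarith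
    then show "ennreal (?m (P \<inter> (+) \<tau> ` Q)) \<le> ennreal k * indicator {-(2 * \<rho>)..2 * \<rho>} \<tau> + ennreal (?m P) * indicator Z \<tau>"
    proof cases
      case 1
      have "P \<inter> (+) \<tau> ` Q = {}"
      proof (rule ccontr)
        assume "P \<inter> (+) \<tau> ` Q \<noteq> {}"
        then obtain q where "q \<in> Q" "\<tau> + q \<in> P" by auto
        then have "\<bar>q\<bar> \<le> \<rho>" "\<bar>\<tau> + q\<bar> \<le> \<rho>" using P Q by (auto simp: abs_le_iff)
        then show False using 1 by linarith
      qed
      then show ?thesis by simp
    next
      case 2
      then show ?thesis using k by (auto simp: indicator_def ennreal_leI)
    next
      case 3
      have "?m (P \<inter> (+) \<tau> ` Q) \<le> ?m P"
        using lm by (intro measure_mono_fmeasurable) (auto simp: fmeasurableD)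
      then have "ennreal (?m (P \<inter> (+) \<tau> ` Q)) \<le> ennreal (?m P) * indicator Z \<tau>"
        using 3 by (simp add: ennreal_leI)
      then show ?thesis by (simp add: add_increasing)
    qed
  qed
  also have "\<dots> = ennreal k * emeasure lebesgue {-(2 * \<rho>)..2 * \<rho>} + ennreal (?m P) * emeasure lebesgue Z"
  proof -
    have m: "(\<lambda>\<tau>. c * indicator A \<tau>) \<in> borel_measurable lebesgue" if "A \<in> sets lebesgue" for c :: ennreal and A :: "real set"
      using that by (intro borel_measurable_times_ennreal borel_measurable_const borel_measurable_indicator)
    show ?thesis
      using Z by (subst nn_integral_add[OF m m]) (auto simp: nn_integral_cmult_indicator fmeasurableD)
  qed
  also have "\<dots> = ennreal (k * (4 * \<rho>) + ?m P * ?m Z)"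
    using Z \<open>0 \<le> \<rho>\<close> k(1) by (simp add: emeasure_eq_measure2 ennreal_mult ennreal_plus)
  finally have "?m P * ?m Q \<le> k * (4 * \<rho>) + ?m P * ?m Z"
    using k(1) \<open>0 \<le> \<rho>\<close> by (subst (asm) ennreal_le_iff) auto
  then show ?thesis by (simp add: algebra_simps)
qed

lemma thicken_translate: "thicken \<delta> ((\<lambda>t. t - c) ` X) = (\<lambda>t. t - c) ` thicken \<delta> X"
proof -
  have "t \<in> (\<lambda>t. t - c) ` thicken \<delta> X \<longleftrightarrow> t + c \<in> thicken \<delta> X" for t
    by force
  then show ?thesis
    by (auto simp: thicken_def dist_real_def algebra_simps)
qed

context subunit_similitude_system
begin

lemma closed_shadow_ge: "closed {e. k \<le> shadow e}"
proof -
  have "open (- {e. k \<le> shadow e})"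
    unfolding open_dist
  proof
    fix e assume "e \<in> - {e. k \<le> shadow e}"
    then have "shadow e < k" by auto
    then obtain \<delta> where "\<delta> > 0" "\<And>e'. norm (e' - e) < \<delta> \<Longrightarrow> shadow e' < shadow e + (k - shadow e)"
      using shadow_near[of "k - shadow e" e] by auto
    then show "\<exists>\<delta>>0. \<forall>y. dist y e < \<delta> \<longrightarrow> y \<in> - {e. k \<le> shadow e}"
      by (intro exI[of _ \<delta>]) (auto simp: dist_norm not_le)
  qed
  then show ?thesis by (simp add: closed_def)
qed

lemma closed_shadow_line_ge: "closed {\<beta>. k \<le> shadow (a + \<beta> *\<^sub>R d)}"
proof -
  have "closed ((\<lambda>\<beta>. a + \<beta> *\<^sub>R d) -` {e. k \<le> shadow e})"
    by (intro continuous_closed_vimage closed_shadow_ge) (auto intro!: continuous_intros)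
  then show ?thesis by (simp add: vimage_def)
qed

text \<open>The projection of the cylinder of \<open>u\<close>, normalised: the image of
  \<open>Sw u p\<close> is moved to 0 and lengths are divided by \<open>rw u\<close>.\<close>

definition profile :: "'i list \<Rightarrow> 'a \<Rightarrow> 'a \<Rightarrow> real set" where
  "profile u p e = (\<lambda>z. (z - p) \<bullet> Aw u e) ` \<Lambda>"

lemma profile_eq: "profile u p e = (\<lambda>t. t - p \<bullet> Aw u e) ` proj (Aw u e) \<Lambda>"
  by (simp add: profile_def proj_def image_image inner_diff_left)

lemma proj_cyl_profile:
  assumes "u \<in> lists I"
  shows "proj e (cyl u) = (+) (Sw u p \<bullet> e) ` (*) (rw u) ` profile u p e"
proof -
  have eq: "Sw u z \<bullet> e = Sw u p \<bullet> e + rw u * ((z - p) \<bullet> Aw u e)" for z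
    using inner_Sw[OF assms, of z p e] by (simp add: inner_diff_left)
  show ?thesis
    unfolding proj_def cyl_def profile_def image_image by (rule image_cong[OF refl], rule eq)
qed

lemma compact_profile: "compact (profile u p e)"
  unfolding profile_def by (intro compact_continuous_image continuous_intros compact)

lemma measure_profile: "u \<in> lists I \<Longrightarrow> measure lebesgue (profile u p e) = shadow e"
  using shadow_Aw[of u e] measure_affine_real[of 1 "- (p \<bullet> Aw u e)" "proj (Aw u e) \<Lambda>"]
  by (simp add: profile_eq shadow_def)

lemma measure_thicken_profile: "measure lebesgue (thicken \<delta> (profile u p e)) = measure lebesgue (thicken \<delta> (proj (Aw u e) \<Lambda>))"
  using measure_affine_real[of 1 "- (p \<bullet> Aw u e)" "thicken \<delta> (proj (Aw u e) \<Lambda>)"]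
  by (simp add: profile_eq thicken_translate)

lemma dist_bound: obtains D where "1 \<le> D" "\<And>x y. x \<in> \<Lambda> \<Longrightarrow> y \<in> \<Lambda> \<Longrightarrow> norm (x - y) \<le> D"
proof -
  obtain B where B: "0 < B" "\<And>x. x \<in> \<Lambda> \<Longrightarrow> norm x \<le> B"
    by (rule norm_bound) blast
  have "norm (x - y) \<le> 2 * B + 1" if "x \<in> \<Lambda>" "y \<in> \<Lambda>" for x y
    using B(2)[OF that(1)] B(2)[OF that(2)] norm_triangle_ineq4[of x y] by linarith
  then show thesis using that[of "2 * B + 1"] B(1) by auto
qed

lemma profile_bound:
  assumes "u \<in> lists I" "p \<in> \<Lambda>" "\<And>x y. x \<in> \<Lambda> \<Longrightarrow> y \<in> \<Lambda> \<Longrightarrow> norm (x - y) \<le> D" "t \<in> profile u p e"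
  shows "\<bar>t\<bar> \<le> D * norm e"
proof -
  obtain z where z: "z \<in> \<Lambda>" "t = (z - p) \<bullet> Aw u e" using assms(4) by (auto simp: profile_def)
  have "\<bar>t\<bar> \<le> norm (z - p) * norm (Aw u e)" unfolding z(2) by (rule Cauchy_Schwarz_ineq2)
  also have "\<dots> \<le> D * norm e" using assms z by (simp add: norm_Aw mult_right_mono)
  finally show ?thesis .
qed

lemma profile_subset_thicken:
  assumes "u \<in> lists I" "p \<in> \<Lambda>" "\<And>x y. x \<in> \<Lambda> \<Longrightarrow> y \<in> \<Lambda> \<Longrightarrow> norm (x - y) \<le> D" "D * norm (e' - e) < \<delta>"
  shows "profile u p e' \<subseteq> thicken \<delta> (profile u p e)"
proof
  fix t assume "t \<in> profile u p e'"
  then obtain z where z: "z \<in> \<Lambda>" "t = (z - p) \<bullet> Aw u e'" by (auto simp: profile_def)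
  have "t - (z - p) \<bullet> Aw u e = (z - p) \<bullet> Aw u (e' - e)"
    using assms(1) by (simp add: z Aw_diff inner_diff_right)
  moreover have "(z - p) \<bullet> Aw u (e' - e) \<in> profile u p (e' - e)" using z by (auto simp: profile_def)
  ultimately have "\<bar>t - (z - p) \<bullet> Aw u e\<bar> < \<delta>"
    using profile_bound[OF assms(1,2,3), of "(z - p) \<bullet> Aw u (e' - e)" "e' - e"] assms(4) by simp
  then show "t \<in> thicken \<delta> (profile u p e)"
    using z by (intro thicken_memI) (auto simp: profile_def)
qed

text \<open>If one word were a prefix of the other, the larger cylinder would contain both points,
  which are too far apart for that. So \<open>null_overlap\<close> applies.\<close>

lemma far_cylinders_incomparable:
  assumes "x \<in> cyl u" "y \<in> cyl v" "u \<in> lists I" "v \<in> lists I"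
    and D: "\<And>x y. x \<in> \<Lambda> \<Longrightarrow> y \<in> \<Lambda> \<Longrightarrow> norm (x - y) \<le> D"
    and "rw u * D < norm (x - y)" "rw v * D < norm (x - y)"
  shows "measure lebesgue (proj e (cyl u) \<inter> proj e (cyl v)) = 0"
proof -
  have not_in: "\<not> {x, y} \<subseteq> cyl w" if "w \<in> lists I" "rw w * D < norm (x - y)" for w
  proof
    assume "{x, y} \<subseteq> cyl w"
    then obtain p q where pq: "p \<in> \<Lambda>" "q \<in> \<Lambda>" "x = Sw w p" "y = Sw w q" by (auto simp: cyl_def)
    have "norm (x - y) = rw w * norm (p - q)"
      using dist_Sw[OF that(1), of p q] pq by (simp add: dist_norm)
    also have "\<dots> \<le> rw w * D" using D pq rw_pos[OF that(1)] by (intro mult_left_mono) auto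
    finally show False using that by simp
  qed
  have sub: "cyl v' \<subseteq> cyl u'" if "take (length u') v' = u'" "v' \<in> lists I" for u' v'
  proof -
    have "drop (length u') v' \<in> lists I" using that(2) by (auto dest: in_set_dropD)
    moreover have "v' = u' @ drop (length u') v'" using that(1) by (metis append_take_drop_id)
    ultimately show ?thesis using cyl_append_subset by metis
  qed
  show ?thesis
  proof (cases "length u \<le> length v")
    case True
    have "take (length u) v \<noteq> u"
      using sub[of u v] not_in[of u] assms by blast
    then show ?thesis using null_overlap True assms by blast
  next
    case False
    have "take (length v) u \<noteq> v"
      using sub[of v u] not_in[of v] assms by blast
    then have "measure lebesgue (proj e (cyl v) \<inter> proj e (cyl u)) = 0"
      using False assms by (intro null_overlap) auto
    then show ?thesis by (simp add: Int_commute)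
  qed
qed

text \<open>\<open>N\<close> and \<open>M\<close> exceed the profiles by at most \<epsilon> in
  measure, and the projections themselves overlap in a null set. In the application \<open>N\<close>
  and \<open>M\<close> stay fixed while \<open>e\<close> varies, so that \<open>e\<close> enters
  only through the translation and the averaging lemma can be used.\<close>

lemma profile_overlap_le:
  assumes "u \<in> lists I" "v \<in> lists I"
    and null: "measure lebesgue (proj e (cyl u) \<inter> proj e (cyl v)) = 0"
    and N: "profile u p e \<subseteq> N" "N \<in> lmeasurable" "measure lebesgue N \<le> shadow e + \<epsilon>"
    and M: "profile v q e \<subseteq> M" "M \<in> lmeasurable" "measure lebesgue M \<le> shadow e + \<epsilon>"
  shows "measure lebesgue ((*) (rw u) ` N \<inter> (+) ((Sw v q - Sw u p) \<bullet> e) ` (*) (rw v) ` M) \<le> (rw u + rw v) * \<epsilon>"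
proof -
  let ?m = "measure lebesgue" and ?g = "(Sw v q - Sw u p) \<bullet> e"
  let ?P = "profile u p e" and ?Q = "profile v q e"
  have scale: "(*) c ` X \<in> lmeasurable" "?m ((*) c ` X) = \<bar>c\<bar> * ?m X" if "X \<in> lmeasurable" for c and X :: "real set"
    using that measure_affine_real[of c 0 X] lmeasurable_affine_real[of X c 0] by auto
  have shift: "(+) c ` X \<in> lmeasurable" "?m ((+) c ` X) = ?m X" if "X \<in> lmeasurable" for c and X :: "real set"
    using that by (auto simp: measurable_translation measure_translation)
  have lm: "?P \<in> lmeasurable" "?Q \<in> lmeasurable"
    using compact_profile by (auto simp: lmeasurable_compact)
  have diff: "?m (N - ?P) \<le> \<epsilon>" "?m (M - ?Q) \<le> \<epsilon>"
    using N M lm assms(1,2) by (simp_all add: measurable_measure_Diff fmeasurableD measure_profile)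
  have lmd: "N - ?P \<in> lmeasurable" "M - ?Q \<in> lmeasurable"
    using N M lm by (auto simp: fmeasurable.Diff)
  let ?A = "(*) (rw u) ` ?P \<inter> (+) ?g ` (*) (rw v) ` ?Q"
  have "proj e (cyl u) \<inter> proj e (cyl v) = (+) (Sw u p \<bullet> e) ` ?A"
    unfolding proj_cyl_profile[OF assms(1), of e p] proj_cyl_profile[OF assms(2), of e q]
    by (subst image_Int) (auto simp: image_image inner_diff_left)
  moreover have A: "?A \<in> lmeasurable" using lm by (intro fmeasurable.Int shift scale)
  ultimately have A0: "?m ?A = 0" using null shift(2)[OF A] by simp
  let ?B = "(*) (rw u) ` (N - ?P)" and ?C = "(+) ?g ` (*) (rw v) ` (M - ?Q)"
  have BC: "?B \<in> lmeasurable" "?C \<in> lmeasurable" using lmd by (auto intro!: scale shift)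
  have "(*) (rw u) ` N \<inter> (+) ?g ` (*) (rw v) ` M \<subseteq> ?A \<union> (?B \<union> ?C)"
    by auto
  then have "?m ((*) (rw u) ` N \<inter> (+) ?g ` (*) (rw v) ` M) \<le> ?m (?A \<union> (?B \<union> ?C))"
    using A BC N M lmd by (intro measure_mono_fmeasurable fmeasurableD[OF fmeasurable.Int] fmeasurable.Un scale shift)
  also have "\<dots> \<le> ?m ?A + (?m ?B + ?m ?C)"
    using A BC by (intro order_trans[OF measure_Un_le] add_left_mono measure_Un_le) (auto simp: fmeasurableD)
  also have "\<dots> \<le> rw u * \<epsilon> + rw v * \<epsilon>"
    using A0 diff lmd rw_pos[OF assms(1)] rw_pos[OF assms(2)]
    by (auto simp: shift scale intro!: add_mono mult_left_mono)
  finally show ?thesis by (simp add: algebra_simps)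
qed

text \<open>As \<open>\<beta>\<close> varies over a ball of radius \<open>\<tau>\<close>, the displacement between the projections of two cylinders of
  size about \<open>s\<close>, chosen around the far pair, sweeps linearly over an interval of length about \<open>s\<close>.\<close>

lemma far_pairs_imp_non_density:
  fixes a d :: 'a
  assumes c0: "0 < shadow (a + \<beta>0 *\<^sub>R d)" and "0 < \<kappa>"
    and far: "\<And>\<eta>. 0 < \<eta> \<Longrightarrow> \<exists>x\<in>\<Lambda>. \<exists>y\<in>\<Lambda>. x \<noteq> y \<and> \<bar>(y - x) \<bullet> (a + \<beta>0 *\<^sub>R d)\<bar> \<le> \<eta> * norm (y - x) \<and>
      \<kappa> * norm (y - x) \<le> \<bar>(y - x) \<bullet> d\<bar>"
  shows "\<exists>\<epsilon>>0. \<forall>t>0. \<exists>\<tau>>0. \<tau> < t \<and>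
    measure lebesgue ({\<beta>. shadow (a + \<beta>0 *\<^sub>R d) - \<epsilon> \<le> shadow (a + \<beta> *\<^sub>R d)} \<inter> cball \<beta>0 \<tau>)
      \<le> (1 - \<epsilon>) * measure lebesgue (cball \<beta>0 \<tau>)"
proof -
  let ?m = "measure lebesgue"
  define e where "e \<beta> = a + \<beta> *\<^sub>R d" for \<beta>
  define c where "c = shadow (e \<beta>0)"
  have "0 < c" using c0 by (simp add: c_def e_def)
  obtain D where D: "1 \<le> D" "\<And>x y. x \<in> \<Lambda> \<Longrightarrow> y \<in> \<Lambda> \<Longrightarrow> norm (x - y) \<le> D"
    by (rule dist_bound) blast
  \<comment> \<open>Normalised profiles, thickened by at most 1, lie within \<open>R / 2\<close> of
    0; cylinders of size at most \<open>s\<close> can then overlap only for displacements up to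
    \<open>R * s\<close>.\<close>
  define R where "R = 2 * (D * norm (e \<beta>0) + 1)"
  have "2 \<le> R" using D by (simp add: R_def)
  \<comment> \<open>After division by \<open>s\<^sup>2\<close>, \<open>k0\<close> bounds the product
    of the two lengths from below, while the averaging lemma bounds it from above by a multiple of
    \<epsilon> with coefficient at most \<open>Q\<close>. The choice of \<epsilon> makes these
    incompatible.\<close>
  define k0 where "k0 = rmin\<^sup>2 * c\<^sup>2"
  define Q where "Q = 16 * R + 8 * (c + 1) * (R + 1)"
  define \<epsilon> where "\<epsilon> = min 1 (k0 / (2 * Q))"
  have "0 < k0" "0 < Q" using rmin \<open>0 < c\<close> \<open>2 \<le> R\<close> by (auto simp: k0_def Q_def add_pos_pos)
  then have \<epsilon>: "0 < \<epsilon>" "\<epsilon> \<le> 1" "\<epsilon> * Q < k0"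
    by (auto simp: \<epsilon>_def min_def field_simps)
  define B where "B = {\<beta>. c - \<epsilon> \<le> shadow (e \<beta>)}"
  have Bm: "B \<in> sets lebesgue"
    using borel_closed[OF closed_shadow_line_ge[of "c - \<epsilon>" a d]] by (simp add: B_def e_def)
  obtain \<delta>0 where \<delta>0: "0 < \<delta>0" "\<And>w e'. w \<in> lists I \<Longrightarrow> norm (e' - Aw w (e \<beta>0)) < \<delta>0 \<Longrightarrow>
      ?m (thicken \<delta>0 (proj e' \<Lambda>)) < c + \<epsilon>"
    using shadow_usc_orbit[OF \<epsilon>(1), of "e \<beta>0"] unfolding c_def by blast
  define \<delta> where "\<delta> = min \<delta>0 1"
  have \<delta>: "0 < \<delta>" "\<delta> \<le> 1" using \<delta>0 by (auto simp: \<delta>_def)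
  have thick: "?m (thicken \<delta> (proj (Aw w (e \<beta>0)) \<Lambda>)) \<le> c + \<epsilon>" if "w \<in> lists I" for w
  proof -
    have "?m (thicken \<delta> (proj (Aw w (e \<beta>0)) \<Lambda>)) \<le> ?m (thicken \<delta>0 (proj (Aw w (e \<beta>0)) \<Lambda>))"
      using compact_proj[OF compact]
      by (intro measure_mono_fmeasurable lmeasurable_thicken compact_imp_bounded thicken_mono sets_thicken) (auto simp: \<delta>_def)
    also have "\<dots> < c + \<epsilon>" using \<delta>0(2)[OF that, of "Aw w (e \<beta>0)"] \<delta>0(1) by simp
    finally show ?thesis by simp
  qed
  have main: "\<exists>\<tau>>0. \<tau> < t \<and> ?m (B \<inter> cball \<beta>0 \<tau>) \<le> (1 - \<epsilon>) * ?m (cball \<beta>0 \<tau>)" if "0 < t" for t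
  proof -
    define t1 where "t1 = min (t / 2) (min 1 (\<delta> / (2 * (norm d + 1) * D)))"
    have t1: "0 < t1" "t1 < t" "D * (t1 * norm d) < \<delta>"
    proof -
      show "0 < t1" "t1 < t" using \<open>0 < t\<close> \<delta> D by (auto simp: t1_def intro!: divide_pos_pos mult_pos_pos add_nonneg_pos)
      have "0 < 2 * (norm d + 1) * D" using D by (intro mult_pos_pos add_nonneg_pos) auto
      moreover have "t1 \<le> \<delta> / (2 * (norm d + 1) * D)" by (simp add: t1_def)
      ultimately have "t1 * (2 * (norm d + 1) * D) \<le> \<delta>" by (simp only: pos_le_divide_eq)
      moreover have "0 < t1 * norm d * D + 2 * t1 * D" using \<open>0 < t1\<close> D by (intro add_nonneg_pos) auto
      ultimately show "D * (t1 * norm d) < \<delta>" by (simp add: algebra_simps)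
    qed
    \<comment> \<open>The first bound keeps the swept parameter range below \<open>t1\<close>; the
      second gives \<open>s \<le> 1\<close> and makes the cylinders small compared with the distance
      of the pair.\<close>
    define \<eta> where "\<eta> = min (\<kappa> * t1 / (R + 1)) (1 / (2 * D))"
    have \<eta>: "0 < \<eta>" "(R + 1) * \<eta> \<le> \<kappa> * t1" "\<eta> * D \<le> 1 / 2"
    proof -
      show "0 < \<eta>" using t1 \<open>0 < \<kappa>\<close> \<open>2 \<le> R\<close> D by (simp add: \<eta>_def)
      have "\<eta> \<le> \<kappa> * t1 / (R + 1)" "\<eta> \<le> 1 / (2 * D)" by (auto simp: \<eta>_def)
      then show "(R + 1) * \<eta> \<le> \<kappa> * t1" "\<eta> * D \<le> 1 / 2"
        using \<open>2 \<le> R\<close> D by (auto simp: field_simps)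
    qed
    obtain x y where xy: "x \<in> \<Lambda>" "y \<in> \<Lambda>" "x \<noteq> y" "\<bar>(y - x) \<bullet> e \<beta>0\<bar> \<le> \<eta> * norm (y - x)"
        "\<kappa> * norm (y - x) \<le> \<bar>(y - x) \<bullet> d\<bar>"
      using far[OF \<eta>(1)] unfolding e_def by blast
    define q where "q = norm (y - x)"
    \<comment> \<open>The size of the cylinders: comparable to the largest initial displacement that
      \<open>far\<close> permits, but small against the distance \<open>q\<close>.\<close>
    define s where "s = \<eta> * q"
    define Y where "Y = (y - x) \<bullet> d"
    define g0 where "g0 = (y - x) \<bullet> e \<beta>0"
    have q: "0 < q" "q \<le> D" using xy D by (auto simp: q_def)
    have "s \<le> \<eta> * D" using q \<eta> by (simp add: s_def)
    then have "s \<le> 1" using \<eta> by linarith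
    moreover have "0 < s" using q \<eta> by (simp add: s_def)
    ultimately have s: "0 < s" "s \<le> 1" by auto
    have sD: "s * D < q"
    proof -
      have "s * D = (\<eta> * D) * q" by (simp add: s_def)
      also have "\<dots> \<le> 1 / 2 * q" using \<eta> q by (intro mult_right_mono) auto
      finally show ?thesis using q by simp
    qed
    have Y: "0 < \<bar>Y\<bar>" "\<kappa> * q \<le> \<bar>Y\<bar>"
    proof -
      show "\<kappa> * q \<le> \<bar>Y\<bar>" using xy by (simp add: Y_def q_def)
      moreover have "0 < \<kappa> * q" using \<open>0 < \<kappa>\<close> q by simp
      ultimately show "0 < \<bar>Y\<bar>" by linarith
    qed
    have g0: "\<bar>g0\<bar> \<le> s" using xy by (simp add: g0_def s_def q_def)
    \<comment> \<open>The displacement starts at \<open>g0\<close>, of size at most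
      \<open>s\<close>, and changes at rate \<open>Y\<close>; this radius lets it reach every value
      up to \<open>R * s\<close>.\<close>
    define \<tau> where "\<tau> = (R + 1) * s / \<bar>Y\<bar>"
    have "(R + 1) * s \<le> t1 * (\<kappa> * q)"
      using mult_right_mono[OF \<eta>(2), of q] q by (simp add: s_def mult_ac)
    also have "\<dots> \<le> t1 * \<bar>Y\<bar>" using Y t1 by (intro mult_left_mono) auto
    finally have "\<tau> \<le> t1" using Y by (simp add: \<tau>_def pos_divide_le_eq)
    moreover have "0 < \<tau>" using Y s \<open>2 \<le> R\<close> unfolding \<tau>_def by (intro divide_pos_pos mult_pos_pos) auto
    ultimately have \<tau>: "0 < \<tau>" "\<tau> \<le> t1" by auto
    have "?m (B \<inter> cball \<beta>0 \<tau>) \<le> (1 - \<epsilon>) * ?m (cball \<beta>0 \<tau>)"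
    proof (rule ccontr)
      assume "\<not> ?thesis"
      then have dense: "(1 - \<epsilon>) * ?m (cball \<beta>0 \<tau>) < ?m (B \<inter> cball \<beta>0 \<tau>)" by simp
      have mball: "?m (cball \<beta>0 \<tau>) = 2 * \<tau>"
        using \<tau> by (simp add: cball_eq_atLeastAtMost)
      have BI: "B \<inter> cball \<beta>0 \<tau> \<in> lmeasurable"
        using fmeasurable_Int_fmeasurable[OF lmeasurable_cball Bm] by (simp add: Int_commute)
      let ?Z0 = "cball \<beta>0 \<tau> - B"
      have Z0: "?Z0 \<in> lmeasurable" using Bm by (intro fmeasurable_Diff) auto
      have "?Z0 = cball \<beta>0 \<tau> - B \<inter> cball \<beta>0 \<tau>" by auto
      then have "?m ?Z0 = 2 * \<tau> - ?m (B \<inter> cball \<beta>0 \<tau>)"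
        using BI by (simp add: measurable_measure_Diff fmeasurableD mball[symmetric])
      then have mZ0: "?m ?Z0 \<le> 2 * \<tau> * \<epsilon>" using dense mball by (simp add: algebra_simps)
      obtain u where u: "u \<in> lists I" "x \<in> cyl u" "rw u \<le> s" "rmin * s \<le> rw u"
        using ex_cyl_size[OF xy(1) s] by blast
      obtain v where v: "v \<in> lists I" "y \<in> cyl v" "rw v \<le> s" "rmin * s \<le> rw v"
        using ex_cyl_size[OF xy(2) s] by blast
      obtain x' where x': "x' \<in> \<Lambda>" "x = Sw u x'" using u by (auto simp: cyl_def)
      obtain y' where y': "y' \<in> \<Lambda>" "y = Sw v y'" using v by (auto simp: cyl_def)
      have ru: "0 < rw u" "0 < rw v" using rw_pos u v by auto
      have "rw u * D \<le> s * D" "rw v * D \<le> s * D"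
        using u(3) v(3) D(1) by (auto intro!: mult_right_mono)
      then have "rw u * D < norm (x - y)" "rw v * D < norm (x - y)"
        using sD by (simp_all add: q_def norm_minus_commute)
      then have null: "?m (proj e (cyl u) \<inter> proj e (cyl v)) = 0" for e
        using far_cylinders_incomparable[OF u(2) v(2) u(1) v(1) D(2)] by blast
      define N where "N w p = thicken \<delta> (profile w p (e \<beta>0))" for w p
      have N: "open (N w p)" "N w p \<in> lmeasurable" "?m (N w p) \<le> c + \<epsilon>" "c \<le> ?m (N w p)"
          "N w p \<subseteq> {-(R/2)..R/2}"
        if w: "w \<in> lists I" "p \<in> \<Lambda>" for w p
      proof -
        show "open (N w p)" by (simp add: N_def open_thicken)
        show lm: "N w p \<in> lmeasurable"
          unfolding N_def by (intro lmeasurable_thicken compact_imp_bounded compact_profile)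
        show "?m (N w p) \<le> c + \<epsilon>" using thick w by (simp add: N_def measure_thicken_profile)
        have "profile w p (e \<beta>0) \<subseteq> N w p" using \<delta> by (auto simp: N_def intro: thicken_memI)
        then have "?m (profile w p (e \<beta>0)) \<le> ?m (N w p)"
          using lm by (intro measure_mono_fmeasurable) (auto simp: compact_profile lmeasurable_compact fmeasurableD)
        then show "c \<le> ?m (N w p)" using w by (simp add: measure_profile c_def)
        show "N w p \<subseteq> {-(R/2)..R/2}"
        proof
          fix t assume "t \<in> N w p"
          then obtain z where z: "z \<in> profile w p (e \<beta>0)" "\<bar>z - t\<bar> < \<delta>"
            by (auto simp: N_def thicken_def dist_real_def)
          have "\<bar>z\<bar> \<le> D * norm (e \<beta>0)" using profile_bound[OF w D(2) z(1)] by blast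
          then have "\<bar>t\<bar> \<le> R / 2" using z \<delta> by (simp add: R_def)
          then show "t \<in> {-(R/2)..R/2}" by auto
        qed
      qed
      let ?P = "(*) (rw u) ` N u x'" and ?Q = "(*) (rw v) ` N v y'"
      have sc: "open ((*) (rw w) ` N w p)" "(*) (rw w) ` N w p \<subseteq> {-(s * (R/2))..s * (R/2)}"
          "?m ((*) (rw w) ` N w p) = rw w * ?m (N w p)"
        if w: "w \<in> lists I" "p \<in> \<Lambda>" "rw w \<le> s" for w p
      proof -
        have "0 < rw w" using rw_pos w by blast
        then show "open ((*) (rw w) ` N w p)" using open_scaling[of "rw w" "N w p"] N(1)[OF w(1,2)] by simp
        show "?m ((*) (rw w) ` N w p) = rw w * ?m (N w p)"
          using measure_affine_real[of "rw w" 0] \<open>0 < rw w\<close> by simp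
        show "(*) (rw w) ` N w p \<subseteq> {-(s * (R/2))..s * (R/2)}"
        proof clarify
          fix t assume "t \<in> N w p"
          then have "\<bar>t\<bar> \<le> R / 2" using N(5)[OF w(1,2)] by (force simp: abs_le_iff)
          then have "rw w * \<bar>t\<bar> \<le> s * (R / 2)"
            using w \<open>0 < rw w\<close> s by (intro mult_mono) auto
          then have "\<bar>rw w * t\<bar> \<le> s * (R / 2)" using \<open>0 < rw w\<close> by (simp add: abs_mult)
          then show "rw w * t \<in> {-(s * (R/2))..s * (R/2)}" unfolding atLeastAtMost_iff by linarith
        qed
      qed
      \<comment> \<open>The displacements that occur at the parameters outside the level set
        \<open>B\<close>.\<close>
      define Z where "Z = (\<lambda>\<beta>. Y * \<beta> + (g0 - Y * \<beta>0)) ` ?Z0"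
      have Zm: "Z \<in> lmeasurable" "?m Z = \<bar>Y\<bar> * ?m ?Z0"
      proof -
        show "?m Z = \<bar>Y\<bar> * ?m ?Z0" unfolding Z_def by (rule measure_affine_real)
        show "Z \<in> lmeasurable" unfolding Z_def using Z0 by (rule lmeasurable_affine_real)
      qed
      have overlap: "?m (?P \<inter> (+) \<sigma> ` ?Q) \<le> 4 * s * \<epsilon>" if \<sigma>: "\<bar>\<sigma>\<bar> \<le> 2 * (s * (R/2))" "\<sigma> \<notin> Z" for \<sigma>
      proof -
        \<comment> \<open>The parameter at which the displacement of the two cylinders is exactly
          \<sigma>.\<close>
        define \<beta> where "\<beta> = \<beta>0 + (\<sigma> - g0) / Y"
        have "\<bar>\<sigma> - g0\<bar> \<le> (R + 1) * s" using \<sigma>(1) g0 by (simp add: algebra_simps)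
        then have "\<bar>(\<sigma> - g0) / Y\<bar> \<le> \<tau>" using Y by (simp add: \<tau>_def abs_divide divide_right_mono)
        then have "\<beta> \<in> cball \<beta>0 \<tau>" by (simp add: \<beta>_def dist_real_def)
        have \<sigma>_eq: "\<sigma> = Y * \<beta> + (g0 - Y * \<beta>0)" using Y by (simp add: \<beta>_def field_simps)
        then have "\<beta> \<in> B" using \<sigma>(2) \<open>\<beta> \<in> cball \<beta>0 \<tau>\<close> unfolding Z_def by blast
        then have sh: "c - \<epsilon> \<le> shadow (e \<beta>)" by (simp add: B_def)
        have e_diff: "e \<beta> - e \<beta>0 = (\<beta> - \<beta>0) *\<^sub>R d" by (simp add: e_def algebra_simps)
        have "\<bar>\<beta> - \<beta>0\<bar> \<le> t1" using \<open>\<beta> \<in> cball \<beta>0 \<tau>\<close> \<tau> by (simp add: dist_real_def abs_minus_commute)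
        then have "D * norm (e \<beta> - e \<beta>0) \<le> D * (t1 * norm d)"
          using D by (simp add: e_diff mult_right_mono)
        then have small: "D * norm (e \<beta> - e \<beta>0) < \<delta>" using t1 by simp
        have "(Sw v y' - Sw u x') \<bullet> e \<beta> = g0 + (\<beta> - \<beta>0) * Y"
          using e_diff unfolding x'(2)[symmetric] y'(2)[symmetric] g0_def Y_def
          by (metis add_diff_cancel_left' diff_add_cancel inner_add_right inner_scaleR_right add.commute)
        then have \<sigma>2: "\<sigma> = (Sw v y' - Sw u x') \<bullet> e \<beta>" by (simp add: \<sigma>_eq algebra_simps)
        have "?m (?P \<inter> (+) \<sigma> ` ?Q) \<le> (rw u + rw v) * (2 * \<epsilon>)"
          unfolding \<sigma>2
        proof (rule profile_overlap_le[OF u(1) v(1) null])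
          show "profile u x' (e \<beta>) \<subseteq> N u x'" unfolding N_def
            using profile_subset_thicken[OF u(1) x'(1) D(2) small] by blast
          show "profile v y' (e \<beta>) \<subseteq> N v y'" unfolding N_def
            using profile_subset_thicken[OF v(1) y'(1) D(2) small] by blast
        qed (use N[OF u(1) x'(1)] N[OF v(1) y'(1)] sh in auto)
        also have "\<dots> \<le> (s + s) * (2 * \<epsilon>)" using u v \<epsilon> by (intro mult_right_mono) auto
        finally show ?thesis by simp
      qed
      have "?m ?P * ?m ?Q \<le> 4 * (s * (R/2)) * (4 * s * \<epsilon>) + ?m ?P * ?m Z"
        using measure_times_le_translate_overlap[OF sc(1,2)[OF u(1) x'(1) u(3)] sc(1,2)[OF v(1) y'(1) v(3)] Zm(1) _ overlap]
          s \<epsilon> \<open>2 \<le> R\<close> by auto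
      moreover have "(rmin * s * c) * (rmin * s * c) \<le> ?m ?P * ?m ?Q"
        using sc(3)[OF u(1) x'(1) u(3)] sc(3)[OF v(1) y'(1) v(3)] N(4)[OF u(1) x'(1)] N(4)[OF v(1) y'(1)]
          u(4) v(4) ru \<open>0 < c\<close> rmin(1) s(1) by (auto intro!: mult_mono)
      moreover have "?m ?P * ?m Z \<le> (s * (c + 1)) * (2 * \<epsilon> * (R + 1) * s)"
      proof (rule mult_mono)
        have "?m ?P \<le> s * (c + \<epsilon>)"
          using sc(3)[OF u(1) x'(1) u(3)] N(3)[OF u(1) x'(1)] u(3) ru s by (auto intro!: mult_mono)
        also have "\<dots> \<le> s * (c + 1)" using s \<epsilon> by simp
        finally show "?m ?P \<le> s * (c + 1)" .
        have "?m Z \<le> \<bar>Y\<bar> * (2 * \<tau> * \<epsilon>)" unfolding Zm(2) using mZ0 by (intro mult_left_mono) auto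
        also have "\<dots> = 2 * \<epsilon> * (R + 1) * s" using Y by (simp add: \<tau>_def)
        finally show "?m Z \<le> 2 * \<epsilon> * (R + 1) * s" .
      qed (use s \<open>0 < c\<close> in auto)
      ultimately have "(rmin * s * c) * (rmin * s * c) \<le> 4 * (s * (R/2)) * (4 * s * \<epsilon>) + (s * (c + 1)) * (2 * \<epsilon> * (R + 1) * s)"
        by linarith
      then have "s\<^sup>2 * k0 \<le> s\<^sup>2 * (\<epsilon> * (8 * R + 2 * (c + 1) * (R + 1)))"
        by (simp add: k0_def power2_eq_square algebra_simps)
      then have "k0 \<le> \<epsilon> * (8 * R + 2 * (c + 1) * (R + 1))"
        using s by (simp add: mult_le_cancel_left_pos)
      also have "\<dots> \<le> \<epsilon> * Q"
      proof (rule mult_left_mono)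
        have "0 \<le> (c + 1) * (R + 1)" using \<open>0 < c\<close> \<open>2 \<le> R\<close> by simp
        then show "8 * R + 2 * (c + 1) * (R + 1) \<le> Q"
          using \<open>2 \<le> R\<close> unfolding Q_def mult.assoc by linarith
      qed (use \<epsilon> in simp)
      finally show False using \<epsilon> by simp
    qed
    then show ?thesis using \<tau> t1 by (intro exI[of _ \<tau>]) auto
  qed
  then show ?thesis
    using \<epsilon>(1) unfolding B_def c_def e_def by blast
qed

end

section \<open>Bi-Lipschitz projections\<close>

definition dense_at :: "real \<Rightarrow> real set \<Rightarrow> real \<Rightarrow> bool" where
  "dense_at \<epsilon> K s \<longleftrightarrow> (\<exists>r0>0. \<forall>r. 0 < r \<and> r < r0 \<longrightarrow>
    (1 - \<epsilon>) * measure lebesgue (cball s r) < measure lebesgue (K \<inter> cball s r))"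

text \<open>Lebesgue's density theorem with a fixed proportional deficit: failure of
  \<open>dense_at\<close> supplies arbitrarily small sparse balls.\<close>

lemma negligible_not_dense_at:
  assumes "K \<in> sets lebesgue" "0 < \<epsilon>"
  shows "negligible {s \<in> K. \<not> dense_at \<epsilon> K s}"
proof (rule negligible_non_density_points[of _ K "1 - \<epsilon>"])
  fix x d :: real
  assume "x \<in> {s \<in> K. \<not> dense_at \<epsilon> K s}" "0 < d"
  then have "\<not> dense_at \<epsilon> K x" by simp
  show "\<exists>r>0. r < d \<and> measure lebesgue (K \<inter> cball x r) \<le> (1 - \<epsilon>) * measure lebesgue (cball x r)"
  proof (rule ccontr)
    assume "\<not> ?thesis"
    then have "dense_at \<epsilon> K x"
      unfolding dense_at_def using \<open>0 < d\<close> by (intro exI[of _ d]) (simp add: not_le)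
    with \<open>\<not> dense_at \<epsilon> K x\<close> show False ..
  qed
qed (use assms in auto)

text \<open>What \<open>K\<close> misses of a subinterval is at most what it misses of the whole
  ball.\<close>

lemma gap_le:
  fixes s r \<epsilon> :: real
  assumes "(1 - \<epsilon>) * measure lebesgue (cball s r) < measure lebesgue (K \<inter> cball s r)" "0 < r"
    and "K \<in> sets lebesgue" "{a..b} \<subseteq> cball s r" "a \<le> b"
  shows "b - a - 2 * r * \<epsilon> \<le> measure lebesgue (K \<inter> {a..b})" "measure lebesgue (K \<inter> {a..b}) \<le> b - a"
proof -
  let ?m = "measure lebesgue"
  have lm: "K \<inter> {a..b} \<in> lmeasurable" "K \<inter> cball s r \<in> lmeasurable"
    using fmeasurable_Int_fmeasurable[OF _ assms(3), of "{a..b}"] fmeasurable_Int_fmeasurable[OF _ assms(3), of "cball s r"]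
    by (auto simp: Int_commute)
  have "?m (K \<inter> {a..b}) \<le> ?m {a..b}" using lm by (intro measure_mono_fmeasurable) (auto simp: fmeasurableD)
  then show "?m (K \<inter> {a..b}) \<le> b - a" using assms by simp
  have "K \<inter> cball s r \<subseteq> (K \<inter> {a..b}) \<union> (cball s r - {a..b})" using assms by auto
  then have "?m (K \<inter> cball s r) \<le> ?m ((K \<inter> {a..b}) \<union> (cball s r - {a..b}))"
    using lm by (intro measure_mono_fmeasurable fmeasurable.Un fmeasurable.Diff) (auto simp: fmeasurableD)
  also have "\<dots> \<le> ?m (K \<inter> {a..b}) + ?m (cball s r - {a..b})"
    using lm by (intro measure_Un_le) (auto simp: fmeasurableD)
  also have "?m (cball s r - {a..b}) = 2 * r - (b - a)"
    using assms by (subst measurable_measure_Diff) (auto simp: cball_eq_atLeastAtMost)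
  finally show "b - a - 2 * r * \<epsilon> \<le> ?m (K \<inter> {a..b})"
    using assms(1,2) by (simp add: cball_eq_atLeastAtMost algebra_simps)
qed

context subunit_similitude_system
begin

text \<open>The cylinders that meet the strip cover it and stick out by at most \<rho> at either
  end. The sum of their ratios depends on the point set \<open>A\<close> alone, which allows a
  comparison of directions.\<close>

lemma measure_strip:
  assumes A: "A = {z \<in> \<Lambda>. s \<le> z \<bullet> e \<and> z \<bullet> e \<le> t}" and "0 \<le> \<rho>"
    and small: "\<And>w x y. w \<in> words n \<Longrightarrow> x \<in> cyl w \<Longrightarrow> y \<in> cyl w \<Longrightarrow> \<bar>(x - y) \<bullet> e\<bar> \<le> \<rho>"
  shows "measure lebesgue (proj e \<Lambda> \<inter> {s..t}) \<le> (\<Sum>w | w \<in> words n \<and> cyl w \<inter> A \<noteq> {}. rw w) * shadow e"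
    and "(\<Sum>w | w \<in> words n \<and> cyl w \<inter> A \<noteq> {}. rw w) * shadow e \<le> measure lebesgue (proj e \<Lambda> \<inter> {s..t}) + 2 * \<rho>"
proof -
  let ?m = "measure lebesgue"
  let ?W = "{w \<in> words n. cyl w \<inter> A \<noteq> {}}"
  let ?U = "\<Union>w\<in>?W. proj e (cyl w)"
  have W: "?m ?U = (\<Sum>w\<in>?W. rw w) * shadow e" by (rule measure_proj_UN_cyl[of _ n]) auto
  have K: "proj e \<Lambda> \<inter> {s..t} \<in> lmeasurable"
    using compact_proj[OF compact] by (intro lmeasurable_compact compact_Int) auto
  have U: "?U \<in> lmeasurable"
    using finite_words[of n] by (intro fmeasurable.finite_UN lmeasurable_proj_cyl words_lists) auto
  have "proj e \<Lambda> \<inter> {s..t} \<subseteq> ?U"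
  proof
    fix p assume "p \<in> proj e \<Lambda> \<inter> {s..t}"
    then obtain z where z: "z \<in> \<Lambda>" "p = z \<bullet> e" "z \<in> A" by (auto simp: proj_def A)
    then obtain w where "w \<in> words n" "z \<in> cyl w" using Un_cyl[of n] by blast
    then show "p \<in> ?U" using z by (auto simp: proj_def)
  qed
  then show "?m (proj e \<Lambda> \<inter> {s..t}) \<le> (\<Sum>w | w \<in> words n \<and> cyl w \<inter> A \<noteq> {}. rw w) * shadow e"
    using K U W measure_mono_fmeasurable[of "proj e \<Lambda> \<inter> {s..t}" ?U lebesgue] by (simp add: fmeasurableD)
  have "?U \<subseteq> (proj e \<Lambda> \<inter> {s..t}) \<union> ({s - \<rho>..s} \<union> {t..t + \<rho>})"
  proof
    fix p assume "p \<in> ?U"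
    then obtain w z y where w: "w \<in> words n" "z \<in> cyl w" "p = z \<bullet> e" "y \<in> cyl w" "y \<in> A"
      by (auto simp: proj_def)
    then have "\<bar>z \<bullet> e - y \<bullet> e\<bar> \<le> \<rho>" using small[of w z y] by (simp add: inner_diff_left)
    moreover have "s \<le> y \<bullet> e" "y \<bullet> e \<le> t" using w A by auto
    moreover have "p \<in> proj e \<Lambda>" using w cyl_subset[OF words_lists[OF w(1)]] by (auto simp: proj_def)
    ultimately show "p \<in> (proj e \<Lambda> \<inter> {s..t}) \<union> ({s - \<rho>..s} \<union> {t..t + \<rho>})"
      using w(3) by auto
  qed
  then have "?m ?U \<le> ?m ((proj e \<Lambda> \<inter> {s..t}) \<union> ({s - \<rho>..s} \<union> {t..t + \<rho>}))"
    using K U by (intro measure_mono_fmeasurable fmeasurable.Un) (auto simp: fmeasurableD)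
  also have "\<dots> \<le> ?m (proj e \<Lambda> \<inter> {s..t}) + (?m {s - \<rho>..s} + ?m {t..t + \<rho>})"
    using K by (intro order_trans[OF measure_Un_le] add_left_mono measure_Un_le) (auto simp: fmeasurableD)
  finally show "(\<Sum>w | w \<in> words n \<and> cyl w \<inter> A \<noteq> {}. rw w) * shadow e \<le> ?m (proj e \<Lambda> \<inter> {s..t}) + 2 * \<rho>"
    using W \<open>0 \<le> \<rho>\<close> by simp
qed

text \<open>Both sides count the same cylinders, once with factor \<open>shadow e\<close> and once
  with \<open>shadow e'\<close>; the boundary error vanishes with the size of the cylinders.
  Exchanging the directions gives equality.\<close>

lemma measure_strip_proportional:
  assumes A: "{z \<in> \<Lambda>. s \<le> z \<bullet> e \<and> z \<bullet> e \<le> t} = {z \<in> \<Lambda>. s' \<le> z \<bullet> e' \<and> z \<bullet> e' \<le> t'}"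
  shows "shadow e' * measure lebesgue (proj e \<Lambda> \<inter> {s..t}) \<le> shadow e * measure lebesgue (proj e' \<Lambda> \<inter> {s'..t'})"
proof (rule field_le_epsilon)
  fix \<epsilon> :: real assume "0 < \<epsilon>"
  obtain D where D: "1 \<le> D" "\<And>x y. x \<in> \<Lambda> \<Longrightarrow> y \<in> \<Lambda> \<Longrightarrow> norm (x - y) \<le> D"
    by (rule dist_bound) blast
  define \<rho> where "\<rho> = \<epsilon> / (2 * (shadow e + 1))"
  have \<rho>: "0 < \<rho>" "shadow e * (2 * \<rho>) \<le> \<epsilon>"
    using \<open>0 < \<epsilon>\<close> shadow_nonneg[of e] by (auto simp: \<rho>_def field_simps add_pos_nonneg)
  define E where "E = norm e + norm e' + 1"
  have E: "0 < E" "norm e \<le> E" "norm e' \<le> E" by (auto simp: E_def add_nonneg_pos)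
  have "0 < \<rho> / (D * E)" using \<rho> D E by simp
  from eventually_happens'[OF _ eventually_rw_less[OF this]]
  obtain n where n: "\<And>w. w \<in> words n \<Longrightarrow> rw w < \<rho> / (D * E)" by auto
  have small: "\<bar>(x - y) \<bullet> f\<bar> \<le> \<rho>" if prems: "w \<in> words n" "x \<in> cyl w" "y \<in> cyl w" "norm f \<le> E" for w x y f
  proof -
    obtain p q where pq: "p \<in> \<Lambda>" "q \<in> \<Lambda>" "x = Sw w p" "y = Sw w q" using prems(2,3) by (auto simp: cyl_def)
    have "norm (x - y) = rw w * norm (p - q)"
      using dist_Sw[OF words_lists[OF prems(1)], of p q] pq by (simp add: dist_norm)
    also have "\<dots> \<le> \<rho> / (D * E) * D"
      using n[OF prems(1)] D pq rw_pos[OF words_lists[OF prems(1)]] by (intro mult_mono) auto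
    also have "\<dots> = \<rho> / E" using D by simp
    finally have "norm (x - y) \<le> \<rho> / E" .
    have "\<bar>(x - y) \<bullet> f\<bar> \<le> norm (x - y) * norm f" by (rule Cauchy_Schwarz_ineq2)
    also have "\<dots> \<le> \<rho> / E * E" using \<open>norm (x - y) \<le> \<rho> / E\<close> prems E \<rho> by (intro mult_mono) auto
    finally show ?thesis using E by simp
  qed
  let ?S = "\<Sum>w | w \<in> words n \<and> cyl w \<inter> {z \<in> \<Lambda>. s \<le> z \<bullet> e \<and> z \<bullet> e \<le> t} \<noteq> {}. rw w"
  have "measure lebesgue (proj e \<Lambda> \<inter> {s..t}) \<le> ?S * shadow e"
    using measure_strip(1)[OF refl, of \<rho> n e s t] small E \<rho> by auto
  then have "shadow e' * measure lebesgue (proj e \<Lambda> \<inter> {s..t}) \<le> shadow e' * (?S * shadow e)"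
    using shadow_nonneg[of e'] by (rule mult_left_mono)
  also have "\<dots> = shadow e * (?S * shadow e')" by simp
  also have "\<dots> \<le> shadow e * (measure lebesgue (proj e' \<Lambda> \<inter> {s'..t'}) + 2 * \<rho>)"
    using measure_strip(2)[OF refl, of \<rho> n e' s' t'] small E \<rho> A shadow_nonneg by (intro mult_left_mono) auto
  also have "\<dots> \<le> shadow e * measure lebesgue (proj e' \<Lambda> \<inter> {s'..t'}) + \<epsilon>"
    using \<rho> by (simp add: distrib_left)
  finally show "shadow e' * measure lebesgue (proj e \<Lambda> \<inter> {s..t}) \<le> shadow e * measure lebesgue (proj e' \<Lambda> \<inter> {s'..t'}) + \<epsilon>" .
qed

text \<open>Near a point that is a density point for both projections, each projection nearly fills
  intervals, so proportionality of the measures becomes proportionality of the coordinates. This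
  makes a small cylinder nearly flat, and \<open>Sw w\<close> transfers the flatness to
  \<Lambda>.\<close>

lemma bilipschitz_projection_flat:
  assumes pos: "0 < shadow e" and "0 < \<eta>"
    and bilip: "\<And>x y. x \<in> \<Lambda> \<Longrightarrow> y \<in> \<Lambda> \<Longrightarrow> \<eta> * norm (y - x) \<le> \<bar>(y - x) \<bullet> e\<bar>"
    and e': "norm (e' - e) \<le> \<eta> / 2"
    and "0 < \<epsilon>"
  shows "\<exists>w\<in>lists I. \<exists>x\<in>\<Lambda>. \<forall>y\<in>\<Lambda>. \<bar>(y - x) \<bullet> Aw w (shadow e *\<^sub>R e' - shadow e' *\<^sub>R e)\<bar> \<le> \<epsilon>"
proof -
  let ?m = "measure lebesgue"
  let ?K = "proj e \<Lambda>" and ?K' = "proj e' \<Lambda>"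
  \<comment> \<open>The change of direction alters differences of projections by at most half, so
    the projections along \<open>e\<close> and \<open>e'\<close> order \<Lambda> in the same
    way.\<close>
  have close: "\<bar>(y - x) \<bullet> e' - (y - x) \<bullet> e\<bar> \<le> \<bar>(y - x) \<bullet> e\<bar> / 2" if "x \<in> \<Lambda>" "y \<in> \<Lambda>" for x y
  proof -
    have "\<bar>(y - x) \<bullet> (e' - e)\<bar> \<le> norm (y - x) * norm (e' - e)" by (rule Cauchy_Schwarz_ineq2)
    also have "\<dots> \<le> norm (y - x) * (\<eta> / 2)" using e' by (intro mult_left_mono) auto
    also have "\<dots> \<le> \<bar>(y - x) \<bullet> e\<bar> / 2" using bilip[OF that] by (simp add: mult_ac)
    finally show ?thesis by (simp add: inner_diff_right)
  qed
  have mono: "x \<bullet> e \<le> y \<bullet> e \<longleftrightarrow> x \<bullet> e' \<le> y \<bullet> e'" if "x \<in> \<Lambda>" "y \<in> \<Lambda>" for x y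
    using close[OF that] by (auto simp: inner_diff_left abs_if split: if_splits)
  obtain D where D: "1 \<le> D" "\<And>x y. x \<in> \<Lambda> \<Longrightarrow> y \<in> \<Lambda> \<Longrightarrow> norm (x - y) \<le> D"
    by (rule dist_bound) blast
  define E where "E = norm e + norm e' + 1"
  have E: "0 < E" "norm e \<le> E" "norm e' \<le> E" by (auto simp: E_def add_nonneg_pos)
  define F where "F = shadow e + shadow e'"
  have F: "0 < F" using pos shadow_nonneg[of e'] by (simp add: F_def)
  \<comment> \<open>Chosen so that \<open>2 * R * \<theta> * F = rw w * \<epsilon>\<close> for the
    radius \<open>R\<close> fixed below.\<close>
  define \<theta> where "\<theta> = \<epsilon> / (2 * D * E * F)"
  have \<theta>: "0 < \<theta>" using \<open>0 < \<epsilon>\<close> D E F by (simp add: \<theta>_def)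
  let ?N = "{s \<in> ?K. \<not> dense_at \<theta> ?K s}" and ?N' = "{s \<in> ?K'. \<not> dense_at \<theta> ?K' s}"
  have Km: "?K \<in> sets lebesgue" "?K' \<in> sets lebesgue"
    using lmeasurable_proj[OF compact] by (auto simp: fmeasurableD)
  \<comment> \<open>The transition from the \<open>e'\<close>-coordinate of a point of \<Lambda> to
    its \<open>e\<close>-coordinate. It is Lipschitz with constant 2, so it carries the exceptional
    null set to a null set and one point can be good for both projections.\<close>
  let ?g = "\<lambda>s. (SOME z. z \<in> \<Lambda> \<and> z \<bullet> e' = s) \<bullet> e"
  have g: "?g (z \<bullet> e') = z \<bullet> e" if "z \<in> \<Lambda>" for z
  proof -
    have "\<exists>y. y \<in> \<Lambda> \<and> y \<bullet> e' = z \<bullet> e'" using that by blast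
    from someI_ex[OF this]
    have *: "(SOME y. y \<in> \<Lambda> \<and> y \<bullet> e' = z \<bullet> e') \<in> \<Lambda>" "(SOME y. y \<in> \<Lambda> \<and> y \<bullet> e' = z \<bullet> e') \<bullet> e' = z \<bullet> e'"
      by auto
    then show ?thesis using mono[OF *(1) that] mono[OF that *(1)] by auto
  qed
  have "negligible (?g ` ?N')"
  proof (rule negligible_locally_Lipschitz_image)
    show "negligible ?N'" by (rule negligible_not_dense_at[OF Km(2) \<theta>])
    fix s assume "s \<in> ?N'"
    then obtain z where z: "z \<in> \<Lambda>" "s = z \<bullet> e'" by (auto simp: proj_def)
    have "norm (?g t - ?g s) \<le> 2 * norm (t - s)" if t: "t \<in> ?N'" for t
    proof -
      obtain y where y: "y \<in> \<Lambda>" "t = y \<bullet> e'" using t by (auto simp: proj_def)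
      show ?thesis using close[OF z(1) y(1)] unfolding y(2) z(2) g[OF y(1)] g[OF z(1)]
        by (auto simp: inner_diff_left abs_if split: if_splits)
    qed
    then show "\<exists>T B. open T \<and> s \<in> T \<and> (\<forall>t\<in>?N' \<inter> T. norm (?g t - ?g s) \<le> B * norm (t - s))"
      by (intro exI[of _ UNIV] exI[of _ 2]) auto
  qed simp
  moreover have "negligible ?N" by (rule negligible_not_dense_at[OF Km(1) \<theta>])
  ultimately have "negligible (?N \<union> ?g ` ?N')" by (rule negligible_Un[rotated])
  moreover have "\<not> negligible ?K"
    using pos negligible_imp_measure0[of ?K] unfolding shadow_def by auto
  ultimately obtain s0 where "s0 \<in> ?K" "s0 \<notin> ?N" "s0 \<notin> ?g ` ?N'"
    using negligible_subset by blast
  then obtain x0 where x0: "x0 \<in> \<Lambda>" "dense_at \<theta> ?K (x0 \<bullet> e)" "dense_at \<theta> ?K' (x0 \<bullet> e')"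
    using g by (force simp: proj_def)
  obtain r1 where r1: "0 < r1" "\<And>R. 0 < R \<Longrightarrow> R < r1 \<Longrightarrow>
      (1 - \<theta>) * ?m (cball (x0 \<bullet> e) R) < ?m (?K \<inter> cball (x0 \<bullet> e) R)"
    using x0(2) unfolding dense_at_def by blast
  obtain r2 where r2: "0 < r2" "\<And>R. 0 < R \<Longrightarrow> R < r2 \<Longrightarrow>
      (1 - \<theta>) * ?m (cball (x0 \<bullet> e') R) < ?m (?K' \<inter> cball (x0 \<bullet> e') R)"
    using x0(3) unfolding dense_at_def by blast
  define \<sigma> where "\<sigma> = min 1 (min r1 r2 / (2 * D * E))"
  have \<sigma>: "0 < \<sigma>" "\<sigma> \<le> 1" using r1 r2 D E by (auto simp: \<sigma>_def)
  obtain w where w: "w \<in> lists I" "x0 \<in> cyl w" "rw w \<le> \<sigma>" using ex_cyl_size[OF x0(1) \<sigma>] by blast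
  obtain x where x: "x \<in> \<Lambda>" "x0 = Sw w x" using w by (auto simp: cyl_def)
  have rwp: "0 < rw w" using rw_pos w by blast
  define R where "R = rw w * D * E"
  have "R \<le> \<sigma> * (D * E)" unfolding R_def mult.assoc using w D E by (intro mult_right_mono) auto
  also have "\<dots> \<le> min r1 r2 / (2 * D * E) * (D * E)"
    using D E by (intro mult_right_mono) (auto simp: \<sigma>_def)
  also have "\<dots> = min r1 r2 / 2" using D E by simp
  also have "min r1 r2 / 2 < min r1 r2" using r1(1) r2(1) by linarith
  finally have R: "0 < R" "R < r1" "R < r2" using rwp D E by (auto simp: R_def)
  \<comment> \<open>The strip between \<open>x0\<close> and \<open>y\<close> is the same set of
    points for both directions, and up to the density deficit the measures of its projections are
    their interval lengths.\<close>
  have key: "\<bar>(y - x0) \<bullet> (shadow e *\<^sub>R e' - shadow e' *\<^sub>R e)\<bar> \<le> 2 * R * \<theta> * F" if y: "y \<in> cyl w" for y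
  proof -
    have y\<Lambda>: "y \<in> \<Lambda>" using y cyl_subset w by blast
    obtain y' where y': "y' \<in> \<Lambda>" "y = Sw w y'" using y by (auto simp: cyl_def)
    have "norm (y - x0) = rw w * norm (y' - x)"
      using dist_Sw[OF w(1), of y' x] by (simp add: y' x dist_norm)
    also have "\<dots> \<le> rw w * D" using D y' x rwp by (intro mult_left_mono) auto
    finally have nrm: "norm (y - x0) \<le> rw w * D" .
    have near: "\<bar>y \<bullet> f - x0 \<bullet> f\<bar> \<le> R" if "norm f \<le> E" for f
    proof -
      have "\<bar>(y - x0) \<bullet> f\<bar> \<le> norm (y - x0) * norm f" by (rule Cauchy_Schwarz_ineq2)
      also have "\<dots> \<le> (rw w * D) * E" using nrm that rwp D by (intro mult_mono) auto
      finally show ?thesis by (simp add: R_def inner_diff_left)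
    qed
    have ordered: "\<bar>shadow e * (b \<bullet> e' - a \<bullet> e') - shadow e' * (b \<bullet> e - a \<bullet> e)\<bar> \<le> 2 * R * \<theta> * F"
      if ab: "{a, b} = {x0, y}" "a \<bullet> e \<le> b \<bullet> e" for a b
    proof -
      have \<Lambda>: "a \<in> \<Lambda>" "b \<in> \<Lambda>" using ab x0 y\<Lambda> by auto
      have le': "a \<bullet> e' \<le> b \<bullet> e'" using mono[OF \<Lambda>] ab by simp
      have strip: "{z \<in> \<Lambda>. a \<bullet> e \<le> z \<bullet> e \<and> z \<bullet> e \<le> b \<bullet> e} = {z \<in> \<Lambda>. a \<bullet> e' \<le> z \<bullet> e' \<and> z \<bullet> e' \<le> b \<bullet> e'}"
        using mono \<Lambda> by blast
      have eq: "shadow e' * ?m (?K \<inter> {a \<bullet> e..b \<bullet> e}) = shadow e * ?m (?K' \<inter> {a \<bullet> e'..b \<bullet> e'})"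
        using measure_strip_proportional[OF strip] measure_strip_proportional[OF strip[symmetric]] by (rule antisym)
      have sub: "{a \<bullet> f..b \<bullet> f} \<subseteq> cball (x0 \<bullet> f) R" if "norm f \<le> E" "a \<bullet> f \<le> b \<bullet> f" for f
      proof -
        have "\<bar>a \<bullet> f - x0 \<bullet> f\<bar> \<le> R" "\<bar>b \<bullet> f - x0 \<bullet> f\<bar> \<le> R"
          using ab(1) near[OF that(1)] R by (auto simp: doubleton_eq_iff)
        then show ?thesis by (auto simp: cball_eq_atLeastAtMost)
      qed
      note g = gap_le[OF r1(2)[OF R(1,2)] R(1) Km(1) sub[OF E(2) ab(2)] ab(2)]
      note g' = gap_le[OF r2(2)[OF R(1,3)] R(1) Km(2) sub[OF E(3) le'] le']
      have "\<bar>shadow e' * (b \<bullet> e - a \<bullet> e) - shadow e' * ?m (?K \<inter> {a \<bullet> e..b \<bullet> e})\<bar> \<le> shadow e' * (2 * R * \<theta>)"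
        using g shadow_nonneg[of e'] unfolding right_diff_distrib[symmetric] abs_mult
        by (auto intro!: mult_mono)
      moreover have "\<bar>shadow e * (b \<bullet> e' - a \<bullet> e') - shadow e * ?m (?K' \<inter> {a \<bullet> e'..b \<bullet> e'})\<bar> \<le> shadow e * (2 * R * \<theta>)"
        using g' shadow_nonneg[of e] unfolding right_diff_distrib[symmetric] abs_mult
        by (auto intro!: mult_mono)
      ultimately have "\<bar>shadow e * (b \<bullet> e' - a \<bullet> e') - shadow e' * (b \<bullet> e - a \<bullet> e)\<bar> \<le> shadow e' * (2 * R * \<theta>) + shadow e * (2 * R * \<theta>)"
        using eq by linarith
      then show ?thesis by (simp add: F_def algebra_simps)
    qed
    show ?thesis
    proof (cases "x0 \<bullet> e \<le> y \<bullet> e")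
      case True
      then show ?thesis using ordered[of x0 y] by (simp add: inner_diff_left inner_diff_right)
    next
      case False
      then show ?thesis using ordered[of y x0] by (simp add: inner_diff_left inner_diff_right insert_commute abs_minus_commute algebra_simps)
    qed
  qed
  have "\<bar>(y - x) \<bullet> Aw w (shadow e *\<^sub>R e' - shadow e' *\<^sub>R e)\<bar> \<le> \<epsilon>" if "y \<in> \<Lambda>" for y
  proof -
    let ?f = "shadow e *\<^sub>R e' - shadow e' *\<^sub>R e"
    have "rw w * \<bar>(y - x) \<bullet> Aw w ?f\<bar> = \<bar>(Sw w y - x0) \<bullet> ?f\<bar>"
      using inner_Sw[OF w(1), of y x ?f] rwp by (simp add: x(2) abs_mult)
    also have "\<dots> \<le> 2 * R * \<theta> * F" using that by (intro key) (auto simp: cyl_def)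
    also have "\<dots> = rw w * \<epsilon>" using D E F by (simp add: R_def \<theta>_def)
    finally show ?thesis using rwp by simp
  qed
  then show ?thesis using w(1) x(1) by blast
qed

text \<open>The flatness error tends to 0 while the covectors keep their norm, so a limit of a
  subsequence annihilates all differences. The norm is recorded to make \<open>g\<close> nonzero
  when \<open>e'\<close> is not a multiple of \<open>e\<close>.\<close>

lemma bilipschitz_projection_hyperplane:
  assumes pos: "0 < shadow e" and "0 < \<eta>"
    and bilip: "\<And>x y. x \<in> \<Lambda> \<Longrightarrow> y \<in> \<Lambda> \<Longrightarrow> \<eta> * norm (y - x) \<le> \<bar>(y - x) \<bullet> e\<bar>"
    and e': "norm (e' - e) \<le> \<eta> / 2"
  shows "\<exists>g. norm g = norm (shadow e *\<^sub>R e' - shadow e' *\<^sub>R e) \<and> (\<forall>x\<in>\<Lambda>. \<forall>y\<in>\<Lambda>. (y - x) \<bullet> g = 0)"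
proof -
  let ?f = "shadow e *\<^sub>R e' - shadow e' *\<^sub>R e"
  have "\<exists>w. w \<in> lists I \<and> (\<exists>x\<in>\<Lambda>. \<forall>y\<in>\<Lambda>. \<bar>(y - x) \<bullet> Aw w ?f\<bar> \<le> inverse (Suc n))" for n
  proof -
    have "0 < inverse (real (Suc n))" by simp
    from bilipschitz_projection_flat[OF pos \<open>0 < \<eta>\<close> bilip e' this] show ?thesis by blast
  qed
  then have "\<forall>n. \<exists>w. w \<in> lists I \<and> (\<exists>x\<in>\<Lambda>. \<forall>y\<in>\<Lambda>. \<bar>(y - x) \<bullet> Aw w ?f\<bar> \<le> inverse (Suc n))" ..
  from choice[OF this] obtain w where w: "\<And>n. w n \<in> lists I"
    and flat: "\<And>n. \<exists>x\<in>\<Lambda>. \<forall>y\<in>\<Lambda>. \<bar>(y - x) \<bullet> Aw (w n) ?f\<bar> \<le> inverse (Suc n)"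
    by blast
  have flat2: "\<bar>(y - x) \<bullet> Aw (w n) ?f\<bar> \<le> 2 * inverse (Suc n)" if "x \<in> \<Lambda>" "y \<in> \<Lambda>" for n x y
  proof -
    obtain z where z: "\<And>y. y \<in> \<Lambda> \<Longrightarrow> \<bar>(y - z) \<bullet> Aw (w n) ?f\<bar> \<le> inverse (Suc n)" using flat by blast
    have "(y - x) \<bullet> Aw (w n) ?f = (y - z) \<bullet> Aw (w n) ?f - (x - z) \<bullet> Aw (w n) ?f"
      by (simp add: inner_diff_left)
    then show ?thesis using z[OF that(1)] z[OF that(2)] by linarith
  qed
  have "\<forall>n. Aw (w n) ?f \<in> sphere 0 (norm ?f)" using w by (simp add: norm_Aw)
  then obtain g l where g: "g \<in> sphere 0 (norm ?f)" "strict_mono l" "((\<lambda>n. Aw (w n) ?f) \<circ> l) \<longlonglongrightarrow> g"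
    by (meson seq_compactE compact_imp_seq_compact compact_sphere)
  have "(y - x) \<bullet> g = 0" if "x \<in> \<Lambda>" "y \<in> \<Lambda>" for x y
  proof -
    have lim: "(\<lambda>n. (y - x) \<bullet> Aw (w (l n)) ?f) \<longlonglongrightarrow> (y - x) \<bullet> g"
      using tendsto_inner[OF tendsto_const g(3)] by (simp add: o_def)
    have "(\<lambda>n. 2 * inverse (real (Suc (l n)))) \<longlonglongrightarrow> 0"
      using filterlim_compose[OF LIMSEQ_inverse_real_of_nat filterlim_subseq[OF g(2)]]
      by (rule tendsto_mult_right_zero)
    then have "(\<lambda>n. (y - x) \<bullet> Aw (w (l n)) ?f) \<longlonglongrightarrow> 0"
      by (rule Lim_null_comparison[OF always_eventually, rotated]) (use flat2[OF that] in simp)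
    then show ?thesis using lim LIMSEQ_unique by blast
  qed
  then show ?thesis using g(1) by (intro exI[of _ g]) auto
qed

end

section \<open>Almost every projection is null\<close>

locale planar_similitude_system = subunit_similitude_system I r T b \<Lambda>
  for I :: "'i set" and r and T :: "'i \<Rightarrow> real^2 \<Rightarrow> real^2" and b and \<Lambda> +
  assumes not_collinear: "\<not> collinear \<Lambda>"
begin

text \<open>Leaving the vector unnormalised makes inner products with it affine in \<beta>.\<close>

definition dir :: "real \<Rightarrow> real^2" where
  "dir \<beta> = vector [1, 0] + \<beta> *\<^sub>R vector [0, 1]"

lemma inner_dir: "x \<bullet> dir \<beta> = x $ 1 + \<beta> * x $ 2"
  by (simp add: dir_def inner_vec_def sum_2 algebra_simps)

lemma not_in_hyperplane:
  assumes "g \<noteq> 0"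
  shows "\<not> (\<forall>x\<in>\<Lambda>. \<forall>y\<in>\<Lambda>. (y - x) \<bullet> g = 0)"
proof
  assume orth: "\<forall>x\<in>\<Lambda>. \<forall>y\<in>\<Lambda>. (y - x) \<bullet> g = 0"
  \<comment> \<open>\<open>g\<close> turned by a right angle: it spans the directions orthogonal to
    \<open>g\<close>.\<close>
  let ?u = "vector [- g $ 2, g $ 1] :: real^2"
  define n where "n = (g $ 1)\<^sup>2 + (g $ 2)\<^sup>2"
  have "n \<noteq> 0" using assms by (auto simp: n_def vec_eq_iff forall_2 sum_power2_eq_zero_iff)
  have "\<exists>c. x - y = c *\<^sub>R ?u" if "x \<in> \<Lambda>" "y \<in> \<Lambda>" for x y
  proof -
    let ?v = "x - y"
    have 0: "?v $ 1 * g $ 1 + ?v $ 2 * g $ 2 = 0"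
      using orth that by (simp add: inner_vec_def sum_2)
    have "?v $ 1 * n = (- ?v $ 1 * g $ 2 + ?v $ 2 * g $ 1) * (- g $ 2)"
      "?v $ 2 * n = (- ?v $ 1 * g $ 2 + ?v $ 2 * g $ 1) * g $ 1"
      using 0 unfolding n_def by algebra+
    then have "?v = ((- ?v $ 1 * g $ 2 + ?v $ 2 * g $ 1) / n) *\<^sub>R ?u"
      using \<open>n \<noteq> 0\<close> by (simp add: vec_eq_iff forall_2 field_simps)
    then show ?thesis by blast
  qed
  then have "collinear \<Lambda>" unfolding collinear_def by blast
  then show False using not_collinear by simp
qed

lemma positive_shadow_imp_non_density:
  assumes pos: "0 < shadow (dir \<beta>0)"
  shows "\<exists>\<epsilon>>0. \<forall>t>0. \<exists>\<tau>>0. \<tau> < t \<and>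
    measure lebesgue ({\<beta>. shadow (dir \<beta>0) - \<epsilon> \<le> shadow (dir \<beta>)} \<inter> cball \<beta>0 \<tau>)
      \<le> (1 - \<epsilon>) * measure lebesgue (cball \<beta>0 \<tau>)"
proof -
  \<comment> \<open>A vector \<open>z\<close> nearly orthogonal to \<open>dir \<beta>0\<close> has
    norm at most \<open>2 * (1 + \<bar>\<beta>0\<bar>)\<close> times the modulus of its second
    coordinate, so its projection moves at a definite rate when \<beta> varies.\<close>
  define \<kappa> where "\<kappa> = 1 / (2 * (2 + \<bar>\<beta>0\<bar>))"
  have \<kappa>: "0 < \<kappa>" "2 * (2 + \<bar>\<beta>0\<bar>) * \<kappa> = 1" by (auto simp: \<kappa>_def)
  have "\<kappa> * 2 \<le> \<kappa> * (2 * (2 + \<bar>\<beta>0\<bar>))" using \<kappa>(1) by (intro mult_left_mono) auto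
  then have "\<kappa> \<le> 1 / 2" using \<kappa>(2) by (simp add: mult.commute)
  have far: "\<exists>x\<in>\<Lambda>. \<exists>y\<in>\<Lambda>. x \<noteq> y \<and> \<bar>(y - x) \<bullet> (vector [1, 0] + \<beta>0 *\<^sub>R vector [0, 1])\<bar> \<le> \<eta> * norm (y - x) \<and>
      \<kappa> * norm (y - x) \<le> \<bar>(y - x) \<bullet> vector [0, 1]\<bar>" if "0 < \<eta>" for \<eta>
  proof -
    define \<eta>' where "\<eta>' = min \<eta> \<kappa>"
    have \<eta>': "0 < \<eta>'" "\<eta>' \<le> \<eta>" "\<eta>' \<le> \<kappa>" using that \<kappa> by (auto simp: \<eta>'_def)
    have "\<exists>x\<in>\<Lambda>. \<exists>y\<in>\<Lambda>. \<bar>(y - x) \<bullet> dir \<beta>0\<bar> < \<eta>' * norm (y - x)"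
    proof (rule ccontr)
      assume "\<not> ?thesis"
      then have bilip: "\<And>x y. x \<in> \<Lambda> \<Longrightarrow> y \<in> \<Lambda> \<Longrightarrow> \<eta>' * norm (y - x) \<le> \<bar>(y - x) \<bullet> dir \<beta>0\<bar>"
        by (meson not_le)
      let ?v = "vector [0, 1] :: real^2"
      have nv: "norm ?v = 1" by (simp add: norm_vec_def L2_set_def sum_2)
      \<comment> \<open>A tilt that keeps the first coordinate: proportionality to
        \<open>dir \<beta>0\<close> would force equal shadows and then a zero tilt.\<close>
      define e' where "e' = dir \<beta>0 + (\<eta>' / 2) *\<^sub>R ?v"
      have "norm (e' - dir \<beta>0) \<le> \<eta>' / 2" using \<eta>' by (simp add: e'_def nv)
      from bilipschitz_projection_hyperplane[OF pos \<eta>'(1) bilip this]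
      obtain g where g: "norm g = norm (shadow (dir \<beta>0) *\<^sub>R e' - shadow e' *\<^sub>R dir \<beta>0)"
          "\<forall>x\<in>\<Lambda>. \<forall>y\<in>\<Lambda>. (y - x) \<bullet> g = 0"
        by blast
      have "shadow (dir \<beta>0) *\<^sub>R e' - shadow e' *\<^sub>R dir \<beta>0 \<noteq> 0"
      proof
        let ?a = "shadow (dir \<beta>0)" and ?b = "shadow e'"
        assume "?a *\<^sub>R e' - ?b *\<^sub>R dir \<beta>0 = 0"
        then have 0: "(?a *\<^sub>R e' - ?b *\<^sub>R dir \<beta>0) $ 1 = 0" "(?a *\<^sub>R e' - ?b *\<^sub>R dir \<beta>0) $ 2 = 0" by simp_all
        have "?a = ?b" using 0(1) by (simp add: e'_def dir_def)
        then show False using 0(2) pos \<eta>' by (simp add: e'_def dir_def algebra_simps)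
      qed
      then have "g \<noteq> 0" using g(1) by auto
      then show False using not_in_hyperplane g(2) by blast
    qed
    then obtain x y where xy: "x \<in> \<Lambda>" "y \<in> \<Lambda>" "\<bar>(y - x) \<bullet> dir \<beta>0\<bar> < \<eta>' * norm (y - x)" by blast
    let ?z = "y - x"
    have ne: "x \<noteq> y" using xy(3) by auto
    have le: "\<bar>?z $ 1 + \<beta>0 * ?z $ 2\<bar> \<le> \<eta>' * norm ?z" using xy(3) by (simp add: inner_dir)
    have "\<eta>' * norm ?z \<le> \<kappa> * norm ?z" "\<eta>' * norm ?z \<le> \<eta> * norm ?z" using \<eta>' by (auto intro!: mult_right_mono)
    moreover have "\<kappa> * norm ?z \<le> \<bar>?z $ 2\<bar>"
    proof -
      have "norm ?z \<le> \<bar>?z $ 1\<bar> + \<bar>?z $ 2\<bar>"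
        using norm_le_l1_cart[of ?z] by (simp add: sum_2)
      also have "\<bar>?z $ 1\<bar> \<le> \<bar>?z $ 1 + \<beta>0 * ?z $ 2\<bar> + \<bar>\<beta>0\<bar> * \<bar>?z $ 2\<bar>"
        using abs_triangle_ineq4[of "?z $ 1 + \<beta>0 * ?z $ 2" "\<beta>0 * ?z $ 2"] by (simp add: abs_mult)
      also have "\<bar>?z $ 1 + \<beta>0 * ?z $ 2\<bar> \<le> 1 / 2 * norm ?z"
        by (rule order_trans[OF le order_trans[OF \<open>\<eta>' * norm ?z \<le> \<kappa> * norm ?z\<close> mult_right_mono[OF \<open>\<kappa> \<le> 1 / 2\<close> norm_ge_zero]]])
      finally have "norm ?z \<le> 2 * (1 + \<bar>\<beta>0\<bar>) * \<bar>?z $ 2\<bar>" by (simp add: algebra_simps)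
      also have "\<dots> \<le> 2 * (2 + \<bar>\<beta>0\<bar>) * \<bar>?z $ 2\<bar>" by (intro mult_right_mono) auto
      finally have "\<kappa> * norm ?z \<le> \<kappa> * (2 * (2 + \<bar>\<beta>0\<bar>) * \<bar>?z $ 2\<bar>)" using \<kappa>(1) by (intro mult_left_mono) auto
      also have "\<dots> = (2 * (2 + \<bar>\<beta>0\<bar>) * \<kappa>) * \<bar>?z $ 2\<bar>" by (simp only: mult_ac)
      finally show ?thesis using \<kappa>(2) by simp
    qed
    moreover have "?z \<bullet> vector [0, 1] = ?z $ 2" by (simp add: inner_vec_def sum_2)
    ultimately have "x \<noteq> y \<and> \<bar>?z \<bullet> (vector [1, 0] + \<beta>0 *\<^sub>R vector [0, 1])\<bar> \<le> \<eta> * norm ?z \<and>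
        \<kappa> * norm ?z \<le> \<bar>?z \<bullet> vector [0, 1]\<bar>"
      using ne xy(3) unfolding dir_def by linarith
    then show ?thesis using xy(1,2) by blast
  qed
  show ?thesis
    using far_pairs_imp_non_density[of "vector [1, 0]" \<beta>0 "vector [0, 1]" \<kappa>, OF _ \<kappa>(1) far] pos
    unfolding dir_def by blast
qed

text \<open>The sparse level set varies with \<beta>. A rational level \<open>q\<close> strictly
  between \<open>shadow (dir \<beta>) - \<epsilon>\<close> and \<open>shadow (dir \<beta>)\<close>,
  and \<open>inverse (Suc n)\<close> below \<epsilon>, leave countably many exceptional null
  sets.\<close>

theorem negligible_positive_shadow: "negligible {\<beta>. 0 < shadow (dir \<beta>)}"
proof -
  define B where "B q = {\<beta>. of_rat q \<le> shadow (dir \<beta>)}" for q :: rat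
  have Bm: "B q \<in> sets lebesgue" for q
    using borel_closed[OF closed_shadow_line_ge] by (simp add: B_def dir_def)
  let ?N = "\<lambda>(q, n). {\<beta> \<in> B q. \<not> dense_at (inverse (real (Suc n))) (B q) \<beta>}"
  have "negligible (\<Union>(range ?N))"
    using Bm by (intro negligible_countable_Union) (auto intro!: negligible_not_dense_at)
  moreover have "{\<beta>. 0 < shadow (dir \<beta>)} \<subseteq> \<Union>(range ?N)"
  proof
    fix \<beta> assume "\<beta> \<in> {\<beta>. 0 < shadow (dir \<beta>)}"
    then obtain \<epsilon> where \<epsilon>: "0 < \<epsilon>" and sparse: "\<And>t. 0 < t \<Longrightarrow> \<exists>\<tau>>0. \<tau> < t \<and>
      measure lebesgue ({\<beta>'. shadow (dir \<beta>) - \<epsilon> \<le> shadow (dir \<beta>')} \<inter> cball \<beta> \<tau>)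
      \<le> (1 - \<epsilon>) * measure lebesgue (cball \<beta> \<tau>)"
      using positive_shadow_imp_non_density by blast
    obtain q where q: "shadow (dir \<beta>) - \<epsilon> < of_rat q" "of_rat q < shadow (dir \<beta>)"
      using of_rat_dense[of "shadow (dir \<beta>) - \<epsilon>" "shadow (dir \<beta>)"] \<epsilon> by auto
    obtain n where n: "inverse (real (Suc n)) < \<epsilon>" using reals_Archimedean[OF \<epsilon>] by blast
    have "\<not> dense_at (inverse (real (Suc n))) (B q) \<beta>"
    proof
      assume "dense_at (inverse (real (Suc n))) (B q) \<beta>"
      then obtain t where t: "0 < t" "\<And>R. 0 < R \<Longrightarrow> R < t \<Longrightarrow>
          (1 - inverse (real (Suc n))) * measure lebesgue (cball \<beta> R) < measure lebesgue (B q \<inter> cball \<beta> R)"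
        unfolding dense_at_def by blast
      obtain \<tau> where \<tau>: "0 < \<tau>" "\<tau> < t"
        "measure lebesgue ({\<beta>'. shadow (dir \<beta>) - \<epsilon> \<le> shadow (dir \<beta>')} \<inter> cball \<beta> \<tau>)
          \<le> (1 - \<epsilon>) * measure lebesgue (cball \<beta> \<tau>)"
        using sparse[OF t(1)] by blast
      have lm: "B q \<inter> cball \<beta> \<tau> \<in> sets lebesgue" using Bm by (intro sets.Int) auto
      have cl: "{\<beta>'. shadow (dir \<beta>) - \<epsilon> \<le> shadow (dir \<beta>')} \<in> sets lebesgue"
        using borel_closed[OF closed_shadow_line_ge] by (simp add: dir_def)
      have "measure lebesgue (B q \<inter> cball \<beta> \<tau>) \<le>
          measure lebesgue ({\<beta>'. shadow (dir \<beta>) - \<epsilon> \<le> shadow (dir \<beta>')} \<inter> cball \<beta> \<tau>)"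
      proof (rule measure_mono_fmeasurable[OF _ lm])
        show "B q \<inter> cball \<beta> \<tau> \<subseteq> {\<beta>'. shadow (dir \<beta>) - \<epsilon> \<le> shadow (dir \<beta>')} \<inter> cball \<beta> \<tau>"
          using q by (auto simp: B_def)
        show "{\<beta>'. shadow (dir \<beta>) - \<epsilon> \<le> shadow (dir \<beta>')} \<inter> cball \<beta> \<tau> \<in> lmeasurable"
          using fmeasurable_Int_fmeasurable[OF lmeasurable_cball cl] by (simp add: Int_commute)
      qed
      moreover have "(1 - \<epsilon>) * measure lebesgue (cball \<beta> \<tau>) \<le> (1 - inverse (real (Suc n))) * measure lebesgue (cball \<beta> \<tau>)"
        using n by (intro mult_right_mono) auto
      ultimately show False using t(2)[OF \<tau>(1,2)] \<tau>(3) by linarith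
    qed
    moreover have "\<beta> \<in> B q" using q by (simp add: B_def)
    ultimately show "\<beta> \<in> \<Union>(range ?N)" by (auto intro!: exI[of _ q] exI[of _ n])
  qed
  ultimately show ?thesis by (rule negligible_subset)
qed

end

section \<open>Radial projection\<close>

text \<open>The parameter \<beta> for which \<open>(1, \<beta>)\<close> is orthogonal to
  \<open>x - a\<close>; meaningful only when \<open>x\<close> and \<open>a\<close> differ in
  height.\<close>

definition slope :: "real^2 \<Rightarrow> real^2 \<Rightarrow> real" where
  "slope a x = - ((x - a) $ 1 / (x - a) $ 2)"

context planar_similitude_system
begin

text \<open>Bounds the denominator in \<open>slope\<close> away from 0, which makes
  \<open>slope\<close> continuous on a compact set.\<close>

definition away :: "real^2 \<Rightarrow> real \<Rightarrow> (real^2) set" where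
  "away a \<rho> = {x \<in> \<Lambda>. \<rho> \<le> \<bar>(x - a) $ 2\<bar>}"

text \<open>A stand-in for the natural measure of the part of \<open>away a \<rho>\<close> seen with
  slope in \<open>J\<close>; a cylinder counts in full as soon as it meets this part.\<close>

definition mass :: "real^2 \<Rightarrow> real \<Rightarrow> nat \<Rightarrow> real set \<Rightarrow> real" where
  "mass a \<rho> n J = (\<Sum>w | w \<in> words n \<and> cyl w \<inter> away a \<rho> \<inter> slope a -` J \<noteq> {}. rw w)"

lemma norm_dir_diff: "norm (dir \<beta> - dir \<beta>') = \<bar>\<beta> - \<beta>'\<bar>"
proof -
  have "dir \<beta> - dir \<beta>' = (\<beta> - \<beta>') *\<^sub>R vector [0, 1]" by (simp add: dir_def algebra_simps)
  then show ?thesis by (simp add: norm_vec_def L2_set_def sum_2)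
qed

text \<open>\<open>dir (slope a x)\<close> is orthogonal to \<open>x - a\<close>, so
  \<open>z - a\<close> and \<open>z - x\<close> have the same inner product with it. The identity is
  exact.\<close>

lemma slope_diff:
  assumes "(x - a) $ 2 \<noteq> 0" "(z - a) $ 2 \<noteq> 0"
  shows "slope a z = slope a x - (z - x) \<bullet> dir (slope a x) / (z - a) $ 2"
proof -
  let ?\<beta> = "slope a x"
  have "?\<beta> * (x - a) $ 2 = - (x - a) $ 1" using assms(1) by (simp add: slope_def)
  then have eq: "?\<beta> * (z - a) $ 2 - (z - x) \<bullet> dir ?\<beta> = - (z - a) $ 1"
    unfolding inner_dir by (simp add: algebra_simps)
  have "slope a z = (- (z - a) $ 1) / (z - a) $ 2"
    unfolding slope_def by (rule minus_divide_left)
  then have "slope a z = (?\<beta> * (z - a) $ 2 - (z - x) \<bullet> dir ?\<beta>) / (z - a) $ 2"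
    by (simp only: eq)
  then show ?thesis using assms(2) by (simp add: diff_divide_distrib)
qed

text \<open>Seen from \<open>a\<close>, a small cylinder looks like an affine image of its orthogonal projection in the
  direction of view.\<close>

lemma slope_cyl_small:
  assumes w: "w \<in> lists I" and x: "x \<in> cyl w" "\<rho> \<le> \<bar>(x - a) $ 2\<bar>" and "0 < \<rho>"
    and D: "1 \<le> D" "\<And>x y. x \<in> \<Lambda> \<Longrightarrow> y \<in> \<Lambda> \<Longrightarrow> norm (x - y) \<le> D"
    and small: "rw w * D \<le> \<rho> / 2" "D * norm (dir (slope a x)) * (rw w * D * 2 / \<rho>) < \<delta>"
    and thick: "measure lebesgue (thicken \<delta> (proj (Aw w (dir (slope a x))) \<Lambda>)) \<le> \<epsilon>"
  shows "\<exists>M\<in>lmeasurable. slope a ` cyl w \<subseteq> M \<and> measure lebesgue M \<le> rw w * (\<epsilon> / \<rho>)"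
proof -
  define \<beta> where "\<beta> = slope a x"
  define X where "X = (x - a) $ 2"
  have X: "\<rho> \<le> \<bar>X\<bar>" "X \<noteq> 0" using x \<open>0 < \<rho>\<close> by (auto simp: X_def)
  have rwp: "0 < rw w" using w rw_pos by blast
  obtain x' where x': "x' \<in> \<Lambda>" "x = Sw w x'" using x by (auto simp: cyl_def)
  let ?N = "thicken \<delta> (profile w x' (dir \<beta>))"
  let ?M = "(\<lambda>t. - (rw w / X) * t + \<beta>) ` ?N"
  have N: "?N \<in> lmeasurable" by (intro lmeasurable_thicken compact_imp_bounded compact_profile)
  have "slope a ` cyl w \<subseteq> ?M"
  proof clarify
    fix z assume "z \<in> cyl w"
    then obtain z' where z': "z' \<in> \<Lambda>" "z = Sw w z'" by (auto simp: cyl_def)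
    define \<alpha> where "\<alpha> = (z' - x') \<bullet> Aw w (dir \<beta>)"
    define Y where "Y = (z - a) $ 2"
    have \<alpha>: "\<alpha> \<in> profile w x' (dir \<beta>)" using z' by (auto simp: profile_def \<alpha>_def)
    have "\<bar>Y - X\<bar> = \<bar>(z - x) $ 2\<bar>" by (simp add: X_def Y_def)
    also have "\<dots> \<le> norm (z - x)" by (rule component_le_norm_cart)
    also have "\<dots> = rw w * norm (z' - x')" using dist_Sw[OF w, of z' x'] by (simp add: z' x' dist_norm)
    also have "\<dots> \<le> rw w * D" using D z' x' rwp by (intro mult_left_mono) auto
    finally have YX: "\<bar>Y - X\<bar> \<le> rw w * D" .
    then have Y: "\<rho> / 2 \<le> \<bar>Y\<bar>" "Y \<noteq> 0" using small(1) X \<open>0 < \<rho>\<close> by linarith+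
    \<comment> \<open>The denominator \<open>Y\<close> varies with \<open>z\<close>. Moving it into
      \<open>t\<close> makes the slope an affine function of \<open>t\<close> with fixed
      coefficients, and \<open>t\<close> differs from the profile point \<alpha> by less than
      \<delta>.\<close>
    define t where "t = \<alpha> * X / Y"
    have "t - \<alpha> = \<alpha> * (X - Y) / Y" using Y by (simp add: t_def field_simps)
    then have "\<bar>t - \<alpha>\<bar> = \<bar>\<alpha>\<bar> * (\<bar>Y - X\<bar> / \<bar>Y\<bar>)" by (simp add: abs_mult abs_minus_commute)
    also have "\<dots> \<le> (D * norm (dir \<beta>)) * (rw w * D / (\<rho> / 2))"
      using profile_bound[OF w x'(1) D(2) \<alpha>] YX Y \<open>0 < \<rho>\<close> D(1) by (intro mult_mono frac_le) auto
    also have "\<dots> < \<delta>" using small(2) by (simp add: \<beta>_def)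
    finally have "t \<in> ?N" using \<alpha> thicken_memI by blast
    have "(z - x) \<bullet> dir \<beta> = rw w * \<alpha>" using inner_Sw[OF w, of z' x'] by (simp add: z' x' \<alpha>_def)
    then have "slope a z = \<beta> - rw w * \<alpha> / Y"
      using slope_diff[of x a z] X Y unfolding X_def Y_def \<beta>_def by simp
    also have "\<dots> = - (rw w / X) * t + \<beta>" using X Y by (simp add: t_def)
    finally show "slope a z \<in> ?M" using \<open>t \<in> ?N\<close> by blast
  qed
  moreover have "?M \<in> lmeasurable" using N by (rule lmeasurable_affine_real)
  moreover have "measure lebesgue ?M \<le> rw w * (\<epsilon> / \<rho>)"
  proof -
    have "measure lebesgue ?M = (rw w / \<bar>X\<bar>) * measure lebesgue ?N"
      using rwp by (subst measure_affine_real) (simp add: abs_divide)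
    also have "\<dots> \<le> (rw w / \<rho>) * \<epsilon>"
      using thick X rwp \<open>0 < \<rho>\<close> unfolding measure_thicken_profile \<beta>_def[symmetric]
      by (intro mult_mono divide_left_mono) auto
    finally show ?thesis by simp
  qed
  ultimately show ?thesis by blast
qed

lemma compact_away: "compact (away a \<rho>)"
proof -
  have "closed {x :: real^2. \<rho> \<le> \<bar>(x - a) $ 2\<bar>}"
    by (intro closed_Collect_le continuous_intros)
  then have "compact (\<Lambda> \<inter> {x. \<rho> \<le> \<bar>(x - a) $ 2\<bar>})" using compact by (rule compact_Int_closed[rotated])
  then show ?thesis by (simp add: away_def Int_def)
qed

lemma continuous_slope: "0 < \<rho> \<Longrightarrow> continuous_on (away a \<rho>) (slope a)"
  unfolding slope_def by (intro continuous_intros) (auto simp: away_def)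

text \<open>A vanishing shadow at \<beta>0 gives short neighbourhoods of the projections, with one
  \<delta> for all words and all nearby slopes. Every small cylinder seen in the ball then
  contributes at most \<epsilon> times its ratio.\<close>

lemma measure_slope_le_mass:
  assumes zero: "shadow (dir \<beta>0) = 0" and "0 < \<rho>" "0 < \<epsilon>"
  shows "\<exists>r0>0. \<forall>R<r0. \<forall>\<^sub>F n in sequentially.
    measure lebesgue (slope a ` away a \<rho> \<inter> cball \<beta>0 R) \<le> \<epsilon> * mass a \<rho> n (cball \<beta>0 R)"
proof -
  let ?m = "measure lebesgue"
  obtain D where D: "1 \<le> D" "\<And>x y. x \<in> \<Lambda> \<Longrightarrow> y \<in> \<Lambda> \<Longrightarrow> norm (x - y) \<le> D"
    by (rule dist_bound) blast
  have "0 < \<epsilon> * \<rho>" using assms by simp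
  from shadow_usc_orbit[OF this, of "dir \<beta>0"]
  obtain \<delta> where \<delta>: "0 < \<delta>" "\<And>w e'. w \<in> lists I \<Longrightarrow> norm (e' - Aw w (dir \<beta>0)) < \<delta> \<Longrightarrow>
      ?m (thicken \<delta> (proj e' \<Lambda>)) < \<epsilon> * \<rho>"
    using zero by auto
  define L where "L = norm (dir \<beta>0) + 1"
  have "0 < L" by (simp add: L_def add_nonneg_pos)
  \<comment> \<open>The two bounds serve the two smallness hypotheses of
    \<open>slope_cyl_small\<close>; the second has a factor 2 to spare because strict inequality is
    required.\<close>
  define s where "s = min (\<rho> / (2 * D)) (\<delta> * \<rho> / (4 * D * D * L))"
  have "0 < s" using assms \<delta> D \<open>0 < L\<close> by (simp add: s_def)
  have "\<forall>\<^sub>F n in sequentially.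
    ?m (slope a ` away a \<rho> \<inter> cball \<beta>0 R) \<le> \<epsilon> * mass a \<rho> n (cball \<beta>0 R)" if R: "R < min 1 \<delta>" for R
    using eventually_rw_less[OF \<open>0 < s\<close>]
  proof eventually_elim
    case (elim n)
    let ?W = "{w \<in> words n. cyl w \<inter> away a \<rho> \<inter> slope a -` cball \<beta>0 R \<noteq> {}}"
    have "\<exists>M\<in>lmeasurable. slope a ` cyl w \<subseteq> M \<and> ?m M \<le> rw w * \<epsilon>" if hit: "w \<in> ?W" for w
    proof -
      have w: "w \<in> lists I" "rw w < s" using hit elim words_lists by auto
      obtain x where "x \<in> cyl w" "x \<in> away a \<rho>" "slope a x \<in> cball \<beta>0 R"
        using hit by blast
      then have x: "x \<in> cyl w" "\<rho> \<le> \<bar>(x - a) $ 2\<bar>" "\<bar>slope a x - \<beta>0\<bar> \<le> R"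
        by (auto simp: away_def dist_real_def abs_minus_commute)
      have rwp: "0 < rw w" using w rw_pos by blast
      have "norm (dir (slope a x)) \<le> norm (dir \<beta>0) + norm (dir (slope a x) - dir \<beta>0)" by (rule norm_triangle_sub)
      then have nL: "norm (dir (slope a x)) \<le> L" using x R by (simp add: L_def norm_dir_diff)
      have "rw w \<le> \<rho> / (2 * D)" "rw w \<le> \<delta> * \<rho> / (4 * D * D * L)" using w by (auto simp: s_def)
      then have 1: "rw w * D \<le> \<rho> / 2" and 2: "rw w * (4 * D * D * L) \<le> \<delta> * \<rho>"
        using D \<open>0 < L\<close> by (auto simp: field_simps)
      have "D * norm (dir (slope a x)) * (rw w * D * 2 / \<rho>) \<le> D * L * (rw w * D * 2 / \<rho>)"
        using nL D rwp \<open>0 < \<rho>\<close> by (intro mult_right_mono mult_left_mono) auto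
      also have "\<dots> = rw w * (4 * D * D * L) / (2 * \<rho>)" using \<open>0 < \<rho>\<close> by (simp add: field_simps)
      also have "\<dots> \<le> \<delta> * \<rho> / (2 * \<rho>)" using 2 \<open>0 < \<rho>\<close> by (intro divide_right_mono) auto
      also have "\<dots> < \<delta>" using \<open>0 < \<rho>\<close> \<delta>(1) by simp
      finally have 3: "D * norm (dir (slope a x)) * (rw w * D * 2 / \<rho>) < \<delta>" .
      have "norm (Aw w (dir (slope a x)) - Aw w (dir \<beta>0)) < \<delta>"
        using x R w by (simp add: Aw_diff[symmetric] norm_Aw norm_dir_diff)
      then have "?m (thicken \<delta> (proj (Aw w (dir (slope a x))) \<Lambda>)) \<le> \<epsilon> * \<rho>"
        using \<delta>(2)[OF w(1)] by (simp add: less_imp_le)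
      from slope_cyl_small[OF w(1) x(1,2) \<open>0 < \<rho>\<close> D 1 3 this] show ?thesis using \<open>0 < \<rho>\<close> by simp
    qed
    then have "\<forall>w\<in>?W. \<exists>M. M \<in> lmeasurable \<and> slope a ` cyl w \<subseteq> M \<and> ?m M \<le> rw w * \<epsilon>" by blast
    from bchoice[OF this] obtain M where M: "\<And>w. w \<in> ?W \<Longrightarrow> M w \<in> lmeasurable" "\<And>w. w \<in> ?W \<Longrightarrow> slope a ` cyl w \<subseteq> M w"
        "\<And>w. w \<in> ?W \<Longrightarrow> ?m (M w) \<le> rw w * \<epsilon>"
      by blast
    have fin: "finite ?W" using finite_words[of n] by simp
    have "slope a ` away a \<rho> \<inter> cball \<beta>0 R \<subseteq> (\<Union>w\<in>?W. M w)"
    proof clarify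
      fix x assume x: "x \<in> away a \<rho>" "slope a x \<in> cball \<beta>0 R"
      then obtain w where w: "w \<in> words n" "x \<in> cyl w" using Un_cyl[of n] by (auto simp: away_def)
      then have "w \<in> ?W" using x by auto
      then show "slope a x \<in> (\<Union>w\<in>?W. M w)" using M(2) w by blast
    qed
    moreover have "slope a ` away a \<rho> \<inter> cball \<beta>0 R \<in> lmeasurable"
      using continuous_slope[OF \<open>0 < \<rho>\<close>] compact_away
      by (intro lmeasurable_compact compact_Int compact_continuous_image) auto
    ultimately have "?m (slope a ` away a \<rho> \<inter> cball \<beta>0 R) \<le> ?m (\<Union>w\<in>?W. M w)"
      using M(1) fin by (intro measure_mono_fmeasurable fmeasurable.finite_UN) (auto simp: fmeasurableD)
    also have "\<dots> \<le> (\<Sum>w\<in>?W. ?m (M w))"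
      using M(1) fin by (intro measure_UNION_le) (auto simp: fmeasurableD)
    also have "\<dots> \<le> (\<Sum>w\<in>?W. rw w * \<epsilon>)" using M(3) by (rule sum_mono)
    also have "\<dots> = \<epsilon> * mass a \<rho> n (cball \<beta>0 R)" by (simp add: mass_def sum_distrib_left mult.commute)
    finally show ?case .
  qed
  then show ?thesis using \<delta>(1) by (intro exI[of _ "min 1 \<delta>"]) auto
qed

text \<open>Disjoint compact sets have positive distance and \<open>slope\<close> is uniformly
  continuous on \<open>away a \<rho>\<close>, so a small cylinder cannot be seen in both. This makes
  masses additive over disjoint balls.\<close>

lemma eventually_hit_one:
  assumes "0 < \<rho>" and J: "compact J" "compact J'" "J \<inter> J' = {}"
  shows "\<forall>\<^sub>F n in sequentially. \<forall>w\<in>words n.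
    cyl w \<inter> away a \<rho> \<inter> slope a -` J = {} \<or> cyl w \<inter> away a \<rho> \<inter> slope a -` J' = {}"
proof -
  obtain D where D: "1 \<le> D" "\<And>x y. x \<in> \<Lambda> \<Longrightarrow> y \<in> \<Lambda> \<Longrightarrow> norm (x - y) \<le> D"
    by (rule dist_bound) blast
  obtain d where d: "0 < d" "\<And>s t. s \<in> J \<Longrightarrow> t \<in> J' \<Longrightarrow> d \<le> dist s t"
    using separate_compact_closed[OF J(1) compact_imp_closed[OF J(2)] J(3)] by blast
  have "uniformly_continuous_on (away a \<rho>) (slope a)"
    by (intro compact_uniformly_continuous continuous_slope compact_away assms)
  then obtain \<delta> where \<delta>: "0 < \<delta>" "\<And>x y. x \<in> away a \<rho> \<Longrightarrow> y \<in> away a \<rho> \<Longrightarrow> dist y x < \<delta> \<Longrightarrow> dist (slope a y) (slope a x) < d"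
    using d(1) unfolding uniformly_continuous_on_def by meson
  have "0 < \<delta> / D" using \<delta> D by simp
  from eventually_rw_less[OF this] show ?thesis
  proof eventually_elim
    case (elim n)
    show ?case
    proof (rule ballI, rule ccontr)
      fix w assume w: "w \<in> words n"
        and "\<not> (cyl w \<inter> away a \<rho> \<inter> slope a -` J = {} \<or> cyl w \<inter> away a \<rho> \<inter> slope a -` J' = {})"
      then obtain x y where xy: "x \<in> cyl w" "x \<in> away a \<rho>" "slope a x \<in> J" "y \<in> cyl w" "y \<in> away a \<rho>" "slope a y \<in> J'"
        by blast
      obtain x' y' where x': "x' \<in> \<Lambda>" "x = Sw w x'" and y': "y' \<in> \<Lambda>" "y = Sw w y'" using xy by (auto simp: cyl_def)
      have "dist x y = rw w * dist x' y'" using dist_Sw words_lists[OF w] x' y' by simp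
      also have "\<dots> \<le> rw w * D"
        using D x' y' rw_pos[OF words_lists[OF w]] by (intro mult_left_mono) (auto simp: dist_norm)
      also have "\<dots> < \<delta>" using elim w D by (auto simp: field_simps)
      finally have "dist (slope a x) (slope a y) < d" using \<delta>(2) xy by blast
      then show False using d(2) xy by fastforce
    qed
  qed
qed

lemma sum_mass_le_1:
  assumes "finite C"
    and one: "\<And>w i j. w \<in> words n \<Longrightarrow> i \<in> C \<Longrightarrow> j \<in> C \<Longrightarrow> i \<noteq> j \<Longrightarrow>
      cyl w \<inter> away a \<rho> \<inter> slope a -` J i = {} \<or> cyl w \<inter> away a \<rho> \<inter> slope a -` J j = {}"
  shows "(\<Sum>i\<in>C. mass a \<rho> n (J i)) \<le> 1"
proof -
  let ?W = "\<lambda>i. {w \<in> words n. cyl w \<inter> away a \<rho> \<inter> slope a -` J i \<noteq> {}}"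
  have "\<forall>i\<in>C. \<forall>j\<in>C. i \<noteq> j \<longrightarrow> ?W i \<inter> ?W j = {}"
    using one by blast
  then have "(\<Sum>i\<in>C. mass a \<rho> n (J i)) = sum rw (\<Union>i\<in>C. ?W i)"
    unfolding mass_def using \<open>finite C\<close> finite_words[of n] by (intro sum.UNION_disjoint[symmetric]) auto
  also have "\<dots> \<le> (\<Sum>w\<in>words n. rw w)"
    using finite_words rw_pos words_lists by (intro sum_mono2) (auto simp: less_imp_le)
  also have "\<dots> \<le> 1" by (rule sum_rw_le_1)
  finally show ?thesis .
qed

text \<open>Each ball has its own threshold for \<open>n\<close>. Only finite disjoint families have
  to be bounded, so a common \<open>n\<close> exists; the masses then sum to at most 1, and the
  final bound no longer mentions \<open>n\<close>.\<close>

lemma negligible_slope_zero_shadow: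
  assumes "0 < \<rho>"
  shows "negligible {\<beta> \<in> slope a ` away a \<rho>. shadow (dir \<beta>) = 0}"
  unfolding negligible_outer_le
proof (intro allI impI)
  let ?E = "slope a ` away a \<rho>"
  let ?m = "measure lebesgue"
  fix \<epsilon> :: real assume "0 < \<epsilon>"
  have E: "?E \<in> sets lebesgue"
    by (intro fmeasurableD lmeasurable_compact compact_continuous_image continuous_slope compact_away \<open>0 < \<rho>\<close>)
  show "\<exists>W. {\<beta> \<in> ?E. shadow (dir \<beta>) = 0} \<subseteq> W \<and> W \<in> lmeasurable \<and> ?m W \<le> \<epsilon>"
  proof (rule vitali_outer_measure_le[OF _ E, where
        P = "\<lambda>\<beta> R. \<forall>\<^sub>F n in sequentially. ?m (?E \<inter> cball \<beta> R) \<le> \<epsilon> * mass a \<rho> n (cball \<beta> R)"])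
    fix \<beta> d :: real
    assume "\<beta> \<in> {\<beta> \<in> ?E. shadow (dir \<beta>) = 0}" "0 < d"
    then obtain r0 where "0 < r0" "\<And>R. R < r0 \<Longrightarrow> \<forall>\<^sub>F n in sequentially. ?m (?E \<inter> cball \<beta> R) \<le> \<epsilon> * mass a \<rho> n (cball \<beta> R)"
      using measure_slope_le_mass[OF _ \<open>0 < \<rho>\<close> \<open>0 < \<epsilon>\<close>] by blast
    then show "\<exists>R>0. R < d \<and> (\<forall>\<^sub>F n in sequentially. ?m (?E \<inter> cball \<beta> R) \<le> \<epsilon> * mass a \<rho> n (cball \<beta> R))"
      using \<open>0 < d\<close> by (intro exI[of _ "min d r0 / 2"]) auto
  next
    fix C :: "(real \<times> real) set"
    let ?J = "\<lambda>i. cball (fst i) (snd i)"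
    assume C: "finite C" "pairwise (\<lambda>i j. disjnt (?J i) (?J j)) C"
      and P: "\<And>\<beta> R. (\<beta>, R) \<in> C \<Longrightarrow> \<beta> \<in> {\<beta> \<in> ?E. shadow (dir \<beta>) = 0} \<and> 0 < R \<and>
        (\<forall>\<^sub>F n in sequentially. ?m (?E \<inter> cball \<beta> R) \<le> \<epsilon> * mass a \<rho> n (cball \<beta> R))"
    have "\<forall>\<^sub>F n in sequentially. \<forall>i\<in>C. ?m (?E \<inter> ?J i) \<le> \<epsilon> * mass a \<rho> n (?J i)"
      using C(1) P by (intro eventually_ball_finite) auto
    moreover have "\<forall>\<^sub>F n in sequentially. \<forall>i\<in>C. \<forall>j\<in>C. i \<noteq> j \<longrightarrow> (\<forall>w\<in>words n.
        cyl w \<inter> away a \<rho> \<inter> slope a -` ?J i = {} \<or> cyl w \<inter> away a \<rho> \<inter> slope a -` ?J j = {})"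
    proof (intro eventually_ball_finite[OF C(1)] ballI)
      fix i j assume "i \<in> C" "j \<in> C"
      show "\<forall>\<^sub>F n in sequentially. i \<noteq> j \<longrightarrow> (\<forall>w\<in>words n.
        cyl w \<inter> away a \<rho> \<inter> slope a -` ?J i = {} \<or> cyl w \<inter> away a \<rho> \<inter> slope a -` ?J j = {})"
      proof (cases "i = j")
        case False
        then have "?J i \<inter> ?J j = {}"
          using C(2) \<open>i \<in> C\<close> \<open>j \<in> C\<close> by (auto simp: pairwise_def disjnt_def)
        from eventually_hit_one[OF \<open>0 < \<rho>\<close> _ _ this] show ?thesis
          by (rule eventually_mono) auto
      qed simp
    qed
    ultimately have "\<forall>\<^sub>F n in sequentially. (\<Sum>(\<beta>, R)\<in>C. ?m (?E \<inter> cball \<beta> R)) \<le> \<epsilon>"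
    proof eventually_elim
      case (elim n)
      have "(\<Sum>(\<beta>, R)\<in>C. ?m (?E \<inter> cball \<beta> R)) \<le> (\<Sum>i\<in>C. \<epsilon> * mass a \<rho> n (?J i))"
        unfolding case_prod_unfold using elim(1) by (intro sum_mono) auto
      also have "\<dots> = \<epsilon> * (\<Sum>i\<in>C. mass a \<rho> n (?J i))" by (simp add: sum_distrib_left)
      also have "\<dots> \<le> \<epsilon> * 1"
        using \<open>0 < \<epsilon>\<close> elim(2) C(1) by (intro mult_left_mono sum_mass_le_1) auto
      finally show ?case by simp
    qed
    then show "(\<Sum>(\<beta>, R)\<in>C. ?m (?E \<inter> cball \<beta> R)) \<le> \<epsilon>" by simp
  qed auto
qed

theorem negligible_slope: "negligible (slope a ` {x \<in> \<Lambda>. (x - a) $ 2 \<noteq> 0})"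
proof -
  have neg: "negligible (slope a ` away a \<rho>)" if "0 < \<rho>" for \<rho>
  proof (rule negligible_subset)
    show "negligible ({\<beta> \<in> slope a ` away a \<rho>. shadow (dir \<beta>) = 0} \<union> {\<beta>. 0 < shadow (dir \<beta>)})"
      using negligible_slope_zero_shadow[OF that] negligible_positive_shadow by (rule negligible_Un)
    show "slope a ` away a \<rho> \<subseteq> {\<beta> \<in> slope a ` away a \<rho>. shadow (dir \<beta>) = 0} \<union> {\<beta>. 0 < shadow (dir \<beta>)}"
      using shadow_nonneg by (auto simp: order_less_le)
  qed
  have "negligible (\<Union>n. slope a ` away a (inverse (real (Suc n))))"
    by (intro negligible_Union_nat neg) simp
  moreover have "slope a ` {x \<in> \<Lambda>. (x - a) $ 2 \<noteq> 0} \<subseteq> (\<Union>n. slope a ` away a (inverse (real (Suc n))))"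
  proof clarify
    fix x assume "x \<in> \<Lambda>" "(x - a) $ 2 \<noteq> 0"
    then obtain n where "inverse (real (Suc n)) < \<bar>(x - a) $ 2\<bar>" using reals_Archimedean[of "\<bar>(x - a) $ 2\<bar>"] by auto
    then show "slope a x \<in> (\<Union>n. slope a ` away a (inverse (real (Suc n))))"
      using \<open>x \<in> \<Lambda>\<close> by (auto simp: away_def intro!: exI[of _ n] imageI)
  qed
  ultimately show ?thesis by (rule negligible_subset)
qed

end

section \<open>From null sets of slopes to null sets on the circle\<close>

lemma hausdorff1_Lipschitz_image_negligible:
  fixes f :: "real \<Rightarrow> 'b::real_normed_vector"
  assumes N: "negligible N" "N \<subseteq> cbox a b" and L: "0 < L" "\<And>s t. norm (f s - f t) \<le> L * \<bar>s - t\<bar>"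
  shows "hausdorff1 (f ` N) = 0"
proof -
  have "hausdorff1_delta \<delta> (f ` N) \<le> 0" if "0 < \<delta>" for \<delta> :: real
  proof (rule ennreal_le_epsilon)
    fix \<epsilon> :: real assume "0 < \<epsilon>"
    \<comment> \<open>The total length \<open>e\<close> also bounds each single interval, so the
      images obey the diameter limit \<delta> as well as the total \<epsilon>.\<close>
    define e where "e = min \<delta> \<epsilon> / L"
    have e: "0 < e" "L * e \<le> \<delta>" "L * e \<le> \<epsilon>" using \<open>0 < \<delta>\<close> \<open>0 < \<epsilon>\<close> L(1) by (auto simp: e_def)
    obtain \<D> where \<D>: "countable \<D>" "\<And>K. K \<in> \<D> \<Longrightarrow> K \<noteq> {} \<and> (\<exists>c d. K = cbox c d)"
        "pairwise (\<lambda>A B. interior A \<inter> interior B = {}) \<D>"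
        "N \<subseteq> \<Union>\<D>" "\<Union>\<D> \<in> lmeasurable" "measure lebesgue (\<Union>\<D>) \<le> measure lebesgue N + e"
      using measurable_outer_intervals_bounded[OF negligible_imp_measurable[OF N(1)] N(2) e(1)] by metis
    have lm: "K \<in> lmeasurable" if "K \<in> \<D>" for K using \<D>(2)[OF that] by auto
    have sum_le: "(\<Sum>K\<in>F. measure lebesgue K) \<le> e" if F: "finite F" "F \<subseteq> \<D>" for F
    proof -
      have "pairwise (\<lambda>S T. negligible (S \<inter> T)) F"
      proof (rule pairwiseI)
        fix A B assume AB: "A \<in> F" "B \<in> F" "A \<noteq> B"
        then have "interior A \<inter> interior B = {}" using \<D>(3) F by (auto simp: pairwise_def)
        moreover have "convex A" "convex B" using \<D>(2) AB F by (metis convex_box(1) subsetD)+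
        ultimately show "negligible (A \<inter> B)" by (simp add: negligible_convex_interior convex_Int)
      qed
      then have "(\<Sum>K\<in>F. measure lebesgue K) = measure lebesgue (\<Union>F)"
        using F lm by (intro measure_negligible_finite_Union[symmetric]) auto
      also have "\<dots> \<le> measure lebesgue (\<Union>\<D>)"
        using F lm \<D>(5) by (intro measure_mono_fmeasurable) (auto intro!: fmeasurableD fmeasurable.finite_Union)
      also have "\<dots> \<le> e" using \<D>(6) negligible_imp_measure0[OF N(1)] by simp
      finally show ?thesis .
    qed
    have diam: "bounded (f ` K)" "diameter (f ` K) \<le> L * measure lebesgue K" if KD: "K \<in> \<D>" for K
    proof -
      obtain c d where K: "K = {c..d}" "c \<le> d" using \<D>(2)[OF KD] by (metis atLeastatMost_empty_iff cbox_interval)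
      have le: "norm (f s - f t) \<le> L * (d - c)" if "s \<in> K" "t \<in> K" for s t
      proof -
        have "\<bar>s - t\<bar> \<le> d - c" using that K by auto
        then have "L * \<bar>s - t\<bar> \<le> L * (d - c)" using L(1) by simp
        then show ?thesis using L(2)[of s t] by linarith
      qed
      have "norm (f s) \<le> norm (f c) + L * (d - c)" if "s \<in> K" for s
        using le[OF that, of c] K norm_triangle_sub[of "f s" "f c"] by auto
      then show "bounded (f ` K)" by (auto simp: bounded_iff)
      show "diameter (f ` K) \<le> L * measure lebesgue K"
        using le K by (intro diameter_le) auto
    qed
    have diam_e: "L * measure lebesgue K \<le> L * e" if "K \<in> \<D>" for K
      using sum_le[of "{K}"] that L(1) by simp
    \<comment> \<open>The family may be finite; indices outside its enumeration get the empty set,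
      of diameter 0.\<close>
    define U where "U i = (if i \<in> to_nat_on \<D> ` \<D> then f ` from_nat_into \<D> i else {})" for i
    have mem: "from_nat_into \<D> i \<in> \<D>" if "i \<in> to_nat_on \<D> ` \<D>" for i using that \<D>(1) by auto
    have "hausdorff1_delta \<delta> (f ` N) \<le> (\<Sum>i. ennreal (diameter (U i)))"
      unfolding hausdorff1_delta_def
    proof (rule INF_lower, clarify, intro conjI allI)
      show "f ` N \<subseteq> (\<Union>i. U i)"
      proof clarify
        fix x assume "x \<in> N"
        then obtain K where "K \<in> \<D>" "x \<in> K" using \<D>(4) by auto
        then have "f x \<in> U (to_nat_on \<D> K)" using \<D>(1) by (simp add: U_def)
        then show "f x \<in> (\<Union>i. U i)" by blast
      qed
      show "bounded (U i)" for i using diam(1) mem by (auto simp: U_def)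
      show "diameter (U i) \<le> \<delta>" for i
      proof (cases "i \<in> to_nat_on \<D> ` \<D>")
        case True
        show ?thesis
          using diam(2)[OF mem[OF True]] diam_e[OF mem[OF True]] e(2) True by (simp add: U_def)
      qed (use \<open>0 < \<delta>\<close> in \<open>simp add: U_def\<close>)
    qed
    also have "\<dots> \<le> ennreal \<epsilon>"
    proof (rule suminf_le_const)
      fix n
      let ?J = "{..<n} \<inter> to_nat_on \<D> ` \<D>"
      have "(\<Sum>i<n. ennreal (diameter (U i))) = (\<Sum>i\<in>?J. ennreal (diameter (U i)))"
        by (rule sum.mono_neutral_right) (auto simp: U_def)
      also have "\<dots> \<le> (\<Sum>i\<in>?J. ennreal (L * measure lebesgue (from_nat_into \<D> i)))"
        using diam(2) mem by (intro sum_mono ennreal_leI) (auto simp: U_def)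
      also have "\<dots> = ennreal (\<Sum>i\<in>?J. L * measure lebesgue (from_nat_into \<D> i))"
        using L(1) by (intro sum_ennreal) auto
      also have "(\<Sum>i\<in>?J. L * measure lebesgue (from_nat_into \<D> i)) = L * (\<Sum>K\<in>from_nat_into \<D> ` ?J. measure lebesgue K)"
      proof -
        have "inj_on (from_nat_into \<D>) ?J" using \<D>(1) by (auto simp: inj_on_def)
        then show ?thesis by (simp add: sum.reindex sum_distrib_left)
      qed
      also have "\<dots> \<le> L * e"
        using mem L(1) by (intro mult_left_mono sum_le) auto
      finally show "(\<Sum>i<n. ennreal (diameter (U i))) \<le> ennreal \<epsilon>"
        using e(3) by (meson ennreal_leI order_trans)
    qed simp
    finally show "hausdorff1_delta \<delta> (f ` N) \<le> 0 + ennreal \<epsilon>" by simp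
  qed
  then have "hausdorff1 (f ` N) \<le> 0"
    unfolding hausdorff1_def by (intro SUP_least) auto
  then show ?thesis by simp
qed

lemma hausdorff1_mono:
  assumes "A \<subseteq> B"
  shows "hausdorff1 A \<le> hausdorff1 B"
  unfolding hausdorff1_def hausdorff1_delta_def
  using assms by (intro SUP_mono' INF_superset_mono) auto

definition unit_vec :: "real \<Rightarrow> real^2" where
  "unit_vec \<theta> = vector [cos \<theta>, sin \<theta>]"

lemma unit_vec_Lipschitz: "norm (unit_vec s - unit_vec t) \<le> 2 * \<bar>s - t\<bar>"
proof -
  have half: "\<bar>sin ((s - t) / 2)\<bar> \<le> \<bar>s - t\<bar> / 2" "\<bar>sin ((t - s) / 2)\<bar> \<le> \<bar>s - t\<bar> / 2"
    using abs_sin_x_le_abs_x[of "(s - t) / 2"] abs_sin_x_le_abs_x[of "(t - s) / 2"] by (auto simp: abs_minus_commute)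
  have "\<bar>cos s - cos t\<bar> = 2 * (\<bar>sin ((s + t) / 2)\<bar> * \<bar>sin ((t - s) / 2)\<bar>)"
    by (simp add: cos_diff_cos abs_mult)
  also have "\<dots> \<le> 2 * (1 * (\<bar>s - t\<bar> / 2))"
    using half by (intro mult_left_mono mult_mono) auto
  finally have 1: "\<bar>cos s - cos t\<bar> \<le> \<bar>s - t\<bar>" by simp
  have "\<bar>sin s - sin t\<bar> = 2 * (\<bar>sin ((s - t) / 2)\<bar> * \<bar>cos ((s + t) / 2)\<bar>)"
    by (simp add: sin_diff_sin abs_mult)
  also have "\<dots> \<le> 2 * ((\<bar>s - t\<bar> / 2) * 1)"
    using half by (intro mult_left_mono mult_mono) auto
  finally have 2: "\<bar>sin s - sin t\<bar> \<le> \<bar>s - t\<bar>" by simp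
  have "norm (unit_vec s - unit_vec t) \<le> \<bar>cos s - cos t\<bar> + \<bar>sin s - sin t\<bar>"
    using norm_le_l1_cart[of "unit_vec s - unit_vec t"] by (simp add: sum_2 unit_vec_def)
  then show ?thesis using 1 2 by simp
qed

text \<open>The slope fixes the line through \<open>a\<close> and \<open>x\<close>, orthogonal to
  the direction of angle \<open>arctan (slope a x)\<close>; the two angles are its two rays. Writing
  \<open>3 * pi / 2\<close> instead of \<open>- pi / 2\<close> keeps all angles in one bounded
  interval.\<close>

lemma radial_projection_eq_unit_vec:
  assumes "(x - a) $ 2 \<noteq> 0"
  shows "radial_projection a x \<in> {unit_vec (arctan (slope a x) + pi / 2), unit_vec (arctan (slope a x) + 3 * pi / 2)}"
proof -
  define p q where "p = (x - a) $ 1" and "q = (x - a) $ 2"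
  define \<beta> where "\<beta> = - (p / q)"
  have q: "q \<noteq> 0" using assms by (simp add: q_def)
  have s: "slope a x = \<beta>" by (simp add: slope_def \<beta>_def p_def q_def)
  have "norm (x - a) = sqrt (p\<^sup>2 + q\<^sup>2)"
    by (simp add: norm_vec_def L2_set_def sum_2 p_def q_def)
  also have "p\<^sup>2 + q\<^sup>2 = q\<^sup>2 * (1 + \<beta>\<^sup>2)" using q by (simp add: \<beta>_def field_simps power2_eq_square)
  also have "sqrt (q\<^sup>2 * (1 + \<beta>\<^sup>2)) = \<bar>q\<bar> * sqrt (1 + \<beta>\<^sup>2)" by (simp add: real_sqrt_mult)
  finally have n: "norm (x - a) = \<bar>q\<bar> * sqrt (1 + \<beta>\<^sup>2)" .
  have p: "p = - \<beta> * q" using q by (simp add: \<beta>_def)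
  have pos: "0 < sqrt (1 + \<beta>\<^sup>2)" by (simp add: add_pos_nonneg)
  have rp: "radial_projection a x $ 1 = - \<beta> * q / (\<bar>q\<bar> * sqrt (1 + \<beta>\<^sup>2))"
    "radial_projection a x $ 2 = q / (\<bar>q\<bar> * sqrt (1 + \<beta>\<^sup>2))"
    using n p by (simp_all add: radial_projection_def p_def q_def divide_inverse mult.commute)
  have u1: "unit_vec (arctan \<beta> + pi / 2) $ 1 = - \<beta> / sqrt (1 + \<beta>\<^sup>2)" "unit_vec (arctan \<beta> + pi / 2) $ 2 = 1 / sqrt (1 + \<beta>\<^sup>2)"
    by (simp_all add: unit_vec_def cos_add sin_add sin_arctan cos_arctan)
  have turn: "arctan \<beta> + 3 * pi / 2 = (arctan \<beta> + pi / 2) + pi" by simp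
  have opposite: "unit_vec (\<theta> + pi) $ i = - unit_vec \<theta> $ i" for \<theta> i
    using exhaust_2[of i] by (auto simp: unit_vec_def)
  have u2: "unit_vec (arctan \<beta> + 3 * pi / 2) $ 1 = \<beta> / sqrt (1 + \<beta>\<^sup>2)" "unit_vec (arctan \<beta> + 3 * pi / 2) $ 2 = - 1 / sqrt (1 + \<beta>\<^sup>2)"
    unfolding turn opposite u1 by simp_all
  show ?thesis
  proof (cases "0 < q")
    case True
    then have "radial_projection a x = unit_vec (arctan \<beta> + pi / 2)"
      using rp u1 by (simp add: vec_eq_iff forall_2)
    then show ?thesis by (simp add: s)
  next
    case False
    then have "q < 0" using q by simp
    then have "radial_projection a x $ 1 = \<beta> / sqrt (1 + \<beta>\<^sup>2)" "radial_projection a x $ 2 = - 1 / sqrt (1 + \<beta>\<^sup>2)"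
      unfolding rp using pos by (simp_all add: divide_simps)
    then have "radial_projection a x = unit_vec (arctan \<beta> + 3 * pi / 2)"
      unfolding vec_eq_iff forall_2 u2 by simp
    then show ?thesis by (simp add: s)
  qed
qed

lemma radial_projection_horizontal:
  assumes "(x - a) $ 2 = 0" "x \<noteq> a"
  shows "radial_projection a x \<in> {unit_vec 0, unit_vec pi}"
proof -
  define p where "p = (x - a) $ 1"
  have p: "p \<noteq> 0" using assms by (auto simp: p_def vec_eq_iff forall_2)
  have "norm (x - a) = \<bar>p\<bar>" using assms(1) by (simp add: norm_vec_def L2_set_def sum_2 p_def)
  then have "radial_projection a x $ 1 = p / \<bar>p\<bar>" "radial_projection a x $ 2 = 0"
    using assms(1) by (simp_all add: radial_projection_def p_def divide_inverse mult.commute)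
  then show ?thesis using p by (cases "0 < p") (auto simp: unit_vec_def vec_eq_iff forall_2)
qed

lemma invisible_from_if_negligible_slope:
  assumes neg: "negligible (slope a ` {x \<in> A. (x - a) $ 2 \<noteq> 0})"
  shows "invisible_from A a"
proof -
  let ?N = "slope a ` {x \<in> A. (x - a) $ 2 \<noteq> 0}"
  \<comment> \<open>The angles 0 and \<open>pi\<close> account for the points at the height of
    \<open>a\<close>, which \<open>slope\<close> does not describe.\<close>
  let ?M = "(\<lambda>\<beta>. arctan \<beta> + pi / 2) ` ?N \<union> (\<lambda>\<beta>. arctan \<beta> + 3 * pi / 2) ` ?N \<union> {0, pi}"
  have neg_arctan: "negligible ((\<lambda>\<beta>. arctan \<beta> + c) ` ?N)" for c
  proof (rule negligible_differentiable_image_negligible[OF _ neg])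
    have "((\<lambda>\<beta>. arctan \<beta> + c) has_real_derivative inverse (1 + \<beta>\<^sup>2) + 0) (at \<beta> within ?N)" for \<beta>
      by (intro DERIV_add DERIV_const has_field_derivative_at_within[OF DERIV_arctan])
    then show "(\<lambda>\<beta>. arctan \<beta> + c) differentiable_on ?N"
      unfolding differentiable_on_def real_differentiable_def by blast
  qed simp
  have neg_M: "negligible ?M"
    by (rule negligible_Un[OF negligible_Un[OF neg_arctan neg_arctan] negligible_finite]) simp
  have sub_M: "?M \<subseteq> cbox 0 (2 * pi)"
  proof -
    have "- (pi / 2) < arctan \<beta>" "arctan \<beta> < pi / 2" for \<beta> by (rule arctan_lbound, rule arctan_ubound)
    then have "0 \<le> arctan \<beta> + pi / 2" "arctan \<beta> + pi / 2 \<le> 2 * pi" "0 \<le> arctan \<beta> + 3 * pi / 2" "arctan \<beta> + 3 * pi / 2 \<le> 2 * pi" for \<beta>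
      using pi_gt_zero by (smt (verit, best) field_sum_of_halves)+
    then show ?thesis using pi_ge_zero by auto
  qed
  have null: "hausdorff1 (unit_vec ` ?M) = 0"
    by (rule hausdorff1_Lipschitz_image_negligible[OF neg_M sub_M _ unit_vec_Lipschitz]) simp
  have "radial_projection a ` (A - {a}) \<subseteq> unit_vec ` ?M"
  proof (rule image_subsetI)
    fix x assume "x \<in> A - {a}"
    then have x: "x \<in> A" "x \<noteq> a" by auto
    show "radial_projection a x \<in> unit_vec ` ?M"
    proof (cases "(x - a) $ 2 = 0")
      case True
      then show ?thesis using radial_projection_horizontal[OF True x(2)] by auto
    next
      case False
      then have "slope a x \<in> ?N" using x by blast
      then show ?thesis using radial_projection_eq_unit_vec[OF False] by blast
    qed
  qed
  from hausdorff1_mono[OF this] have "hausdorff1 (radial_projection a ` (A - {a})) \<le> 0"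
    unfolding null .
  then show ?thesis by (simp add: invisible_from_def)
qed

theorem theorem1p1:
  fixes S :: "nat \<Rightarrow> real^2 \<Rightarrow> real^2" and m :: nat and \<Lambda> :: "(real^2) set"
  assumes "\<And>i. i \<in> {1..m} \<Longrightarrow> contracting_similitude (S i)"
    and "open_set_condition m S"
    and "is_self_similar_set m S \<Lambda>"
    and "0 < hausdorff1 \<Lambda>"
    and "hausdorff1 \<Lambda> < \<infinity>"
    and "\<not> collinear \<Lambda>"
  shows "\<forall>a. invisible_from \<Lambda> a"
proof -
  have "\<forall>i\<in>{1..m}. \<exists>p. case p of (r, T, b) \<Rightarrow>
      0 < r \<and> r < 1 \<and> orthogonal_transformation T \<and> (\<forall>x. S i x = r *\<^sub>R T x + b)"
    using assms(1) by (auto simp: contracting_similitude_def)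
  from bchoice[OF this] obtain p where p: "\<forall>i\<in>{1..m}. case p i of (r, T, b) \<Rightarrow>
      0 < r \<and> r < 1 \<and> orthogonal_transformation T \<and> (\<forall>x. S i x = r *\<^sub>R T x + b)" by blast
  define r where "r i = fst (p i)" for i
  define T where "T i = fst (snd (p i))" for i
  define b where "b i = snd (snd (p i))" for i
  have S: "0 < r i" "r i < 1" "orthogonal_transformation (T i)" "S i = (\<lambda>x. r i *\<^sub>R T i x + b i)"
    if "i \<in> {1..m}" for i
    using p that by (auto simp: r_def T_def b_def case_prod_unfold fun_eq_iff)
  have \<Lambda>: "compact \<Lambda>" "\<Lambda> \<noteq> {}" "\<Lambda> = (\<Union>i\<in>{1..m}. S i ` \<Lambda>)"
    using assms(3) by (auto simp: is_self_similar_set_def)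
  have "(\<Union>i\<in>{1..m}. S i ` \<Lambda>) = (\<Union>i\<in>{1..m}. (\<lambda>x. r i *\<^sub>R T i x + b i) ` \<Lambda>)"
    using S(4) by (intro SUP_cong) auto
  then interpret similitude_system "{1..m}" r T b \<Lambda>
    using S \<Lambda> by unfold_locales auto
  obtain V where V: "V \<noteq> {}" "open V" "\<forall>i\<in>{1..m}. S i ` V \<subseteq> V"
      "\<forall>i\<in>{1..m}. \<forall>j\<in>{1..m}. i \<noteq> j \<longrightarrow> S i ` V \<inter> S j ` V = {}"
    using assms(2) unfolding open_set_condition_def by blast
  have "(\<Sum>i\<in>{1..m}. r i) \<le> 1"
  proof (rule sum_ratio_le_1_if_open_set_condition[OF _ V(2,1) _ assms(4,5)])
    show "(\<lambda>x. r i *\<^sub>R T i x + b i) ` V \<subseteq> V" if "i \<in> {1..m}" for i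
      using V(3) S(4)[OF that] that by metis
    show "(\<lambda>x. r i *\<^sub>R T i x + b i) ` V \<inter> (\<lambda>x. r j *\<^sub>R T j x + b j) ` V = {}"
      if "i \<in> {1..m}" "j \<in> {1..m}" "i \<noteq> j" for i j
      using V(4) S(4)[OF that(1)] S(4)[OF that(2)] that by metis
  qed
  then interpret planar_similitude_system "{1..m}" r T b \<Lambda>
    using assms(6) by unfold_locales
  show ?thesis
    using invisible_from_if_negligible_slope[OF negligible_slope] by blast
qed

end
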